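(* Let $(X,d,\mu)$ be as in the context, fix $x\in X$ and $0<R_0<\frac14\operatorname{diam}X$, write $B_r=B(x,r)$, let $1<p<\infty$, and assume that $\mu$ is globally doubling and that $X$ supports a global $p_0$-Poincaré inequality for some $1\le p_0<p$. (i) If $p=\max\underline{Q}_0(x)$ and $0<2r\le R\le R_0$, then $\frac{\mu(B_r)}{r^p}\big(\log\frac Rr\big)^{1-p}\lesssim\operatorname{cap}_p(B_r,B_R)\lesssim\frac{\mu(B_R)}{R^p}\big(\log\frac Rr\big)^{1-p}$. (ii) If $p=\min\overline{Q}_0(x)$ and $0<2r\le R\le R_0$, then $\frac{\mu(B_R)}{R^p}\big(\log\frac Rr\big)^{1-p}\lesssim\operatorname{cap}_p(B_r,B_R)\lesssim\frac{\mu(B_r)}{r^p}\big(\log\frac Rr\big)^{1-p}$. Moreover, if the lower bound in (i) holds for all $0<2r\le R\le R_0$, then $p\le\sup\underline{Q}_0(x)$, and if the lower bound in (ii) holds for all $0<2r\le R\le R_0$, then $p\ge\inf\overline{Q}_0(x)$.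
   Context: $(X,d,\mu)$ is a metric space with a positive complete Borel measure $\mu$ such that $0<\mu(B)<\infty$ for every ball $B$. $\mu$ is globally doubling if there is $C$ with $\mu(B(y,2r))\le C\mu(B(y,r))$ for all $y$, $r>0$. Upper gradients: a nonnegative Borel $g$ with $|f(\gamma(0))-f(\gamma(l_\gamma))|\le\int_\gamma g\,ds$ for all nonconstant compact rectifiable curves; $p$-weak upper gradients: same for all curves outside a family of zero $p$-modulus; $g_u$ is the minimal $p$-weak upper gradient. $N^{1,p}(X)$: everywhere-defined measurable $f$ with $\int|f|^p\,d\mu+\inf_g\int g^p\,d\mu<\infty$; $N^{1,p}_0(\Omega)=\{f|_\Omega: f\in N^{1,p}(X), f=0\text{ on }X\setminus\Omega\}$; $\operatorname{cap}_p(E,\Omega)=\inf\{\int_\Omega g_u^p\,d\mu: u\in N^{1,p}_0(\Omega),\ u\ge1\text{ on }E\}$. A global $p_0$-Poincaré inequality: there are $C,\lambda\ge1$ with $\frac1{\mu(B)}\int_B|f-f_B|\,d\mu\le Cr\big(\frac1{\mu(\lambda B)}\int_{\lambda B}g^{p_0}\,d\mu\big)^{1/p_0}$ for all balls $B$ of radius $r$, integrable $f$ and upper gradients $g$ of $f$. $\underline{Q}_0(x)=\{q>0:\exists C_q,\ \mu(B_r)/\mu(B_R)\le C_q(r/R)^q\text{ for }0<r<R\le1\}$, $\overline{Q}_0(x)=\{q>0:\exists C_q,\ \mu(B_r)/\mu(B_R)\ge C_q(r/R)^q\text{ for }0<r<R\le1\}$. $a\lesssim b$ means $a\le Cb$ with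 $C$ independent of $r,R$ (possibly depending on $R_0$, $p$, $x$ and the data). *)

theory Defs
  imports "HOL-Analysis.Analysis"
begin

definition mms :: "'a::metric_space measure \<Rightarrow> bool" where
  "mms M \<longleftrightarrow> space M = UNIV \<and> sets borel \<subseteq> sets M \<and> complete_measure M \<and>
     (\<forall>y r. 0 < r \<longrightarrow> 0 < emeasure M (ball y r) \<and> emeasure M (ball y r) < \<infinity>)"

definition globally_doubling :: "'a::metric_space measure \<Rightarrow> bool" where
  "globally_doubling M \<longleftrightarrow>
     (\<exists>C. \<forall>y r. 0 < r \<longrightarrow> emeasure M (ball y (2*r)) \<le> ennreal C * emeasure M (ball y r))"

definition diam_X :: "'a::metric_space itself \<Rightarrow> ereal" where
  "diam_X _ = (SUP xy \<in> (UNIV::('a \<times> 'a) set). ereal (dist (fst xy) (snd xy)))"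

definition epow :: "ennreal \<Rightarrow> real \<Rightarrow> ennreal" where
  "epow a q = (if a = \<infinity> then \<infinity> else ennreal (enn2real a powr q))"

definition curve_length :: "(real \<Rightarrow> 'a::metric_space) \<Rightarrow> real \<Rightarrow> real \<Rightarrow> ereal" where
  "curve_length \<gamma> a b =
     (SUP ts \<in> {ts. ts \<noteq> [] \<and> sorted ts \<and> hd ts = a \<and> last ts = b}.
        ereal (\<Sum>i<length ts - 1. dist (\<gamma> (ts ! i)) (\<gamma> (ts ! Suc i))))"

text \<open>Nonconstant compact rectifiable curves, parametrized by arc length on [0,l].\<close>
definition arc_curve :: "(real \<Rightarrow> 'a::metric_space) \<Rightarrow> real \<Rightarrow> bool" where
  "arc_curve \<gamma> l \<longleftrightarrow> 0 < l \<and>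
     (\<forall>s t. 0 \<le> s \<and> s \<le> t \<and> t \<le> l \<longrightarrow> curve_length \<gamma> s t = ereal (t - s))"

definition line_integral :: "('a::metric_space \<Rightarrow> ennreal) \<Rightarrow> (real \<Rightarrow> 'a) \<Rightarrow> real \<Rightarrow> ennreal" where
  "line_integral g \<gamma> l = (\<integral>\<^sup>+ t. g (\<gamma> t) * indicator {0..l} t \<partial>lborel)"

definition p_modulus :: "'a::metric_space measure \<Rightarrow> real \<Rightarrow> ((real \<Rightarrow> 'a) \<times> real) set \<Rightarrow> ennreal" where
  "p_modulus M p \<Gamma> = (INF \<rho> \<in> {\<rho>. \<rho> \<in> borel_measurable borel \<and>
        (\<forall>(\<gamma>,l)\<in>\<Gamma>. 1 \<le> line_integral \<rho> \<gamma> l)}. \<integral>\<^sup>+ y. epow (\<rho> y) p \<partial>M)"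

definition upper_gradient :: "('a::metric_space \<Rightarrow> real) \<Rightarrow> ('a \<Rightarrow> ennreal) \<Rightarrow> bool" where
  "upper_gradient f g \<longleftrightarrow> g \<in> borel_measurable borel \<and>
     (\<forall>\<gamma> l. arc_curve \<gamma> l \<longrightarrow> ennreal \<bar>f (\<gamma> 0) - f (\<gamma> l)\<bar> \<le> line_integral g \<gamma> l)"

definition p_weak_upper_gradient ::
  "'a::metric_space measure \<Rightarrow> real \<Rightarrow> ('a \<Rightarrow> real) \<Rightarrow> ('a \<Rightarrow> ennreal) \<Rightarrow> bool" where
  "p_weak_upper_gradient M p f g \<longleftrightarrow> g \<in> borel_measurable borel \<and>
     (\<exists>\<Gamma>. p_modulus M p \<Gamma> = 0 \<and>
        (\<forall>\<gamma> l. arc_curve \<gamma> l \<and> (\<gamma>, l) \<notin> \<Gamma> \<longrightarrow>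
           ennreal \<bar>f (\<gamma> 0) - f (\<gamma> l)\<bar> \<le> line_integral g \<gamma> l))"

definition minimal_p_weak_upper_gradient ::
  "'a::metric_space measure \<Rightarrow> real \<Rightarrow> ('a \<Rightarrow> real) \<Rightarrow> ('a \<Rightarrow> ennreal) \<Rightarrow> bool" where
  "minimal_p_weak_upper_gradient M p f g \<longleftrightarrow>
     p_weak_upper_gradient M p f g \<and> (\<integral>\<^sup>+ y. epow (g y) p \<partial>M) < \<infinity> \<and>
     (\<forall>g'. p_weak_upper_gradient M p f g' \<and> (\<integral>\<^sup>+ y. epow (g' y) p \<partial>M) < \<infinity> \<longrightarrow>
        (AE y in M. g y \<le> g' y))"

definition newtonian :: "'a::metric_space measure \<Rightarrow> real \<Rightarrow> ('a \<Rightarrow> real) \<Rightarrow> bool" where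
  "newtonian M p f \<longleftrightarrow> f \<in> borel_measurable M \<and>
     (\<integral>\<^sup>+ y. ennreal (\<bar>f y\<bar> powr p) \<partial>M) < \<infinity> \<and>
     (\<exists>g. upper_gradient f g \<and> (\<integral>\<^sup>+ y. epow (g y) p \<partial>M) < \<infinity>)"

text \<open>Variational capacity cap_p(E, Omega). Elements of N^{1,p}_0(Omega) are represented
  by their zero extensions u in N^{1,p}(X); g ranges over minimal p-weak upper gradients g_u
  (determined a.e., so the integral is that of g_u).\<close>
definition cap_p :: "'a::metric_space measure \<Rightarrow> real \<Rightarrow> 'a set \<Rightarrow> 'a set \<Rightarrow> ennreal" where
  "cap_p M p E \<Omega> = (INF ug \<in> {(u, g). newtonian M p u \<and> (\<forall>y. y \<notin> \<Omega> \<longrightarrow> u y = 0) \<and>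
        (\<forall>y\<in>E. 1 \<le> u y) \<and> minimal_p_weak_upper_gradient M p u g}.
      \<integral>\<^sup>+ y. epow (snd ug y) p * indicator \<Omega> y \<partial>M)"

definition avg :: "'a measure \<Rightarrow> 'a set \<Rightarrow> ('a \<Rightarrow> real) \<Rightarrow> real" where
  "avg M B f = (\<integral>y\<in>B. f y \<partial>M) / measure M B"

definition global_poincare :: "'a::metric_space measure \<Rightarrow> real \<Rightarrow> bool" where
  "global_poincare M p0 \<longleftrightarrow> (\<exists>C lam. 1 \<le> C \<and> 1 \<le> lam \<and>
     (\<forall>y r f g. 0 < r \<and> f \<in> borel_measurable M \<and> set_integrable M (ball y r) f \<and>
        upper_gradient f g \<longrightarrow>
        ennreal ((\<integral>z\<in>ball y r. \<bar>f z - avg M (ball y r) f\<bar> \<partial>M) / measure M (ball y r))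
        \<le> ennreal (C * r) *
          epow ((\<integral>\<^sup>+ z. epow (g z) p0 * indicator (ball y (lam*r)) z \<partial>M)
                / ennreal (measure M (ball y (lam*r)))) (1/p0)))"

definition lowerQ0 :: "'a::metric_space measure \<Rightarrow> 'a \<Rightarrow> real set" where
  "lowerQ0 M x = {q. 0 < q \<and> (\<exists>C>0. \<forall>r R. 0 < r \<and> r < R \<and> R \<le> 1 \<longrightarrow>
       measure M (ball x r) / measure M (ball x R) \<le> C * (r/R) powr q)}"

definition upperQ0 :: "'a::metric_space measure \<Rightarrow> 'a \<Rightarrow> real set" where
  "upperQ0 M x = {q. 0 < q \<and> (\<exists>C>0. \<forall>r R. 0 < r \<and> r < R \<and> R \<le> 1 \<longrightarrow>
       measure M (ball x r) / measure M (ball x R) \<ge> C * (r/R) powr q)}"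

end

theory Submission
  imports Defs
begin

text \<open>
  Write \<open>B\<^sub>k\<close> for the balls of radius \<open>2\<^sup>k r\<close> about \<open>x\<close>, up to radius comparable to \<open>R\<close>; their number \<open>n\<close> is
  comparable to \<open>ln (R / r)\<close>. Both capacity estimates have the form \<open>n\<close> to the power \<open>1 - p\<close> times an extremal value
  of \<open>\<mu>(B\<^sub>k)\<close> divided by the \<open>p\<close>-th power of the radius, and the exponent hypothesis says that this extremum is,
  up to a constant, attained at one end of the range of scales.

  Upper bound: test with a function decreasing by \<open>1 / n\<close> across each dyadic annulus.

  Lower bound: let \<open>u\<close> equal 1 on the inner ball and 0 off the outer one. A fixed proportion of some ball of
  radius comparable to \<open>R\<close> lies outside the outer ball, because the Poincare inequality makes the space connected.
  Compare the quantiles of \<open>u\<close> on consecutive \<open>B\<^sub>k\<close> by applying the Poincare inequality to truncations of \<open>u\<close>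
  between these quantiles. The gradients of the truncations have disjoint supports, so the power mean inequality
  over the \<open>n\<close> scales gives the sharp power of \<open>n\<close>.

  The converse statements follow from testing the capacity with a cutoff at a single scale, as a logarithm is
  dominated by every positive power.
\<close>

section \<open>Curves and line integrals\<close>

text \<open>The capacity is defined through minimal p-weak upper gradients, whereas the Poincare
  inequality speaks of genuine upper gradients with exponent \<open>p0\<close>. This mismatch shapes
  the proof twice. A test function counts in \<open>cap_p\<close> only if a minimal weak gradient
  exists, so its existence is proved by minimizing the energy; for the lower bound a weak gradient
  is turned into a genuine one by adding a density of small energy. The exponent is raised from
  \<open>p0\<close> to \<open>p\<close> once, in \<open>ex_poincare_space\<close>.

  The level-set argument uses radii between \<open>r / 2\<close> and \<open>8 * R\<close>: smoothing
  uses up half of the inner ball, and a ball of radius \<open>R / 2\<close> on which the function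
  vanishes has to fit inside the largest ball. The condition on the diameter supplies a point at
  distance at least \<open>2 * R\<close> from \<open>x\<close>. The exponent sets control only radii
  up to 1, so their growth bounds are extended to all radii up to \<open>8 * R0\<close>, with
  constants depending on \<open>x\<close> and \<open>R0\<close>; a doubling factor or
  \<open>8 powr p\<close> then absorbs the widened range of scales.\<close>

lemma arc_curve_dist_le:
  assumes "arc_curve \<gamma> l" "0 \<le> s" "s \<le> t" "t \<le> l"
  shows "dist (\<gamma> s) (\<gamma> t) \<le> t - s"
proof -
  have "ereal (dist (\<gamma> s) (\<gamma> t)) \<le> curve_length \<gamma> s t"
    unfolding curve_length_def
    by (rule SUP_upper2[where i="[s,t]"]) (use assms in auto)
  also have "\<dots> = ereal (t - s)"
    using assms by (auto simp: arc_curve_def)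
  finally show ?thesis by simp
qed

lemma arc_curve_dist_le_abs:
  assumes "arc_curve \<gamma> l" "s \<in> {0..l}" "t \<in> {0..l}"
  shows "dist (\<gamma> s) (\<gamma> t) \<le> \<bar>t - s\<bar>"
  using arc_curve_dist_le[OF assms(1), of s t] arc_curve_dist_le[OF assms(1), of t s] assms
  by (cases "s \<le> t") (auto simp: dist_commute)

lemma arc_curve_continuous:
  assumes "arc_curve \<gamma> l"
  shows "continuous_on {0..l} \<gamma>"
proof (rule continuous_onI)
  fix s e :: real assume "s \<in> {0..l}" "0 < e"
  then show "\<exists>d>0. \<forall>t\<in>{0..l}. dist t s < d \<longrightarrow> dist (\<gamma> t) (\<gamma> s) \<le> e"
    using arc_curve_dist_le_abs[OF assms] by (intro exI[of _ e]) (fastforce simp: dist_real_def)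
qed

lemma curve_length_shift_le:
  "curve_length (\<lambda>t. \<gamma> (c + t)) a b \<le> curve_length \<gamma> (c + a) (c + b)"
  unfolding curve_length_def
proof (rule SUP_least)
  fix ts assume ts: "ts \<in> {ts. ts \<noteq> [] \<and> sorted ts \<and> hd ts = a \<and> last ts = b}"
  have "sorted (map ((+) c) ts)"
    using ts by (auto simp: sorted_iff_nth_mono)
  then show "ereal (\<Sum>i<length ts - 1. dist (\<gamma> (c + ts ! i)) (\<gamma> (c + ts ! Suc i)))
    \<le> (SUP ts\<in>{ts. ts \<noteq> [] \<and> sorted ts \<and> hd ts = c + a \<and> last ts = c + b}.
          ereal (\<Sum>i<length ts - 1. dist (\<gamma> (ts ! i)) (\<gamma> (ts ! Suc i))))"
    using ts by (intro SUP_upper2[where i="map ((+) c) ts"]) (auto simp: hd_map last_map)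
qed

lemma curve_length_shift:
  "curve_length (\<lambda>t. \<gamma> (c + t)) a b = curve_length \<gamma> (c + a) (c + b)"
  using curve_length_shift_le[of \<gamma> c a b]
    curve_length_shift_le[of "\<lambda>t. \<gamma> (c + t)" "-c" "c + a" "c + b"]
  by (simp add: antisym)

lemma arc_curve_subcurve:
  assumes "arc_curve \<gamma> l" "0 \<le> a" "a < b" "b \<le> l"
  shows "arc_curve (\<lambda>t. \<gamma> (a + t)) (b - a)"
  using assms unfolding arc_curve_def curve_length_shift by auto

text \<open>\<open>arc_curve\<close> constrains \<open>\<gamma>\<close> only on
  \<open>{0..l}\<close>, so the composition with \<open>g\<close> need not be measurable elsewhere;
  the indicator removes the uncontrolled part.\<close>

lemma borel_measurable_along_curve:
  fixes g :: "'a::metric_space \<Rightarrow> ennreal"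
  assumes "g \<in> borel_measurable borel" "arc_curve \<gamma> l" "0 \<le> a" "b \<le> l"
  shows "(\<lambda>t. g (\<gamma> t) * indicator {a..b} t) \<in> borel_measurable borel"
proof -
  have "continuous_on {a..b} \<gamma>"
    using arc_curve_continuous[OF assms(2)] assms by (auto elim: continuous_on_subset)
  then have "(\<lambda>t. g (\<gamma> t)) \<in> borel_measurable (restrict_space borel {a..b})"
    using assms(1) by (intro measurable_compose[OF borel_measurable_continuous_on_restrict]) auto
  then show ?thesis
    by (subst (asm) borel_measurable_restrict_space_iff_ennreal) auto
qed

lemma line_integral_subcurve:
  fixes g :: "'a::metric_space \<Rightarrow> ennreal"
  assumes "g \<in> borel_measurable borel" "arc_curve \<gamma> l" "0 \<le> a" "b \<le> l"
  shows "line_integral g (\<lambda>t. \<gamma> (a + t)) (b - a) = (\<integral>\<^sup>+t. g (\<gamma> t) * indicator {a..b} t \<partial>lborel)"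
  unfolding line_integral_def
  by (subst nn_integral_real_affine[OF borel_measurable_along_curve[OF assms], of 1 a])
     (auto intro!: nn_integral_cong simp: indicator_def)

lemma nn_integral_Icc_add:
  fixes G :: "real \<Rightarrow> ennreal"
  assumes [measurable]: "G \<in> borel_measurable borel" and "a \<le> b" "b \<le> c"
  shows "(\<integral>\<^sup>+t. G t * indicator {a..b} t \<partial>lborel) + (\<integral>\<^sup>+t. G t * indicator {b..c} t \<partial>lborel)
    = (\<integral>\<^sup>+t. G t * indicator {a..c} t \<partial>lborel)"
proof -
  have "(\<integral>\<^sup>+t. G t * indicator {a..b} t \<partial>lborel) + (\<integral>\<^sup>+t. G t * indicator {b..c} t \<partial>lborel)
    = (\<integral>\<^sup>+t. G t * indicator {a..b} t + G t * indicator {b..c} t \<partial>lborel)"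
    by (rule nn_integral_add[symmetric]) auto
  also have "\<dots> = (\<integral>\<^sup>+t. G t * indicator {a..c} t \<partial>lborel)"
    using assms(2,3) by (intro nn_integral_cong_AE eventually_mono[OF AE_lborel_singleton[of b]])
      (auto simp: indicator_def)
  finally show ?thesis .
qed

lemma ennreal_abs_diff_triangle:
  "ennreal \<bar>a - c\<bar> \<le> ennreal \<bar>a - b\<bar> + ennreal \<bar>b - (c::real)\<bar>"
  by (simp add: ennreal_leI flip: ennreal_plus)

text \<open>Chaining over steps of length at most \<open>\<delta> / 2\<close>, which are strictly
  shorter than \<open>\<delta>\<close>. It lets an increment be checked on segments so short that
  one of two gradients, or one point of a net, suffices.\<close>

lemma increment_bound_from_local:
  fixes h :: "real \<Rightarrow> real" and G :: "real \<Rightarrow> ennreal"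
  assumes G[measurable]: "G \<in> borel_measurable borel" and "0 \<le> l" "0 < \<delta>"
    and local: "\<And>a b. 0 \<le> a \<Longrightarrow> a \<le> b \<Longrightarrow> b \<le> l \<Longrightarrow> b - a < \<delta> \<Longrightarrow>
      ennreal \<bar>h a - h b\<bar> \<le> (\<integral>\<^sup>+t. G t * indicator {a..b} t \<partial>lborel)"
  shows "ennreal \<bar>h 0 - h l\<bar> \<le> (\<integral>\<^sup>+t. G t * indicator {0..l} t \<partial>lborel)"
proof -
  have *: "ennreal \<bar>h 0 - h t\<bar> \<le> (\<integral>\<^sup>+t'. G t' * indicator {0..t} t' \<partial>lborel)"
    if "0 \<le> t" "t \<le> l" "t \<le> real n * (\<delta> / 2)" for t n
    using that
  proof (induction n arbitrary: t)
    case 0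
    then show ?case by simp
  next
    case (Suc n)
    define s where "s = max 0 (t - \<delta> / 2)"
    have s: "0 \<le> s" "s \<le> t" "s \<le> l" "s \<le> real n * (\<delta> / 2)" "t - s < \<delta>"
      using Suc.prems \<open>0 < \<delta>\<close> by (auto simp: s_def max_def algebra_simps)
    have "ennreal \<bar>h 0 - h t\<bar> \<le> ennreal \<bar>h 0 - h s\<bar> + ennreal \<bar>h s - h t\<bar>"
      by (rule ennreal_abs_diff_triangle)
    also have "\<dots> \<le> (\<integral>\<^sup>+t. G t * indicator {0..s} t \<partial>lborel) + (\<integral>\<^sup>+t'. G t' * indicator {s..t} t' \<partial>lborel)"
      using Suc s by (intro add_mono local Suc.IH) auto
    also have "\<dots> = (\<integral>\<^sup>+t'. G t' * indicator {0..t} t' \<partial>lborel)"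
      using s by (intro nn_integral_Icc_add G) auto
    finally show ?case .
  qed
  obtain n :: nat where "l / (\<delta> / 2) < n" using reals_Archimedean2 by blast
  then show ?thesis
    using \<open>0 < \<delta>\<close> \<open>0 \<le> l\<close> by (intro *[of l n]) (auto simp: field_simps)
qed

lemma upper_gradient_on_segment:
  fixes g :: "'a::metric_space \<Rightarrow> ennreal"
  assumes "upper_gradient f g" "arc_curve \<gamma> l" "0 \<le> a" "a \<le> b" "b \<le> l"
  shows "ennreal \<bar>f (\<gamma> a) - f (\<gamma> b)\<bar> \<le> (\<integral>\<^sup>+t. g (\<gamma> t) * indicator {a..b} t \<partial>lborel)"
proof (cases "a = b")
  case False
  have g: "g \<in> borel_measurable borel" using assms(1) by (simp add: upper_gradient_def)
  have "arc_curve (\<lambda>t. \<gamma> (a + t)) (b - a)"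
    using False assms by (intro arc_curve_subcurve) auto
  then have "ennreal \<bar>f (\<gamma> (a + 0)) - f (\<gamma> (a + (b - a)))\<bar> \<le> line_integral g (\<lambda>t. \<gamma> (a + t)) (b - a)"
    using assms(1) unfolding upper_gradient_def by blast
  then show ?thesis
    by (simp add: line_integral_subcurve[OF g assms(2,3,5)])
qed simp

lemma segment_integral_le_line_integral:
  assumes "0 \<le> a" "b \<le> l"
  shows "(\<integral>\<^sup>+t. g (\<gamma> t) * indicator {a..b} t \<partial>lborel) \<le> line_integral g \<gamma> l"
  unfolding line_integral_def using assms
  by (intro nn_integral_mono) (auto simp: indicator_def)

lemma compact_closed_subset_Icc:
  fixes S :: "real set"
  assumes "closed S" "S \<subseteq> {a..b}"
  shows "compact S"
  using assms by (metis compact_Int_closed compact_Icc inf.absorb2)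

text \<open>Take the last time \<open>s\<close> with \<open>f s \<le> A\<close>, then the first time
  from \<open>s\<close> on with value at least \<open>B\<close>; compactness of the two sets of
  times provides both.\<close>

lemma crossing_interval:
  fixes f :: "real \<Rightarrow> real"
  assumes cont: "continuous_on {0..l} f" and "0 \<le> l" "f 0 \<le> A" "A < B" "B \<le> f l"
  shows "\<exists>s s'. 0 \<le> s \<and> s \<le> s' \<and> s' \<le> l \<and> f s \<le> A \<and> B \<le> f s' \<and>
    (\<forall>t. s < t \<and> t < s' \<longrightarrow> A < f t \<and> f t < B)"
proof -
  define S where "S = {t\<in>{0..l}. f t \<le> A}"
  have "closed S" unfolding S_def using cont by (intro continuous_on_closed_Collect_le) auto
  then have "compact S" by (rule compact_closed_subset_Icc[of _ 0 l]) (auto simp: S_def)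
  moreover have "0 \<in> S" using assms by (auto simp: S_def)
  ultimately obtain s where s: "s \<in> S" "\<And>t. t \<in> S \<Longrightarrow> t \<le> s"
    using compact_attains_sup[of S] by blast
  define T where "T = {t\<in>{s..l}. B \<le> f t}"
  have "continuous_on {s..l} f" using cont s(1) by (auto simp: S_def elim: continuous_on_subset)
  then have "closed T" unfolding T_def by (intro continuous_on_closed_Collect_le) auto
  then have "compact T" by (rule compact_closed_subset_Icc[of _ s l]) (auto simp: T_def)
  moreover have "l \<in> T" using assms s by (auto simp: T_def S_def)
  ultimately obtain s' where s': "s' \<in> T" "\<And>t. t \<in> T \<Longrightarrow> s' \<le> t"
    using compact_attains_inf[of T] by blast
  have "A < f t \<and> f t < B" if t: "s < t" "t < s'" for t
  proof -
    have "t \<notin> S" "t \<notin> T" using t s(2)[of t] s'(2)[of t] by auto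
    then show ?thesis
      using t s(1) s'(1) by (auto simp: S_def T_def)
  qed
  then show ?thesis
    using s(1) s'(1) by (intro exI[of _ s] exI[of _ s']) (auto simp: S_def T_def)
qed

text \<open>If the truncation changes along a curve, some subsegment carries at least this change of
  \<open>w\<close>, while inside it \<open>w\<close> stays strictly between the two end values of
  the truncation. Continuity of \<open>w\<close> provides the crossing times and makes the level set
  Borel, as an upper gradient requires.\<close>

lemma upper_gradient_truncate:
  fixes w :: "'a::metric_space \<Rightarrow> real"
  assumes ug: "upper_gradient w h" and w: "continuous_on UNIV w"
  shows "upper_gradient (\<lambda>y. max a (min b (w y))) (\<lambda>y. h y * indicator {y. a < w y \<and> w y < b} y)"
    (is "upper_gradient ?v ?h")
  unfolding upper_gradient_def
proof (intro conjI allI impI)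
  have [measurable]: "w \<in> borel_measurable borel" "h \<in> borel_measurable borel"
    using w ug by (auto simp: borel_measurable_continuous_onI upper_gradient_def)
  show "?h \<in> borel_measurable borel" by measurable
  fix \<gamma> :: "real \<Rightarrow> 'a" and l assume \<gamma>: "arc_curve \<gamma> l"
  then have l: "0 \<le> l" by (simp add: arc_curve_def)
  define f where "f = (\<lambda>t. w (\<gamma> t))"
  have cont: "continuous_on {0..l} f"
    unfolding f_def by (rule continuous_on_compose2[OF w arc_curve_continuous[OF \<gamma>]]) auto
  have key: "ennreal \<bar>?v (\<gamma> 0) - ?v (\<gamma> l)\<bar> \<le> line_integral ?h \<gamma> l"
    if "0 \<le> s" "s \<le> s'" "s' \<le> l" "\<bar>f s - f s'\<bar> \<ge> \<bar>?v (\<gamma> 0) - ?v (\<gamma> l)\<bar>"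
      "\<And>t. s < t \<Longrightarrow> t < s' \<Longrightarrow> a < f t \<and> f t < b" for s s'
  proof -
    have "ennreal \<bar>?v (\<gamma> 0) - ?v (\<gamma> l)\<bar> \<le> ennreal \<bar>w (\<gamma> s) - w (\<gamma> s')\<bar>"
      using that(4) unfolding f_def by (rule ennreal_leI)
    also have "\<dots> \<le> (\<integral>\<^sup>+t. h (\<gamma> t) * indicator {s..s'} t \<partial>lborel)"
      by (rule upper_gradient_on_segment[OF ug \<gamma> that(1-3)])
    also have "\<dots> \<le> line_integral ?h \<gamma> l"
      unfolding line_integral_def
    proof (rule nn_integral_mono_AE, use AE_lborel_singleton[of s] AE_lborel_singleton[of s'] in eventually_elim)
      case (elim t)
      then show ?case using that(1-3) that(5)[of t] by (auto simp: indicator_def f_def)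
    qed
    finally show ?thesis .
  qed
  consider "?v (\<gamma> 0) = ?v (\<gamma> l)" | "?v (\<gamma> 0) < ?v (\<gamma> l)" | "?v (\<gamma> l) < ?v (\<gamma> 0)" by linarith
  then show "ennreal \<bar>?v (\<gamma> 0) - ?v (\<gamma> l)\<bar> \<le> line_integral ?h \<gamma> l"
  proof cases
    case 2
    define A B where "A = ?v (\<gamma> 0)" and "B = ?v (\<gamma> l)"
    have AB: "a \<le> A" "A < B" "B \<le> b" "f 0 \<le> A" "B \<le> f l"
      using 2 unfolding A_def B_def f_def by (auto simp: max_def min_def split: if_splits)
    obtain s s' where s: "0 \<le> s" "s \<le> s'" "s' \<le> l" "f s \<le> A" "B \<le> f s'"
      "\<And>t. s < t \<Longrightarrow> t < s' \<Longrightarrow> A < f t \<and> f t < B"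
      using crossing_interval[OF cont l AB(4,2,5)] by blast
    have "a < f t \<and> f t < b" if "s < t" "t < s'" for t
      using s(6)[OF that] AB by linarith
    moreover have "\<bar>f s - f s'\<bar> \<ge> \<bar>?v (\<gamma> 0) - ?v (\<gamma> l)\<bar>"
      unfolding A_def[symmetric] B_def[symmetric] using s AB by linarith
    ultimately show ?thesis by (intro key[OF s(1-3)])
  next
    case 3
    define A B where "A = ?v (\<gamma> l)" and "B = ?v (\<gamma> 0)"
    have AB: "a \<le> A" "A < B" "B \<le> b" "f l \<le> A" "B \<le> f 0"
      using 3 unfolding A_def B_def f_def by (auto simp: max_def min_def split: if_splits)
    \<comment> \<open>The decreasing case is the increasing one for \<open>- f\<close>.\<close>
    have "- f 0 \<le> - B" "- B < - A" "- A \<le> - f l" using AB by auto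
    then obtain s s' where s: "0 \<le> s" "s \<le> s'" "s' \<le> l" "- f s \<le> - B" "- A \<le> - f s'"
      "\<And>t. s < t \<Longrightarrow> t < s' \<Longrightarrow> - B < - f t \<and> - f t < - A"
      using crossing_interval[OF continuous_on_minus[OF cont] l] by metis
    have "a < f t \<and> f t < b" if "s < t" "t < s'" for t
      using s(6)[OF that] AB by linarith
    moreover have "\<bar>f s - f s'\<bar> \<ge> \<bar>?v (\<gamma> 0) - ?v (\<gamma> l)\<bar>"
      unfolding A_def[symmetric] B_def[symmetric] using s AB by linarith
    ultimately show ?thesis by (intro key[OF s(1-3)])
  qed simp
qed

text \<open>The part of a curve between its first and last time outside \<open>\<Omega>\<close>
  contributes no increment, because \<open>u\<close> vanishes at both times; the two remaining
  pieces run inside \<open>\<Omega>\<close>. This reconciles \<open>cap_p\<close>, which integrates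
  over \<open>\<Omega>\<close>, with gradients on the whole space.\<close>

lemma upper_gradient_restrict_open:
  fixes u :: "'a::metric_space \<Rightarrow> real"
  assumes ug: "upper_gradient u g" and \<Omega>: "open \<Omega>" and zero: "\<And>y. y \<notin> \<Omega> \<Longrightarrow> u y = 0"
  shows "upper_gradient u (\<lambda>y. g y * indicator \<Omega> y)"
  unfolding upper_gradient_def
proof (intro conjI allI impI)
  have [measurable]: "g \<in> borel_measurable borel" "\<Omega> \<in> sets borel"
    using ug \<Omega> by (auto simp: upper_gradient_def)
  then show "(\<lambda>y. g y * indicator \<Omega> y) \<in> borel_measurable borel" by measurable
  fix \<gamma> :: "real \<Rightarrow> 'a" and l assume \<gamma>: "arc_curve \<gamma> l"
  then have l: "0 < l" by (simp add: arc_curve_def)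
  show "ennreal \<bar>u (\<gamma> 0) - u (\<gamma> l)\<bar> \<le> line_integral (\<lambda>y. g y * indicator \<Omega> y) \<gamma> l"
  proof (cases "\<forall>t\<in>{0..l}. \<gamma> t \<in> \<Omega>")
    case True
    have "ennreal \<bar>u (\<gamma> 0) - u (\<gamma> l)\<bar> \<le> (\<integral>\<^sup>+t. g (\<gamma> t) * indicator {0..l} t \<partial>lborel)"
      using l by (intro upper_gradient_on_segment[OF ug \<gamma>]) auto
    also have "\<dots> \<le> line_integral (\<lambda>y. g y * indicator \<Omega> y) \<gamma> l"
      unfolding line_integral_def using True
      by (intro nn_integral_mono) (auto simp: indicator_def)
    finally show ?thesis .
  next
    case False
    define S where "S = {0..l} \<inter> \<gamma> -` (- \<Omega>)"
    have "closed S" unfolding S_def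
      using \<Omega> by (intro continuous_closed_preimage arc_curve_continuous[OF \<gamma>]) auto
    then have "compact S" by (rule compact_closed_subset_Icc[of _ 0 l]) (auto simp: S_def)
    moreover have "S \<noteq> {}" using False by (auto simp: S_def)
    ultimately obtain t1 t2 where t1: "t1 \<in> S" "\<And>t. t \<in> S \<Longrightarrow> t1 \<le> t" and t2: "t2 \<in> S" "\<And>t. t \<in> S \<Longrightarrow> t \<le> t2"
      using compact_attains_sup[of S] compact_attains_inf[of S] by metis
    have z: "u (\<gamma> t1) = 0" "u (\<gamma> t2) = 0" using t1 t2 zero by (auto simp: S_def)
    have m1: "(\<lambda>t. g (\<gamma> t) * indicator {0..t1} t) \<in> borel_measurable borel"
      and m2: "(\<lambda>t. g (\<gamma> t) * indicator {t2..l} t) \<in> borel_measurable borel"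
      using t1 t2 by (auto intro!: borel_measurable_along_curve[OF _ \<gamma>] simp: S_def)
    have le: "t1 \<le> t2" using t1 t2 by auto
    have in\<Omega>: "\<gamma> t \<in> \<Omega>" if "0 \<le> t" "t \<le> l" "t < t1 \<or> t2 < t" for t
      using t1(2)[of t] t2(2)[of t] that by (cases "\<gamma> t \<in> \<Omega>") (auto simp: S_def)
    have "ennreal \<bar>u (\<gamma> 0) - u (\<gamma> l)\<bar> \<le> ennreal \<bar>u (\<gamma> 0) - u (\<gamma> t1)\<bar> + ennreal \<bar>u (\<gamma> t2) - u (\<gamma> l)\<bar>"
      using ennreal_abs_diff_triangle[of "u (\<gamma> 0)" "u (\<gamma> l)" 0] z by simp
    also have "\<dots> \<le> (\<integral>\<^sup>+t. g (\<gamma> t) * indicator {0..t1} t \<partial>lborel) + (\<integral>\<^sup>+t. g (\<gamma> t) * indicator {t2..l} t \<partial>lborel)"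
      using t1 t2 by (intro add_mono upper_gradient_on_segment[OF ug \<gamma>]) (auto simp: S_def)
    also have "\<dots> = (\<integral>\<^sup>+t. g (\<gamma> t) * indicator {0..t1} t + g (\<gamma> t) * indicator {t2..l} t \<partial>lborel)"
      using m1 m2 by (intro nn_integral_add[symmetric]) auto
    also have "\<dots> \<le> line_integral (\<lambda>y. g y * indicator \<Omega> y) \<gamma> l"
      unfolding line_integral_def
    proof (intro nn_integral_mono_AE, use AE_lborel_singleton[of t1] AE_lborel_singleton[of t2] in eventually_elim)
      case (elim t)
      then show ?case using le t1(1) t2(1) in\<Omega>[of t] by (auto simp: indicator_def S_def)
    qed
    finally show ?thesis .
  qed
qed

section \<open>Powers of extended nonnegative functions\<close>

lemma epow_ennreal [simp]: "0 \<le> a \<Longrightarrow> epow (ennreal a) q = ennreal (a powr q)"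
  by (simp add: epow_def)

lemma epow_0 [simp]: "epow 0 q = 0"
  by (simp add: epow_def)

lemma epow_top [simp]: "epow top q = top"
  by (simp add: epow_def)

lemma epow_mono: "a \<le> b \<Longrightarrow> 0 \<le> q \<Longrightarrow> epow a q \<le> epow b q"
  by (cases a; cases b) (auto simp: powr_mono2 top_unique intro!: ennreal_leI)

lemma epow_epow: "0 < p \<Longrightarrow> epow (epow a p) (1 / p) = a"
  by (cases a) (auto simp: powr_powr)

lemma epow_epow_inverse: "0 < p \<Longrightarrow> epow (epow a (1 / p)) p = a"
  by (cases a) (auto simp: powr_powr)

lemma epow_le_cancel: "epow a p \<le> epow b p \<Longrightarrow> 0 < p \<Longrightarrow> a \<le> b"
  using epow_mono[of "epow a p" "epow b p" "1 / p"] by (simp add: epow_epow)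

lemma epow_indicator: "epow (a * indicator A y) q = epow a q * indicator A y"
  by (auto simp: indicator_def)

lemma epow_cmult: "0 < c \<Longrightarrow> epow (ennreal c * a) q = ennreal (c powr q) * epow a q"
  by (cases a) (auto simp: ennreal_mult_top powr_mult ennreal_mult'[symmetric] simp flip: ennreal_mult)

lemma epow_add_le:
  assumes "0 \<le> q"
  shows "epow (a + b) q \<le> ennreal (2 powr q) * (epow a q + epow b q)"
proof -
  have "a + b \<le> ennreal 2 * max a b"
    by (metis add_mono max.cobounded1 max.cobounded2 mult_2 ennreal_numeral)
  then have "epow (a + b) q \<le> ennreal (2 powr q) * epow (max a b) q"
    using epow_mono[OF _ assms, of "a + b" "ennreal 2 * max a b"] epow_cmult[of 2 "max a b" q] by simp
  also have "epow (max a b) q \<le> epow a q + epow b q"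
    by (auto simp: max_def)
  finally show ?thesis by (simp add: mult_left_mono)
qed

lemma borel_measurable_epow [measurable]:
  assumes [measurable]: "f \<in> borel_measurable N"
  shows "(\<lambda>y. epow (f y) q) \<in> borel_measurable N"
  unfolding epow_def by measurable

abbreviation energy :: "'a measure \<Rightarrow> real \<Rightarrow> ('a \<Rightarrow> ennreal) \<Rightarrow> ennreal" where
  "energy M p g \<equiv> \<integral>\<^sup>+y. epow (g y) p \<partial>M"

section \<open>Curve families of modulus zero\<close>

lemma p_modulus_eq_0_iff:
  "p_modulus M p \<Gamma> = 0 \<longleftrightarrow> (\<forall>e>0. \<exists>\<rho>\<in>borel_measurable borel.
     (\<forall>(\<gamma>, l)\<in>\<Gamma>. 1 \<le> line_integral \<rho> \<gamma> l) \<and> energy M p \<rho> < e)"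
proof
  assume 0: "p_modulus M p \<Gamma> = 0"
  show "\<forall>e>0. \<exists>\<rho>\<in>borel_measurable borel.
     (\<forall>(\<gamma>, l)\<in>\<Gamma>. 1 \<le> line_integral \<rho> \<gamma> l) \<and> energy M p \<rho> < e"
  proof (intro allI impI)
    fix e :: ennreal assume "0 < e"
    then have "p_modulus M p \<Gamma> < e" using 0 by simp
    then show "\<exists>\<rho>\<in>borel_measurable borel.
     (\<forall>(\<gamma>, l)\<in>\<Gamma>. 1 \<le> line_integral \<rho> \<gamma> l) \<and> energy M p \<rho> < e"
      unfolding p_modulus_def by (auto simp: INF_less_iff)
  qed
next
  assume *: "\<forall>e>0. \<exists>\<rho>\<in>borel_measurable borel.
     (\<forall>(\<gamma>, l)\<in>\<Gamma>. 1 \<le> line_integral \<rho> \<gamma> l) \<and> energy M p \<rho> < e"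
  have "p_modulus M p \<Gamma> < e" if "0 < e" for e
    using * that unfolding p_modulus_def by (auto simp: INF_less_iff)
  then show "p_modulus M p \<Gamma> = 0"
    by (metis not_gr_zero order_less_irrefl)
qed

lemma mms_borel_measurable:
  fixes f :: "'a::metric_space \<Rightarrow> 'b::topological_space"
  assumes "mms M" "f \<in> borel_measurable borel"
  shows "f \<in> borel_measurable M"
  using assms unfolding mms_def measurable_def by auto

text \<open>The densities are combined into their l^p-sum \<open>\<sigma>\<close>, which dominates
  each of them and whose energy is exactly the sum of their energies.\<close>

lemma p_modulus_UN_eq_0:
  fixes M :: "'a::metric_space measure"
  assumes "mms M" "0 < p" and "\<And>n::nat. p_modulus M p (\<Gamma> n) = 0"
  shows "p_modulus M p (\<Union>n. \<Gamma> n) = 0"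
  unfolding p_modulus_eq_0_iff
proof (intro allI impI)
  fix e :: ennreal assume e: "0 < e"
  obtain e' where e': "0 < e'" "e' < e" using dense[OF e] by blast
  have "e' < top" using e' by (simp add: order_less_le_trans)
  then obtain c where c: "e' = ennreal c" "0 < c" using e' by (cases e') auto
  have "\<exists>\<rho>\<in>borel_measurable borel. (\<forall>(\<gamma>, l)\<in>\<Gamma> n. 1 \<le> line_integral \<rho> \<gamma> l) \<and>
      energy M p \<rho> < ennreal (c * (1/2)^Suc n)" for n
    using assms(3)[of n] c unfolding p_modulus_eq_0_iff by simp
  then obtain \<rho> where \<rho>: "\<And>n. \<rho> n \<in> borel_measurable borel"
    "\<And>n. \<forall>(\<gamma>, l)\<in>\<Gamma> n. 1 \<le> line_integral (\<rho> n) \<gamma> l"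
    "\<And>n. (\<integral>\<^sup>+y. epow (\<rho> n y) p \<partial>M) < ennreal (c * (1/2)^Suc n)"
    by metis
  note [measurable] = \<rho>(1) mms_borel_measurable[OF assms(1) \<rho>(1)]
  define \<sigma> where "\<sigma> y = epow (\<Sum>n. epow (\<rho> n y) p) (1 / p)" for y
  have [measurable]: "\<sigma> \<in> borel_measurable borel" unfolding \<sigma>_def by measurable
  have le: "\<rho> n y \<le> \<sigma> y" for n y
  proof -
    have "epow (\<rho> n y) p \<le> (\<Sum>n. epow (\<rho> n y) p)"
      using sum_le_suminf[of "\<lambda>n. epow (\<rho> n y) p" "{n}"] by auto
    from epow_mono[OF this, of "1 / p"] show ?thesis
      using assms(2) by (simp add: epow_epow \<sigma>_def)
  qed
  show "\<exists>\<rho>\<in>borel_measurable borel. (\<forall>(\<gamma>, l)\<in>(\<Union>n. \<Gamma> n). 1 \<le> line_integral \<rho> \<gamma> l) \<and>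
      energy M p \<rho> < e"
  proof (intro bexI[of _ \<sigma>] conjI)
    show "\<forall>(\<gamma>, l)\<in>(\<Union>n. \<Gamma> n). 1 \<le> line_integral \<sigma> \<gamma> l"
    proof (clarify)
      fix \<gamma> l n assume "(\<gamma>, l) \<in> \<Gamma> n"
      then have "1 \<le> line_integral (\<rho> n) \<gamma> l" using \<rho>(2)[of n] by auto
      also have "\<dots> \<le> line_integral \<sigma> \<gamma> l"
        unfolding line_integral_def by (intro nn_integral_mono mult_right_mono le) auto
      finally show "1 \<le> line_integral \<sigma> \<gamma> l" .
    qed
    have "energy M p \<sigma> = (\<Sum>n. \<integral>\<^sup>+y. epow (\<rho> n y) p \<partial>M)"
      unfolding \<sigma>_def epow_epow_inverse[OF assms(2)] by (rule nn_integral_suminf) measurable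
    also have "\<dots> \<le> (\<Sum>n. ennreal (c * (1/2)^Suc n))"
      using \<rho>(3) by (intro suminf_le) (auto intro: less_imp_le)
    also have "\<dots> = ennreal (c * 1)"
      using c by (intro suminf_ennreal_eq sums_mult power_half_series) auto
    also have "\<dots> < e" using c e' by simp
    finally show "energy M p \<sigma> < e" .
  qed simp
qed

lemma p_modulus_Un_eq_0:
  fixes M :: "'a::metric_space measure"
  assumes "mms M" "0 < p" "p_modulus M p \<Gamma> = 0" "p_modulus M p \<Delta> = 0"
  shows "p_modulus M p (\<Gamma> \<union> \<Delta>) = 0"
proof -
  have "(\<Union>n::nat. if n = 0 then \<Gamma> else \<Delta>) = \<Gamma> \<union> \<Delta>" by (auto split: if_splits)
  then show ?thesis
    using p_modulus_UN_eq_0[OF assms(1,2), of "\<lambda>n. if n = 0 then \<Gamma> else \<Delta>"] assms(3,4) by auto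
qed

text \<open>Every multiple \<open>c * g\<close> with \<open>c > 0\<close> is admissible for this
  family, and its energy scales by \<open>c powr p\<close>.\<close>

lemma p_modulus_infinite_line_integral:
  fixes M :: "'a::metric_space measure"
  assumes "mms M" "0 < p" and g[measurable]: "g \<in> borel_measurable borel"
    and fin: "energy M p g < \<infinity>"
  shows "p_modulus M p {(\<gamma>, l). arc_curve \<gamma> l \<and> line_integral g \<gamma> l = \<infinity>} = 0"
  unfolding p_modulus_eq_0_iff
proof (intro allI impI)
  fix e :: ennreal assume e: "0 < e"
  note [measurable] = mms_borel_measurable[OF assms(1) g]
  obtain e' where e': "0 < e'" "e' < e" using dense[OF e] by blast
  have "e' < top" using e' by (simp add: order_less_le_trans)
  then obtain d where d: "e' = ennreal d" "0 < d" using e' by (cases e') auto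
  obtain I where I: "energy M p g = ennreal I" "0 \<le> I"
    using fin by (cases "energy M p g") auto
  \<comment> \<open>Adding 1 to the energy \<open>I\<close> keeps the denominator positive when
    \<open>I = 0\<close>.\<close>
  define c where "c = (d / (I + 1)) powr (1 / p)"
  have c: "0 < c" "c powr p * I \<le> d"
    using d I assms(2) by (auto simp: c_def powr_powr divide_simps algebra_simps)
  show "\<exists>\<rho>\<in>borel_measurable borel. (\<forall>(\<gamma>, l)\<in>{(\<gamma>, l). arc_curve \<gamma> l \<and> line_integral g \<gamma> l = \<infinity>}.
      1 \<le> line_integral \<rho> \<gamma> l) \<and> energy M p \<rho> < e"
  proof (intro bexI[of _ "\<lambda>y. ennreal c * g y"] conjI)
    show "\<forall>(\<gamma>, l)\<in>{(\<gamma>, l). arc_curve \<gamma> l \<and> line_integral g \<gamma> l = \<infinity>}.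
      1 \<le> line_integral (\<lambda>y. ennreal c * g y) \<gamma> l"
    proof clarify
      fix \<gamma> :: "real \<Rightarrow> 'a" and l assume *: "arc_curve \<gamma> l" "line_integral g \<gamma> l = \<infinity>"
      have "line_integral (\<lambda>y. ennreal c * g y) \<gamma> l = ennreal c * line_integral g \<gamma> l"
        unfolding line_integral_def using borel_measurable_along_curve[OF g *(1), of 0 l]
        by (simp add: mult.assoc nn_integral_cmult)
      then show "1 \<le> line_integral (\<lambda>y. ennreal c * g y) \<gamma> l"
        using * c by (simp add: ennreal_mult_top)
    qed
    have "(\<integral>\<^sup>+y. epow (ennreal c * g y) p \<partial>M) = ennreal (c powr p) * ennreal I"
      using c by (simp add: epow_cmult nn_integral_cmult I)
    also have "\<dots> \<le> ennreal d"
      using c I by (auto simp flip: ennreal_mult intro!: ennreal_leI)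
    finally show "(\<integral>\<^sup>+y. epow (ennreal c * g y) p \<partial>M) < e" using d e' by simp
  qed simp
qed

text \<open>A density admissible for the subcurves is admissible for the longer curves too. Hence a
  weak upper gradient controls the increments on all subsegments of almost every curve.\<close>

lemma p_modulus_supercurves:
  fixes M :: "'a::metric_space measure"
  assumes "p_modulus M p \<Gamma> = 0"
  shows "p_modulus M p {(\<gamma>, l). arc_curve \<gamma> l \<and>
    (\<exists>a b. 0 \<le> a \<and> a < b \<and> b \<le> l \<and> ((\<lambda>t. \<gamma> (a + t)), b - a) \<in> \<Gamma>)} = 0" (is "p_modulus M p ?\<Delta> = 0")
  unfolding p_modulus_eq_0_iff
proof (intro allI impI)
  fix e :: ennreal assume "0 < e"
  then obtain \<rho> where \<rho>: "\<rho> \<in> borel_measurable borel" "\<And>\<gamma> l. (\<gamma>, l) \<in> \<Gamma> \<Longrightarrow> 1 \<le> line_integral \<rho> \<gamma> l"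
    "energy M p \<rho> < e"
    using assms unfolding p_modulus_eq_0_iff by blast
  have "1 \<le> line_integral \<rho> \<gamma> l" if "(\<gamma>, l) \<in> ?\<Delta>" for \<gamma> l
  proof -
    from that obtain a b where ab: "arc_curve \<gamma> l" "0 \<le> a" "a < b" "b \<le> l" "((\<lambda>t. \<gamma> (a + t)), b - a) \<in> \<Gamma>"
      by auto
    have "1 \<le> line_integral \<rho> (\<lambda>t. \<gamma> (a + t)) (b - a)" by (rule \<rho>(2)[OF ab(5)])
    also have "\<dots> \<le> line_integral \<rho> \<gamma> l"
      unfolding line_integral_subcurve[OF \<rho>(1) ab(1,2,4)]
      by (rule segment_integral_le_line_integral[OF ab(2,4)])
    finally show ?thesis .
  qed
  then show "\<exists>\<rho>\<in>borel_measurable borel. (\<forall>(\<gamma>, l)\<in>?\<Delta>. 1 \<le> line_integral \<rho> \<gamma> l) \<and>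
     energy M p \<rho> < e"
    using \<rho>(1,3) by blast
qed

section \<open>Minimal weak upper gradients\<close>

lemma p_weak_upper_gradient_segments:
  fixes M :: "'a::metric_space measure"
  assumes "mms M" "0 < p" "p_weak_upper_gradient M p u g" "energy M p g < \<infinity>"
  shows "\<exists>\<Gamma>. p_modulus M p \<Gamma> = 0 \<and> (\<forall>\<gamma> l. arc_curve \<gamma> l \<and> (\<gamma>, l) \<notin> \<Gamma> \<longrightarrow>
    line_integral g \<gamma> l < \<infinity> \<and> (\<forall>a b. 0 \<le> a \<and> a \<le> b \<and> b \<le> l \<longrightarrow>
      ennreal \<bar>u (\<gamma> a) - u (\<gamma> b)\<bar> \<le> (\<integral>\<^sup>+t. g (\<gamma> t) * indicator {a..b} t \<partial>lborel)))"
proof -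
  obtain \<Gamma> where g: "g \<in> borel_measurable borel" and \<Gamma>: "p_modulus M p \<Gamma> = 0"
    "\<And>\<gamma> l. arc_curve \<gamma> l \<Longrightarrow> (\<gamma>, l) \<notin> \<Gamma> \<Longrightarrow> ennreal \<bar>u (\<gamma> 0) - u (\<gamma> l)\<bar> \<le> line_integral g \<gamma> l"
    using assms(3) unfolding p_weak_upper_gradient_def by blast
  define \<Delta> where "\<Delta> = {(\<gamma>, l). arc_curve \<gamma> l \<and>
    (\<exists>a b. 0 \<le> a \<and> a < b \<and> b \<le> l \<and> ((\<lambda>t. \<gamma> (a + t)), b - a) \<in> \<Gamma>)}"
  define \<Delta>' where "\<Delta>' = {(\<gamma>, l). arc_curve \<gamma> l \<and> line_integral g \<gamma> l = \<infinity>}"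
  have "p_modulus M p (\<Delta> \<union> \<Delta>') = 0"
    unfolding \<Delta>_def \<Delta>'_def
    using p_modulus_supercurves[OF \<Gamma>(1)] p_modulus_infinite_line_integral[OF assms(1,2) g assms(4)]
    by (intro p_modulus_Un_eq_0[OF assms(1,2)])
  moreover have "ennreal \<bar>u (\<gamma> a) - u (\<gamma> b)\<bar> \<le> (\<integral>\<^sup>+t. g (\<gamma> t) * indicator {a..b} t \<partial>lborel)"
    if \<gamma>: "arc_curve \<gamma> l" "(\<gamma>, l) \<notin> \<Delta> \<union> \<Delta>'" and ab: "0 \<le> a" "a \<le> b" "b \<le> l" for \<gamma> l a b
  proof (cases "a = b")
    case False
    then have "a < b" using ab by simp
    then have "((\<lambda>t. \<gamma> (a + t)), b - a) \<notin> \<Gamma>" using \<gamma> ab unfolding \<Delta>_def by blast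
    from \<Gamma>(2)[OF arc_curve_subcurve[OF \<gamma>(1) ab(1) \<open>a < b\<close> ab(3)] this] show ?thesis
      by (simp add: line_integral_subcurve[OF g \<gamma>(1) ab(1,3)])
  qed simp
  ultimately show ?thesis
    by (intro exI[of _ "\<Delta> \<union> \<Delta>'"]) (auto simp: \<Delta>'_def less_top)
qed

text \<open>Off a set of small \<open>G\<^sub>1 + G\<^sub>2\<close>-mass, the set \<open>{G\<^sub>1 \<le> G\<^sub>2}\<close> is a union of short intervals:
  squeeze it between a compact \<open>K\<close> and an open \<open>U\<close>, and use \<open>G\<^sub>1\<close> on the short intervals meeting \<open>K\<close>
  and \<open>G\<^sub>2\<close> on the others.\<close>
lemma increment_bound_min:
  fixes h :: "real \<Rightarrow> real" and G1 G2 :: "real \<Rightarrow> ennreal"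
  assumes [measurable]: "G1 \<in> borel_measurable borel" "G2 \<in> borel_measurable borel" and l: "0 \<le> l"
    and fin: "(\<integral>\<^sup>+t. G1 t \<partial>lborel) < \<infinity>" "(\<integral>\<^sup>+t. G2 t \<partial>lborel) < \<infinity>"
    and 1: "\<And>a b. 0 \<le> a \<Longrightarrow> a \<le> b \<Longrightarrow> b \<le> l \<Longrightarrow>
      ennreal \<bar>h a - h b\<bar> \<le> (\<integral>\<^sup>+t. G1 t * indicator {a..b} t \<partial>lborel)"
    and 2: "\<And>a b. 0 \<le> a \<Longrightarrow> a \<le> b \<Longrightarrow> b \<le> l \<Longrightarrow>
      ennreal \<bar>h a - h b\<bar> \<le> (\<integral>\<^sup>+t. G2 t * indicator {a..b} t \<partial>lborel)"
  shows "ennreal \<bar>h 0 - h l\<bar> \<le> (\<integral>\<^sup>+t. min (G1 t) (G2 t) * indicator {0..l} t \<partial>lborel)"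
proof (rule ennreal_le_epsilon)
  fix e :: real assume e: "0 < e"
  define A where "A = {t. G1 t \<le> G2 t}"
  have [measurable]: "A \<in> sets borel" unfolding A_def by measurable
  define \<nu> where "\<nu> = density lborel (\<lambda>t. G1 t + G2 t)"
  have sets_\<nu>: "sets \<nu> = sets borel" by (simp add: \<nu>_def)
  have fin_\<nu>: "emeasure \<nu> (space \<nu>) \<noteq> \<infinity>"
    using fin by (auto simp: \<nu>_def emeasure_density nn_integral_add)
  interpret \<nu>: finite_measure \<nu> by (rule finite_measureI[OF fin_\<nu>])
  have finA: "emeasure \<nu> B \<noteq> \<infinity>" for B by (simp add: \<nu>.emeasure_finite)
  have "\<exists>U. A \<subseteq> U \<and> open U \<and> emeasure \<nu> U < emeasure \<nu> A + ennreal (e / 2)"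
  proof -
    have "emeasure \<nu> A < emeasure \<nu> A + ennreal (e / 2)"
      using e finA[of A] ennreal_add_left_cancel_less[of "emeasure \<nu> A" 0 "ennreal (e / 2)"] by auto
    then show ?thesis
      using outer_regular[OF sets_\<nu> fin_\<nu>, of A] by (auto simp: INF_less_iff)
  qed
  then obtain U where U: "A \<subseteq> U" "open U" "emeasure \<nu> U < emeasure \<nu> A + ennreal (e / 2)" by blast
  have "\<exists>K. K \<subseteq> A \<and> compact K \<and> emeasure \<nu> A \<le> emeasure \<nu> K + ennreal (e / 2)"
  proof (cases "emeasure \<nu> A = 0")
    case False
    then have "emeasure \<nu> A - ennreal (e / 2) < emeasure \<nu> A"
      using e finA[of A] by (intro ennreal_between) (auto simp: top.not_eq_extremum zero_less_iff_neq_zero simp del: \<nu>.emeasure_finite)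
    then obtain K where "K \<subseteq> A" "compact K" "emeasure \<nu> A - ennreal (e / 2) < emeasure \<nu> K"
      unfolding inner_regular[OF sets_\<nu> fin_\<nu>, of A, simplified] by (auto simp: less_SUP_iff)
    then show ?thesis by (metis add.commute ennreal_minus_le_iff less_imp_le)
  qed auto
  then obtain K where K: "K \<subseteq> A" "compact K" "emeasure \<nu> A \<le> emeasure \<nu> K + ennreal (e / 2)" by blast
  have [measurable]: "U \<in> sets borel" "K \<in> sets borel"
    using U K by (auto intro: borel_closed compact_imp_closed)
  have small: "emeasure \<nu> (U - K) \<le> ennreal e"
  proof -
    have "emeasure \<nu> K + emeasure \<nu> (U - K) = emeasure \<nu> U"
      using U K by (subst plus_emeasure) (auto simp: sets_\<nu> intro!: arg_cong[of _ _ "emeasure \<nu>"])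
    also have "\<dots> \<le> emeasure \<nu> K + ennreal (e / 2) + ennreal (e / 2)"
      using U(3) K(3) by (meson add_right_mono less_imp_le order_trans)
    also have "\<dots> = emeasure \<nu> K + ennreal e"
      using e by (simp add: add.assoc flip: ennreal_plus)
    finally show ?thesis using finA[of K] by (simp add: ennreal_add_left_cancel_le)
  qed
  obtain \<delta> where \<delta>: "0 < \<delta>" "\<And>s t. s \<in> K \<Longrightarrow> t \<notin> U \<Longrightarrow> \<delta> \<le> dist s t"
    using separate_compact_closed[of K "- U"] K(1,2) U(1,2) by (metis ComplI closed_Compl disjoint_eq_subset_Compl double_complement order_trans)
  \<comment> \<open>\<open>G\<close> dominates \<open>G1\<close> on \<open>U\<close> and
    \<open>G2\<close> off \<open>K\<close>: the minimum is \<open>G1\<close> on \<open>K\<close> and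
    \<open>G2\<close> off \<open>U\<close>, and the extra term pays for \<open>U - K\<close>. An
    interval shorter than \<open>\<delta>\<close> either misses \<open>K\<close> or lies in
    \<open>U\<close>.\<close>
  define G where "G t = min (G1 t) (G2 t) + (G1 t + G2 t) * indicator (U - K) t" for t
  have [measurable]: "G \<in> borel_measurable borel" unfolding G_def by measurable
  have "ennreal \<bar>h 0 - h l\<bar> \<le> (\<integral>\<^sup>+t. G t * indicator {0..l} t \<partial>lborel)"
  proof (rule increment_bound_from_local[OF _ l \<delta>(1)])
    fix a b assume ab: "0 \<le> a" "a \<le> b" "b \<le> l" "b - a < \<delta>"
    show "ennreal \<bar>h a - h b\<bar> \<le> (\<integral>\<^sup>+t. G t * indicator {a..b} t \<partial>lborel)"
    proof (cases "K \<inter> {a..b} = {}")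
      case True
      have "G2 t * indicator {a..b} t \<le> G t * indicator {a..b} t" for t
        using True U(1) by (auto simp: G_def indicator_def A_def min_def add_increasing)
      then have "(\<integral>\<^sup>+t. G2 t * indicator {a..b} t \<partial>lborel) \<le> (\<integral>\<^sup>+t. G t * indicator {a..b} t \<partial>lborel)"
        by (rule nn_integral_mono)
      with 2[OF ab(1-3)] show ?thesis by (rule order_trans)
    next
      case False
      then obtain s where s: "s \<in> K" "a \<le> s" "s \<le> b" by auto
      have "t \<in> U" if "a \<le> t" "t \<le> b" for t
        using \<delta>(2)[OF s(1), of t] s that ab by (cases "t \<in> U") (auto simp: dist_real_def abs_real_def split: if_splits)
      then have "G1 t * indicator {a..b} t \<le> G t * indicator {a..b} t" for t
        using K(1) by (auto simp: G_def indicator_def A_def min_def add_increasing)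
      then have "(\<integral>\<^sup>+t. G1 t * indicator {a..b} t \<partial>lborel) \<le> (\<integral>\<^sup>+t. G t * indicator {a..b} t \<partial>lborel)"
        by (rule nn_integral_mono)
      with 1[OF ab(1-3)] show ?thesis by (rule order_trans)
    qed
  qed simp
  also have "\<dots> \<le> (\<integral>\<^sup>+t. min (G1 t) (G2 t) * indicator {0..l} t + (G1 t + G2 t) * indicator (U - K) t \<partial>lborel)"
    by (intro nn_integral_mono) (auto simp: G_def indicator_def)
  also have "\<dots> = (\<integral>\<^sup>+t. min (G1 t) (G2 t) * indicator {0..l} t \<partial>lborel) + emeasure \<nu> (U - K)"
    by (simp add: nn_integral_add \<nu>_def emeasure_density)
  also have "\<dots> \<le> (\<integral>\<^sup>+t. min (G1 t) (G2 t) * indicator {0..l} t \<partial>lborel) + ennreal e"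
    using small by (rule add_left_mono)
  finally show "ennreal \<bar>h 0 - h l\<bar> \<le> (\<integral>\<^sup>+t. min (G1 t) (G2 t) * indicator {0..l} t \<partial>lborel) + ennreal e" .
qed

text \<open>It lets a minimizing sequence be replaced by its running minima, and the minimizer be
  compared with any competitor.\<close>

lemma p_weak_upper_gradient_min:
  fixes M :: "'a::metric_space measure"
  assumes "mms M" "0 < p"
    and 1: "p_weak_upper_gradient M p u g1" "energy M p g1 < \<infinity>"
    and 2: "p_weak_upper_gradient M p u g2" "energy M p g2 < \<infinity>"
  shows "p_weak_upper_gradient M p u (\<lambda>y. min (g1 y) (g2 y))"
proof -
  have [measurable]: "g1 \<in> borel_measurable borel" "g2 \<in> borel_measurable borel"
    using 1 2 by (auto simp: p_weak_upper_gradient_def)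
  obtain \<Gamma>1 where \<Gamma>1: "p_modulus M p \<Gamma>1 = 0" "\<forall>\<gamma> l. arc_curve \<gamma> l \<and> (\<gamma>, l) \<notin> \<Gamma>1 \<longrightarrow>
    line_integral g1 \<gamma> l < \<infinity> \<and> (\<forall>a b. 0 \<le> a \<and> a \<le> b \<and> b \<le> l \<longrightarrow>
      ennreal \<bar>u (\<gamma> a) - u (\<gamma> b)\<bar> \<le> (\<integral>\<^sup>+t. g1 (\<gamma> t) * indicator {a..b} t \<partial>lborel))"
    using p_weak_upper_gradient_segments[OF assms(1,2) 1] by blast
  obtain \<Gamma>2 where \<Gamma>2: "p_modulus M p \<Gamma>2 = 0" "\<forall>\<gamma> l. arc_curve \<gamma> l \<and> (\<gamma>, l) \<notin> \<Gamma>2 \<longrightarrow>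
    line_integral g2 \<gamma> l < \<infinity> \<and> (\<forall>a b. 0 \<le> a \<and> a \<le> b \<and> b \<le> l \<longrightarrow>
      ennreal \<bar>u (\<gamma> a) - u (\<gamma> b)\<bar> \<le> (\<integral>\<^sup>+t. g2 (\<gamma> t) * indicator {a..b} t \<partial>lborel))"
    using p_weak_upper_gradient_segments[OF assms(1,2) 2] by blast
  have "ennreal \<bar>u (\<gamma> 0) - u (\<gamma> l)\<bar> \<le> line_integral (\<lambda>y. min (g1 y) (g2 y)) \<gamma> l"
    if \<gamma>: "arc_curve \<gamma> l" "(\<gamma>, l) \<notin> \<Gamma>1 \<union> \<Gamma>2" for \<gamma> l
  proof -
    have l: "0 \<le> l" using \<gamma> by (simp add: arc_curve_def)
    define G1 where "G1 t = g1 (\<gamma> t) * indicator {0..l} t" for t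
    define G2 where "G2 t = g2 (\<gamma> t) * indicator {0..l} t" for t
    have m: "G1 \<in> borel_measurable borel" "G2 \<in> borel_measurable borel"
      unfolding G1_def G2_def by (auto intro!: borel_measurable_along_curve[OF _ \<gamma>(1)])
    have eq: "g1 (\<gamma> t) * indicator {a..b} t = G1 t * indicator {a..b} t"
      "g2 (\<gamma> t) * indicator {a..b} t = G2 t * indicator {a..b} t" if "0 \<le> a" "b \<le> l" for a b t
      using that by (auto simp: G1_def G2_def indicator_def)
    have "ennreal \<bar>u (\<gamma> 0) - u (\<gamma> l)\<bar> \<le> (\<integral>\<^sup>+t. min (G1 t) (G2 t) * indicator {0..l} t \<partial>lborel)"
    proof (rule increment_bound_min[OF m l])
      show "(\<integral>\<^sup>+t. G1 t \<partial>lborel) < \<infinity>" "(\<integral>\<^sup>+t. G2 t \<partial>lborel) < \<infinity>"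
        using \<Gamma>1(2)[rule_format, of \<gamma> l] \<Gamma>2(2)[rule_format, of \<gamma> l] \<gamma>
        by (auto simp: G1_def G2_def line_integral_def)
      fix a b :: real assume ab: "0 \<le> a" "a \<le> b" "b \<le> l"
      show "ennreal \<bar>u (\<gamma> a) - u (\<gamma> b)\<bar> \<le> (\<integral>\<^sup>+t. G1 t * indicator {a..b} t \<partial>lborel)"
        "ennreal \<bar>u (\<gamma> a) - u (\<gamma> b)\<bar> \<le> (\<integral>\<^sup>+t. G2 t * indicator {a..b} t \<partial>lborel)"
        using \<Gamma>1(2) \<Gamma>2(2) \<gamma> ab unfolding eq[OF ab(1,3), symmetric] by blast+
    qed
    also have "\<dots> = line_integral (\<lambda>y. min (g1 y) (g2 y)) \<gamma> l"
      unfolding line_integral_def by (intro nn_integral_cong) (auto simp: G1_def G2_def indicator_def)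
    finally show ?thesis .
  qed
  then show ?thesis
    unfolding p_weak_upper_gradient_def
    using p_modulus_Un_eq_0[OF assms(1,2) \<Gamma>1(1) \<Gamma>2(1)] by (auto intro!: exI[of _ "\<Gamma>1 \<union> \<Gamma>2"])
qed

text \<open>Line integrals pass to the decreasing limit by monotone convergence, which requires a
  finite first integral; the curves with an infinite line integral of \<open>G 0\<close> therefore
  join the exceptional family.\<close>

lemma p_weak_upper_gradient_INF:
  fixes M :: "'a::metric_space measure" and G :: "nat \<Rightarrow> 'a \<Rightarrow> ennreal"
  assumes "mms M" "0 < p" and G: "\<And>n. p_weak_upper_gradient M p u (G n)"
    and fin: "(\<integral>\<^sup>+y. epow (G 0 y) p \<partial>M) < \<infinity>" and dec: "decseq G"
  shows "p_weak_upper_gradient M p u (\<lambda>y. INF n. G n y)"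
proof -
  have G_meas[measurable]: "G n \<in> borel_measurable borel" for n
    using G by (auto simp: p_weak_upper_gradient_def)
  have "\<forall>n. \<exists>\<Gamma>. p_modulus M p \<Gamma> = 0 \<and> (\<forall>\<gamma> l. arc_curve \<gamma> l \<and> (\<gamma>, l) \<notin> \<Gamma> \<longrightarrow>
           ennreal \<bar>u (\<gamma> 0) - u (\<gamma> l)\<bar> \<le> line_integral (G n) \<gamma> l)"
    using G by (auto simp: p_weak_upper_gradient_def)
  then obtain \<Gamma> where \<Gamma>: "\<And>n. p_modulus M p (\<Gamma> n) = 0"
    "\<And>n \<gamma> l. arc_curve \<gamma> l \<Longrightarrow> (\<gamma>, l) \<notin> \<Gamma> n \<Longrightarrow> ennreal \<bar>u (\<gamma> 0) - u (\<gamma> l)\<bar> \<le> line_integral (G n) \<gamma> l"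
    by metis
  define \<Delta> where "\<Delta> = {(\<gamma>, l). arc_curve \<gamma> l \<and> line_integral (G 0) \<gamma> l = \<infinity>}"
  have "p_modulus M p ((\<Union>n. \<Gamma> n) \<union> \<Delta>) = 0"
    using \<Gamma>(1) p_modulus_infinite_line_integral[OF assms(1,2) G_meas fin] unfolding \<Delta>_def
    by (intro p_modulus_Un_eq_0[OF assms(1,2)] p_modulus_UN_eq_0[OF assms(1,2)])
  moreover have "ennreal \<bar>u (\<gamma> 0) - u (\<gamma> l)\<bar> \<le> line_integral (\<lambda>y. INF n. G n y) \<gamma> l"
    if \<gamma>: "arc_curve \<gamma> l" "(\<gamma>, l) \<notin> (\<Union>n. \<Gamma> n) \<union> \<Delta>" for \<gamma> l
  proof -
    have "line_integral (\<lambda>y. INF n. G n y) \<gamma> l = (\<integral>\<^sup>+t. (INF n. G n (\<gamma> t) * indicator {0..l} t) \<partial>lborel)"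
      unfolding line_integral_def by (intro nn_integral_cong) (auto simp: indicator_def)
    also have "\<dots> = (INF n. line_integral (G n) \<gamma> l)"
      unfolding line_integral_def
    proof (rule nn_integral_monotone_convergence_INF_decseq)
      show "decseq (\<lambda>n t. G n (\<gamma> t) * indicator {0..l} t)"
        using decseq_SucD[OF dec] by (intro decseq_SucI) (auto simp: le_fun_def intro!: mult_right_mono)
      show "(\<lambda>t. G n (\<gamma> t) * indicator {0..l} t) \<in> borel_measurable lborel" for n
        using borel_measurable_along_curve[OF G_meas \<gamma>(1)] by simp
      show "(\<integral>\<^sup>+t. G 0 (\<gamma> t) * indicator {0..l} t \<partial>lborel) < \<infinity>"
        using \<gamma> by (auto simp: \<Delta>_def line_integral_def less_top)
    qed
    finally show ?thesis
      using \<Gamma>(2)[OF \<gamma>(1)] \<gamma>(2) by (auto intro!: INF_greatest)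
  qed
  moreover have "(\<lambda>y. INF n. G n y) \<in> borel_measurable borel" by measurable
  ultimately show ?thesis
    unfolding p_weak_upper_gradient_def by blast
qed

text \<open>\<open>cap_p\<close> admits a function only together with a minimal weak gradient, so
  this existence is what makes test functions usable. The infimum of the running minima of a
  minimizing sequence attains the least energy \<open>I\<close>; were it above a competitor on a set
  of positive measure, the pointwise minimum of the two would have smaller energy.\<close>

lemma ex_minimal_p_weak_upper_gradient:
  fixes M :: "'a::metric_space measure"
  assumes M: "mms M" and p: "0 < p"
    and g: "p_weak_upper_gradient M p u g" "energy M p g < \<infinity>"
  shows "\<exists>g. minimal_p_weak_upper_gradient M p u g"
proof -
  define E where "E f = energy M p f" for f :: "'a \<Rightarrow> ennreal"
  define W where "W = {f. p_weak_upper_gradient M p u f \<and> E f < \<infinity>}"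
  define I where "I = (INF f\<in>W. E f)"
  have E_mono: "E f \<le> E f'" if "\<And>y. f y \<le> f' y" for f f'
    unfolding E_def using that p by (intro nn_integral_mono epow_mono) auto
  have Wmin: "(\<lambda>y. min (f y) (f' y)) \<in> W" if "f \<in> W" "f' \<in> W" for f f'
  proof -
    have "E (\<lambda>y. min (f y) (f' y)) \<le> E f" by (rule E_mono) simp
    then show ?thesis
      using that p_weak_upper_gradient_min[OF M p, of u f f'] unfolding W_def E_def by auto
  qed
  have "g \<in> W" using g by (simp add: W_def E_def)
  then have "I < \<infinity>" unfolding I_def W_def by (auto simp: INF_less_iff)
  have "\<exists>f\<in>W. E f < I + ennreal (1 / Suc n)" for n
  proof -
    have "I < I + ennreal (1 / Suc n)"
      using \<open>I < \<infinity>\<close> ennreal_add_left_cancel_less[of I 0 "ennreal (1 / Suc n)"] by auto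
    then show ?thesis unfolding I_def INF_less_iff .
  qed
  then obtain f where f: "\<And>n. f n \<in> W" "\<And>n. E (f n) < I + ennreal (1 / Suc n)" by metis
  define G where "G = rec_nat (f 0) (\<lambda>n h y. min (h y) (f (Suc n) y))"
  have G_0: "G 0 = f 0" and G_Suc: "G (Suc n) = (\<lambda>y. min (G n y) (f (Suc n) y))" for n
    by (auto simp: G_def)
  have GW: "G n \<in> W" for n
    by (induction n) (auto simp: G_0 G_Suc f intro!: Wmin)
  have Gf: "G n y \<le> f n y" for n y by (cases n) (auto simp: G_0 G_Suc)
  have dec: "decseq G" by (rule decseq_SucI) (auto simp: G_Suc le_fun_def)
  define G' where "G' y = (INF n. G n y)" for y
  have EG': "E G' \<le> I"
  proof (rule ennreal_le_epsilon)
    fix e :: real assume "0 < e"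
    then obtain n :: nat where n: "1 / Suc n < e" using nat_approx_posE by (metis of_nat_Suc)
    have "E G' \<le> E (f n)"
      unfolding G'_def by (rule E_mono) (meson Gf INF_lower UNIV_I order_trans)
    also have "\<dots> \<le> I + ennreal (1 / Suc n)" using f(2)[of n] by simp
    also have "\<dots> \<le> I + ennreal e" using n by (intro add_left_mono ennreal_leI) simp
    finally show "E G' \<le> I + ennreal e" .
  qed
  have G'W: "G' \<in> W"
    unfolding W_def G'_def
    using p_weak_upper_gradient_INF[OF M p, of u G] GW dec EG' \<open>I < \<infinity>\<close>
    by (auto simp: W_def E_def G'_def[abs_def] less_top)
  have "AE y in M. G' y \<le> g' y" if g': "g' \<in> W" for g'
  proof -
    have [measurable]: "G' \<in> borel_measurable M" "g' \<in> borel_measurable M"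
      using G'W g' by (auto simp: W_def p_weak_upper_gradient_def intro!: mms_borel_measurable[OF M])
    define m where "m y = min (G' y) (g' y)" for y
    have "m \<in> W" unfolding m_def by (rule Wmin[OF G'W g'])
    then have "E G' \<le> E m" using EG' unfolding I_def by (meson INF_lower order_trans)
    moreover have "E m \<noteq> \<infinity>" using \<open>m \<in> W\<close> by (auto simp: W_def)
    ultimately have "AE y in M. epow (G' y) p \<le> epow (m y) p"
      using nn_integral_less[of "\<lambda>y. epow (m y) p" M "\<lambda>y. epow (G' y) p"] p
      unfolding E_def by (force simp: m_def intro!: epow_mono)
    then show ?thesis
      by eventually_elim (use p in \<open>auto simp: m_def dest!: epow_le_cancel\<close>)
  qed
  then show ?thesis
    using G'W by (auto simp: minimal_p_weak_upper_gradient_def W_def E_def intro!: exI[of _ G'])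
qed

section \<open>Capacity and upper gradients\<close>

lemma upper_gradient_imp_p_weak:
  assumes "upper_gradient u g"
  shows "p_weak_upper_gradient M p u g"
proof -
  have "p_modulus M p {} = 0"
    unfolding p_modulus_eq_0_iff by (auto intro!: bexI[of _ "\<lambda>_. 0"])
  then show ?thesis
    using assms by (auto simp: upper_gradient_def p_weak_upper_gradient_def intro!: exI[of _ "{}"])
qed

lemma cap_p_le_upper_gradient:
  fixes M :: "'a::metric_space measure"
  assumes M: "mms M" and p: "0 < p" and u: "u \<in> borel_measurable M"
    "(\<integral>\<^sup>+y. ennreal (\<bar>u y\<bar> powr p) \<partial>M) < \<infinity>" "\<And>y. y \<notin> \<Omega> \<Longrightarrow> u y = 0" "\<And>y. y \<in> A \<Longrightarrow> 1 \<le> u y"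
    and g: "upper_gradient u g" "energy M p g < \<infinity>"
  shows "cap_p M p A \<Omega> \<le> energy M p g"
proof -
  obtain g' where g': "minimal_p_weak_upper_gradient M p u g'"
    using ex_minimal_p_weak_upper_gradient[OF M p upper_gradient_imp_p_weak g(2)] g(1) by blast
  have "newtonian M p u" using u g by (auto simp: newtonian_def)
  then have "cap_p M p A \<Omega> \<le> (\<integral>\<^sup>+y. epow (g' y) p * indicator \<Omega> y \<partial>M)"
    unfolding cap_p_def using u g' by (intro INF_lower2[of "(u, g')"]) auto
  also have "AE y in M. g' y \<le> g y"
    using g' g upper_gradient_imp_p_weak[OF g(1)] by (auto simp: minimal_p_weak_upper_gradient_def)
  then have "(\<integral>\<^sup>+y. epow (g' y) p * indicator \<Omega> y \<partial>M) \<le> energy M p g"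
    by (intro nn_integral_mono_AE, eventually_elim) (use p in \<open>auto simp: indicator_def intro!: epow_mono\<close>)
  finally show ?thesis .
qed

text \<open>On an exceptional curve the admissible density alone contributes at least 1, and a
  function with values in \<open>{0..1}\<close> cannot change by more.\<close>

lemma upper_gradient_of_p_weak:
  fixes u :: "'a::metric_space \<Rightarrow> real"
  assumes g: "p_weak_upper_gradient M p u g" and u: "\<And>y. 0 \<le> u y" "\<And>y. u y \<le> 1" and e: "0 < e"
  shows "\<exists>\<rho>. \<rho> \<in> borel_measurable borel \<and> energy M p \<rho> < e \<and>
    upper_gradient u (\<lambda>y. g y + \<rho> y)"
proof -
  obtain \<Gamma> where [measurable]: "g \<in> borel_measurable borel" and \<Gamma>: "p_modulus M p \<Gamma> = 0"
    "\<And>\<gamma> l. arc_curve \<gamma> l \<Longrightarrow> (\<gamma>, l) \<notin> \<Gamma> \<Longrightarrow> ennreal \<bar>u (\<gamma> 0) - u (\<gamma> l)\<bar> \<le> line_integral g \<gamma> l"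
    using g unfolding p_weak_upper_gradient_def by blast
  obtain \<rho> where \<rho>[measurable]: "\<rho> \<in> borel_measurable borel"
    and \<rho>1: "\<And>\<gamma> l. (\<gamma>, l) \<in> \<Gamma> \<Longrightarrow> 1 \<le> line_integral \<rho> \<gamma> l" and \<rho>e: "energy M p \<rho> < e"
    using \<Gamma>(1) e unfolding p_modulus_eq_0_iff by blast
  have "ennreal \<bar>u (\<gamma> 0) - u (\<gamma> l)\<bar> \<le> line_integral (\<lambda>y. g y + \<rho> y) \<gamma> l" if "arc_curve \<gamma> l" for \<gamma> l
  proof -
    have "line_integral g \<gamma> l \<le> line_integral (\<lambda>y. g y + \<rho> y) \<gamma> l"
      "line_integral \<rho> \<gamma> l \<le> line_integral (\<lambda>y. g y + \<rho> y) \<gamma> l"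
      unfolding line_integral_def by (auto intro!: nn_integral_mono mult_right_mono)
    moreover have "ennreal \<bar>u (\<gamma> 0) - u (\<gamma> l)\<bar> \<le> 1"
      using u[of "\<gamma> 0"] u[of "\<gamma> l"] by (simp add: ennreal_le_1 abs_le_iff)
    ultimately show ?thesis
      using \<Gamma>(2)[OF that] \<rho>1[of \<gamma> l] by (metis order_trans)
  qed
  then show ?thesis
    using \<rho>e by (intro exI[of _ \<rho>]) (auto simp: upper_gradient_def)
qed

text \<open>Truncation to \<open>{0..1}\<close> keeps the weak gradient and makes
  \<open>upper_gradient_of_p_weak\<close> applicable, so that the lower bound has to be known for
  genuine upper gradients only. The factor \<open>2 powr p\<close> comes from splitting
  \<open>g + \<rho>\<close> by \<open>epow_add_le\<close>; the part with \<open>\<rho>\<close>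
  contributes at most \<open>e\<close>.\<close>

lemma cap_p_ge_upper_gradient:
  fixes M :: "'a::metric_space measure"
  assumes M: "mms M" and p: "0 < p" and \<Omega>: "open \<Omega>"
    and lower: "\<And>u g. u \<in> borel_measurable M \<Longrightarrow> (\<And>y. 0 \<le> u y) \<Longrightarrow> (\<And>y. u y \<le> 1) \<Longrightarrow>
      (\<And>y. y \<notin> \<Omega> \<Longrightarrow> u y = 0) \<Longrightarrow> (\<And>y. y \<in> A \<Longrightarrow> u y = 1) \<Longrightarrow> upper_gradient u g \<Longrightarrow>
      c \<le> energy M p g"
  shows "c \<le> ennreal (2 powr p) * cap_p M p A \<Omega>"
proof -
  have "c \<le> ennreal (2 powr p) * (\<integral>\<^sup>+y. epow (g y) p * indicator \<Omega> y \<partial>M)"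
    if u: "newtonian M p u" "\<And>y. y \<notin> \<Omega> \<Longrightarrow> u y = 0" "\<And>y. y \<in> A \<Longrightarrow> 1 \<le> u y"
      "minimal_p_weak_upper_gradient M p u g" for u g
  proof (rule ennreal_le_epsilon)
    fix e :: real assume e: "0 < e"
    define v where "v y = max 0 (min 1 (u y))" for y
    have [measurable]: "u \<in> borel_measurable M" using u(1) by (simp add: newtonian_def)
    have "p_weak_upper_gradient M p u g" using u(4) by (simp add: minimal_p_weak_upper_gradient_def)
    then obtain \<Gamma> where g[measurable]: "g \<in> borel_measurable borel" and \<Gamma>: "p_modulus M p \<Gamma> = 0"
      "\<And>\<gamma> l. arc_curve \<gamma> l \<Longrightarrow> (\<gamma>, l) \<notin> \<Gamma> \<Longrightarrow> ennreal \<bar>u (\<gamma> 0) - u (\<gamma> l)\<bar> \<le> line_integral g \<gamma> l"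
      unfolding p_weak_upper_gradient_def by blast
    have "ennreal \<bar>v a - v b\<bar> \<le> ennreal \<bar>u a - u b\<bar>" for a b
      unfolding v_def by (intro ennreal_leI) linarith
    then have wv: "p_weak_upper_gradient M p v g"
      unfolding p_weak_upper_gradient_def using g \<Gamma> by (meson order_trans)
    have "0 < ennreal (e / 2 powr p)" using e by simp
    with upper_gradient_of_p_weak[OF wv, of "ennreal (e / 2 powr p)"]
    obtain \<rho> where [measurable]: "\<rho> \<in> borel_measurable borel"
      and \<rho>: "energy M p \<rho> < ennreal (e / 2 powr p)" "upper_gradient v (\<lambda>y. g y + \<rho> y)"
      by (auto simp: v_def)
    note [measurable] = mms_borel_measurable[OF M \<open>g \<in> _\<close>] mms_borel_measurable[OF M \<open>\<rho> \<in> _\<close>]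
    have [measurable]: "\<Omega> \<in> sets M" using M \<Omega> by (auto simp: mms_def)
    have ug: "upper_gradient v (\<lambda>y. (g y + \<rho> y) * indicator \<Omega> y)"
      by (rule upper_gradient_restrict_open[OF \<rho>(2) \<Omega>]) (simp add: v_def u(2))
    have "c \<le> (\<integral>\<^sup>+y. epow ((g y + \<rho> y) * indicator \<Omega> y) p \<partial>M)"
    proof (rule lower[OF _ _ _ _ _ ug])
      show "v \<in> borel_measurable M" unfolding v_def by measurable
    qed (use u in \<open>auto simp: v_def\<close>)
    also have "\<dots> \<le> (\<integral>\<^sup>+y. ennreal (2 powr p) * (epow (g y) p * indicator \<Omega> y + epow (\<rho> y) p) \<partial>M)"
      using epow_add_le[of p] p
      by (intro nn_integral_mono) (auto simp: indicator_def)
    also have "\<dots> = ennreal (2 powr p) * (\<integral>\<^sup>+y. epow (g y) p * indicator \<Omega> y \<partial>M) +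
        ennreal (2 powr p) * energy M p \<rho>"
      by (simp add: nn_integral_cmult nn_integral_add distrib_left)
    also have "ennreal (2 powr p) * energy M p \<rho> \<le> ennreal (2 powr p) * ennreal (e / 2 powr p)"
      using \<rho>(1) by (intro mult_left_mono) auto
    also have "\<dots> = ennreal e" using e by (simp flip: ennreal_mult)
    finally show "c \<le> ennreal (2 powr p) * (\<integral>\<^sup>+y. epow (g y) p * indicator \<Omega> y \<partial>M) + ennreal e"
      by (simp add: add_left_mono)
  qed
  then have "c / ennreal (2 powr p) \<le> cap_p M p A \<Omega>"
    unfolding cap_p_def by (auto intro!: INF_greatest simp: divide_le_posI_ennreal)
  then have "ennreal (2 powr p) * (c / ennreal (2 powr p)) \<le> ennreal (2 powr p) * cap_p M p A \<Omega>"
    by (rule mult_left_mono) simp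
  moreover have "ennreal (2 powr p) * (c / ennreal (2 powr p)) = c"
    by (simp add: mult.commute[of _ "c / _"] ennreal_divide_times ennreal_divide_self)
  ultimately show ?thesis by simp
qed

section \<open>Doubling measures\<close>

locale doubling_space =
  fixes M :: "'a::metric_space measure" and D :: real
  assumes mms: "mms M" and D_ge_1: "1 \<le> D"
    and doubling: "0 < r \<Longrightarrow> measure M (ball y (2 * r)) \<le> D * measure M (ball y r)"
begin

abbreviation vol :: "'a \<Rightarrow> real \<Rightarrow> real" where
  "vol y r \<equiv> measure M (ball y r)"

lemma space_M [simp]: "space M = UNIV"
  using mms by (simp add: mms_def)

lemma sets_M_borel: "A \<in> sets borel \<Longrightarrow> A \<in> sets M"
  using mms by (auto simp: mms_def)

lemma ball_sets [measurable, simp]: "ball y r \<in> sets M"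
  by (rule sets_M_borel) simp

lemma emeasure_ball_finite [simp]: "emeasure M (ball y r) < top"
proof (cases "0 < r")
  case True
  then show ?thesis using mms unfolding mms_def by auto
qed (simp add: ball_empty)

lemma emeasure_ball: "emeasure M (ball y r) = ennreal (vol y r)"
  by (simp add: measure_def)

lemma fmeasurable_ball [simp]: "ball y r \<in> fmeasurable M"
  by (simp add: fmeasurable_def)

lemma vol_pos:
  assumes "0 < r"
  shows "0 < vol y r"
proof -
  have "0 < emeasure M (ball y r)" using mms assms unfolding mms_def by blast
  then show ?thesis unfolding emeasure_ball by simp
qed

lemma ball_subset_iff_dist: "dist y z + r \<le> s \<Longrightarrow> ball y r \<subseteq> ball z s"
  by (smt (verit) dist_commute dist_triangle mem_ball subsetI)

lemma vol_mono: "dist y z + r \<le> s \<Longrightarrow> vol y r \<le> vol z s"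
  by (intro measure_mono_fmeasurable ball_subset_iff_dist) auto

lemma vol_mono_radius: "r \<le> s \<Longrightarrow> vol y r \<le> vol y s"
  by (rule vol_mono) simp

lemma vol_power: "0 < r \<Longrightarrow> vol y (2 ^ m * r) \<le> D ^ m * vol y r"
proof (induction m)
  case (Suc m)
  have "vol y (2 ^ Suc m * r) = vol y (2 * (2 ^ m * r))" by (simp add: mult.assoc)
  also have "\<dots> \<le> D * vol y (2 ^ m * r)" using Suc.prems by (intro doubling) simp
  also have "\<dots> \<le> D * (D ^ m * vol y r)" using Suc D_ge_1 by (intro mult_left_mono) auto
  finally show ?case by (simp add: mult.assoc)
qed simp

lemma vol_compare:
  assumes "0 < r" "dist y z + s \<le> 2 ^ m * r"
  shows "vol y s \<le> D ^ m * vol z r"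
  using vol_mono[OF assms(2)] vol_power[OF assms(1), of z m] by linarith

text \<open>The balls of radius \<open>\<epsilon> / 2\<close> about the points are disjoint and lie
  in \<open>ball y (2 ^ (m + 1) * \<epsilon>)\<close>, which in turn lies in the
  \<open>2 ^ (m + 3)\<close>-fold enlargement of each of them; by doubling each carries at least the
  fraction \<open>1 / D ^ (m + 3)\<close> of its volume.\<close>

lemma separated_card_le:
  fixes y :: 'a
  assumes "finite S" "0 < \<epsilon>" "S \<subseteq> ball y (2 ^ m * \<epsilon>)"
    and sep: "\<And>a b. a \<in> S \<Longrightarrow> b \<in> S \<Longrightarrow> a \<noteq> b \<Longrightarrow> \<epsilon> \<le> dist a b"
  shows "real (card S) \<le> D ^ (m + 3)"
proof -
  let ?V = "vol y (2 ^ (m + 1) * \<epsilon>)"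
  have e: "\<epsilon> \<le> 2 ^ m * \<epsilon>" using assms(2) by simp
  have pos_\<epsilon>: "0 < 2 ^ m * \<epsilon>" using assms(2) by simp
  have pw: "2 ^ (m + 1) * \<epsilon> = 2 * (2 ^ m * \<epsilon>)" "2 ^ (m + 3) * (\<epsilon> / 2) = 4 * (2 ^ m * \<epsilon>)"
    by (simp_all add: power_add)
  have disj: "disjoint_family_on (\<lambda>a. ball a (\<epsilon> / 2)) S"
  proof (clarsimp simp: disjoint_family_on_def, rule equals0I, clarsimp)
    fix a b z assume "a \<in> S" "b \<in> S" "a \<noteq> b" "dist a z * 2 < \<epsilon>" "dist b z * 2 < \<epsilon>"
    then show False using sep[of a b] dist_triangle2[of a b z] by (simp add: dist_commute)
  qed
  have "card S * (?V / D ^ (m + 3)) = (\<Sum>a\<in>S. ?V / D ^ (m + 3))" by simp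
  also have "\<dots> \<le> (\<Sum>a\<in>S. vol a (\<epsilon> / 2))"
  proof (rule sum_mono)
    fix a assume "a \<in> S"
    then have "dist y a < 2 ^ m * \<epsilon>" using assms(3) by auto
    then have "dist y a + 2 ^ (m + 1) * \<epsilon> \<le> 2 ^ (m + 3) * (\<epsilon> / 2)"
      using pw pos_\<epsilon> by linarith
    from vol_compare[OF _ this] assms(2) D_ge_1 show "?V / D ^ (m + 3) \<le> vol a (\<epsilon> / 2)"
      by (simp add: divide_le_eq mult.commute)
  qed
  also have "\<dots> = measure M (\<Union>a\<in>S. ball a (\<epsilon> / 2))"
    using assms(1) disj by (intro measure_finite_Union[symmetric]) (auto simp: emeasure_ball)
  also have "\<dots> \<le> ?V"
  proof (intro measure_mono_fmeasurable)
    show "(\<Union>a\<in>S. ball a (\<epsilon> / 2)) \<subseteq> ball y (2 ^ (m + 1) * \<epsilon>)"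
    proof (rule UN_least)
      fix a assume "a \<in> S"
      then have "dist a y < 2 ^ m * \<epsilon>" using assms(3) by (auto simp: dist_commute)
      then show "ball a (\<epsilon> / 2) \<subseteq> ball y (2 ^ (m + 1) * \<epsilon>)"
        using e assms(2) pw(1) by (intro ball_subset_iff_dist) linarith
    qed
  qed (use assms(1) in auto)
  finally have *: "card S * (?V / D ^ (m + 3)) \<le> ?V" .
  have "0 < ?V" using assms(2) by (intro vol_pos) auto
  with * D_ge_1 show ?thesis by (simp add: divide_simps)
qed

text \<open>\<open>separated_card_le\<close> bounds the cardinality of separated subsets of the
  ball, so one of largest cardinality exists; a point far from all of its elements could be added to
  it.\<close>

lemma ex_finite_net:
  fixes x :: 'a
  assumes "0 < \<epsilon>"
  shows "\<exists>S. finite S \<and> S \<subseteq> ball x R \<and> (\<forall>a\<in>S. \<forall>b\<in>S. a \<noteq> b \<longrightarrow> \<epsilon> \<le> dist a b) \<and>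
    (\<forall>y\<in>ball x R. \<exists>a\<in>S. dist y a < \<epsilon>)"
proof -
  obtain m :: nat where "R / \<epsilon> < 2 ^ m" using real_arch_pow[of 2 "R / \<epsilon>"] by auto
  then have "R \<le> 2 ^ m * \<epsilon>" using assms by (simp add: divide_less_eq)
  then have sub: "ball x R \<subseteq> ball x (2 ^ m * \<epsilon>)" by auto
  define P where "P n \<longleftrightarrow> (\<exists>S. finite S \<and> S \<subseteq> ball x R \<and>
    (\<forall>a\<in>S. \<forall>b\<in>S. a \<noteq> b \<longrightarrow> \<epsilon> \<le> dist a b) \<and> card S = n)" for n
  have "P 0" unfolding P_def by (intro exI[of _ "{}"]) auto
  have bound: "n \<le> nat \<lfloor>D ^ (m + 3)\<rfloor>" if "P n" for n
  proof -
    from that have "real n \<le> D ^ (m + 3)"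
      unfolding P_def using separated_card_le[OF _ assms, of _ x m] sub by (metis subset_trans)
    then show ?thesis by linarith
  qed
  have "P (Greatest P)" by (rule GreatestI_nat[where P=P and k=0, OF \<open>P 0\<close> bound])
  then obtain S where S: "finite S" "S \<subseteq> ball x R" "\<forall>a\<in>S. \<forall>b\<in>S. a \<noteq> b \<longrightarrow> \<epsilon> \<le> dist a b"
    "card S = Greatest P" unfolding P_def by blast
  have "\<exists>a\<in>S. dist y a < \<epsilon>" if y: "y \<in> ball x R" for y
  proof (rule ccontr)
    assume *: "\<not> ?thesis"
    then have "y \<notin> S" using assms by (metis dist_self)
    have "P (card (insert y S))"
      unfolding P_def using S * y by (intro exI[of _ "insert y S"]) (auto simp: dist_commute not_less)
    then have "card (insert y S) \<le> Greatest P" by (rule Greatest_le_nat[OF _ bound])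
    then show False using \<open>y \<notin> S\<close> S by simp
  qed
  then show ?thesis using S by blast
qed

lemma bounded_set_integrable:
  fixes f :: "'a \<Rightarrow> real"
  assumes "f \<in> borel_measurable M" "\<And>y. \<bar>f y\<bar> \<le> c"
  shows "set_integrable M (ball y r) f"
  unfolding set_integrable_def
  by (rule integrableI_bounded_set_indicator[where B=c]) (use assms in auto)

end

section \<open>Consequences of the Poincare inequality\<close>

text \<open>The right-hand side of the inequality enters only through an upper bound \<open>s\<close> for the
  \<open>L\<^sup>p\<close>-average of the gradient, so that no roots of extended reals are needed.\<close>
locale poincare_space = doubling_space +
  fixes p K lam :: real
  assumes p_gt_1: "1 < p" and K_ge_1: "1 \<le> K" and lam_ge_1: "1 \<le> lam"
    and poincare: "0 < r \<Longrightarrow> f \<in> borel_measurable M \<Longrightarrow> set_integrable M (ball y r) f \<Longrightarrow>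
      upper_gradient f g \<Longrightarrow> 0 \<le> s \<Longrightarrow>
      (\<integral>\<^sup>+z. epow (g z) p * indicator (ball y (lam * r)) z \<partial>M) \<le> ennreal (s powr p * measure M (ball y (lam * r))) \<Longrightarrow>
      (\<integral>z\<in>ball y r. \<bar>f z - avg M (ball y r) f\<bar> \<partial>M) \<le> K * r * s * measure M (ball y r)"
begin

lemma set_integrable_abs_diff_const:
  assumes "set_integrable M (ball y r) f" "A \<in> sets M" "A \<subseteq> ball y r"
  shows "set_integrable M A (\<lambda>z. \<bar>f z - (c::real)\<bar>)" "set_integrable M A (\<lambda>z. f z - c)"
proof -
  have "set_integrable M (ball y r) (\<lambda>_. c)"
    by (rule bounded_set_integrable[where c="\<bar>c\<bar>"]) auto
  then have "set_integrable M (ball y r) (\<lambda>z. f z - c)"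
    using assms(1) by (rule set_integral_diff[rotated])
  then show "set_integrable M A (\<lambda>z. f z - c)" using assms(2,3) by (rule set_integrable_subset)
  then show "set_integrable M A (\<lambda>z. \<bar>f z - c\<bar>)" by (rule set_integrable_abs)
qed

lemma set_integral_abs_mono:
  assumes "set_integrable M (ball y r) f" "A \<in> sets M" "A \<subseteq> ball y r"
  shows "(\<integral>z\<in>A. \<bar>f z - (c::real)\<bar> \<partial>M) \<le> (\<integral>z\<in>ball y r. \<bar>f z - c\<bar> \<partial>M)"
  using set_integrable_abs_diff_const(1)[OF assms, of c] set_integrable_abs_diff_const(1)[OF assms(1), of "ball y r" c] assms
  unfolding set_lebesgue_integral_def set_integrable_def
  by (intro integral_mono) (auto simp: indicator_def)

lemma average_diff_le:
  assumes "0 < \<rho>" "ball z \<rho> \<subseteq> ball y r" "set_integrable M (ball y r) f"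
  shows "\<bar>avg M (ball z \<rho>) f - c\<bar> * vol z \<rho> \<le> (\<integral>z\<in>ball y r. \<bar>f z - c\<bar> \<partial>M)"
proof -
  have int: "set_integrable M (ball z \<rho>) (\<lambda>z. f z - c)" "set_integrable M (ball z \<rho>) f"
    using set_integrable_abs_diff_const(2)[OF assms(3) _ assms(2)] set_integrable_subset[OF assms(3) _ assms(2)] by auto
  have const: "set_integrable M (ball z \<rho>) (\<lambda>_. c)"
    by (rule bounded_set_integrable[where c="\<bar>c\<bar>"]) auto
  have pos: "0 < vol z \<rho>" by (rule vol_pos[OF assms(1)])
  have "(avg M (ball z \<rho>) f - c) * vol z \<rho> = (\<integral>z\<in>ball z \<rho>. f z \<partial>M) - c * vol z \<rho>"
    using pos by (simp add: avg_def field_simps)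
  also have "\<dots> = (\<integral>z\<in>ball z \<rho>. f z - c \<partial>M)"
    using int const by (subst set_integral_diff(2)) (auto simp: set_lebesgue_integral_def mult.commute)
  finally have "\<bar>avg M (ball z \<rho>) f - c\<bar> * vol z \<rho> = \<bar>\<integral>z\<in>ball z \<rho>. f z - c \<partial>M\<bar>"
    using pos by (metis abs_mult abs_of_pos)
  also have "\<dots> \<le> (\<integral>z\<in>ball z \<rho>. \<bar>f z - c\<bar> \<partial>M)"
    using set_integral_norm_bound[OF int(1)] by simp
  also have "\<dots> \<le> (\<integral>z\<in>ball y r. \<bar>f z - c\<bar> \<partial>M)"
    by (rule set_integral_abs_mono[OF assms(3) _ assms(2)]) simp
  finally show ?thesis .
qed

text \<open>Whichever side of the midpoint \<open>(a + b) / 2\<close> the mean lies on,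
  \<open>f\<close> differs from it by at least \<open>(b - a) / 2\<close> on all of \<open>U\<close>
  or on all of \<open>V\<close>.\<close>

lemma poincare_level_sets:
  assumes "0 < r" "f \<in> borel_measurable M" "set_integrable M (ball y r) f" "upper_gradient f g" "0 \<le> s"
    "(\<integral>\<^sup>+z. epow (g z) p * indicator (ball y (lam * r)) z \<partial>M) \<le> ennreal (s powr p * vol y (lam * r))"
    and F: "U \<in> sets M" "V \<in> sets M" "U \<subseteq> ball y r" "V \<subseteq> ball y r"
    "\<And>z. z \<in> U \<Longrightarrow> b \<le> f z" "\<And>z. z \<in> V \<Longrightarrow> f z \<le> a" "a \<le> b"
    "\<theta> \<le> measure M U" "\<theta> \<le> measure M V"
  shows "(b - a) / 2 * \<theta> \<le> K * r * s * vol y r"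
proof -
  define c where "c = avg M (ball y r) f"
  have *: "(b - a) / 2 * \<theta> \<le> (\<integral>z\<in>ball y r. \<bar>f z - c\<bar> \<partial>M)"
    if F: "F \<in> sets M" "F \<subseteq> ball y r" "\<theta> \<le> measure M F" "\<And>z. z \<in> F \<Longrightarrow> (b - a) / 2 \<le> \<bar>f z - c\<bar>" for F
  proof -
    have Ffm: "F \<in> fmeasurable M" using F by (intro fmeasurableI2[OF fmeasurable_ball])
    have "(b - a) / 2 * \<theta> \<le> (b - a) / 2 * measure M F" using F \<open>a \<le> b\<close> by (intro mult_left_mono) auto
    also have "\<dots> = (\<integral>z\<in>F. (b - a) / 2 \<partial>M)"
      using F by (simp add: set_lebesgue_integral_def)
    also have "\<dots> \<le> (\<integral>z\<in>F. \<bar>f z - c\<bar> \<partial>M)"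
    proof (rule set_integral_mono)
      show "set_integrable M F (\<lambda>_. (b - a) / 2)"
        using Ffm by (auto simp: set_integrable_def fmeasurable_def)
      show "set_integrable M F (\<lambda>z. \<bar>f z - c\<bar>)"
        by (rule set_integrable_abs_diff_const(1)[OF assms(3) F(1,2)])
    qed (rule F(4))
    also have "\<dots> \<le> (\<integral>z\<in>ball y r. \<bar>f z - c\<bar> \<partial>M)"
      by (rule set_integral_abs_mono[OF assms(3) F(1,2)])
    finally show ?thesis .
  qed
  have "(b - a) / 2 * \<theta> \<le> (\<integral>z\<in>ball y r. \<bar>f z - c\<bar> \<partial>M)"
  proof (cases "c \<le> (a + b) / 2")
    case True
    have "(b - a) / 2 \<le> \<bar>f z - c\<bar>" if "z \<in> U" for z
      using F(5)[OF that] True by (simp add: field_simps abs_real_def)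
    then show ?thesis using F by (intro *[of U]) auto
  next
    case False
    have "(b - a) / 2 \<le> \<bar>f z - c\<bar>" if "z \<in> V" for z
      using F(6)[OF that] False by (simp add: field_simps abs_real_def)
    then show ?thesis using F by (intro *[of V]) auto
  qed
  also have "\<dots> \<le> K * r * s * vol y r"
    unfolding c_def by (rule poincare[OF assms(1-6)])
  finally show ?thesis .
qed

end

section \<open>Smoothing\<close>

text \<open>Normalised weights sum to 1, so \<open>c\<close> may be subtracted from all values
  \<open>v i\<close> before comparing. A normalised weight changes by at most
  \<open>(N + 1) * (d / \<epsilon>)\<close>: one part from its numerator, \<open>N\<close> parts
  from the total weight.\<close>

lemma weighted_average_lipschitz:
  fixes a b v :: "'i \<Rightarrow> real"
  assumes S: "finite S" "T \<subseteq> S" "real (card T) \<le> N"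
    and nonneg: "\<And>i. i \<in> S \<Longrightarrow> 0 \<le> a i" "\<And>i. i \<in> S \<Longrightarrow> 0 \<le> b i"
    and zero: "\<And>i. i \<in> S - T \<Longrightarrow> a i = 0" "\<And>i. i \<in> S - T \<Longrightarrow> b i = 0"
    and ab: "\<And>i. i \<in> T \<Longrightarrow> \<bar>a i - b i\<bar> \<le> d" and v: "\<And>i. i \<in> T \<Longrightarrow> \<bar>v i - c\<bar> \<le> \<delta>"
    and pos: "0 < \<epsilon>" "\<epsilon> \<le> (\<Sum>i\<in>S. a i)" "0 < (\<Sum>i\<in>S. b i)" "0 \<le> d" "0 \<le> \<delta>"
  shows "\<bar>(\<Sum>i\<in>S. a i * v i) / (\<Sum>i\<in>S. a i) - (\<Sum>i\<in>S. b i * v i) / (\<Sum>i\<in>S. b i)\<bar>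
    \<le> N * (N + 1) * \<delta> * (d / \<epsilon>)"
proof -
  define A B where "A = (\<Sum>i\<in>S. a i)" and "B = (\<Sum>i\<in>S. b i)"
  have A: "\<epsilon> \<le> A" "0 < A" and B: "0 < B" using pos by (auto simp: A_def B_def)
  have N: "0 \<le> N" using S(3) by linarith
  have finT: "finite T" using S finite_subset by blast
  have AB: "\<bar>B - A\<bar> \<le> N * d"
  proof -
    have "B - A = (\<Sum>i\<in>S. b i - a i)" by (simp add: A_def B_def sum_subtractf)
    also have "\<dots> = (\<Sum>i\<in>T. b i - a i)" using S zero by (intro sum.mono_neutral_right) auto
    finally have "\<bar>B - A\<bar> \<le> (\<Sum>i\<in>T. \<bar>b i - a i\<bar>)" by simp
    also have "\<dots> \<le> (\<Sum>i\<in>T. d)" using ab by (intro sum_mono) (simp add: abs_minus_commute)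
    also have "\<dots> = card T * d" by simp
    also have "\<dots> \<le> N * d" using S(3) pos by (intro mult_right_mono) auto
    finally show ?thesis .
  qed
  have quot: "\<bar>a i / A - b i / B\<bar> \<le> (N + 1) * (d / \<epsilon>)" if "i \<in> T" for i
  proof -
    have bB: "0 \<le> b i / B" "b i / B \<le> 1"
    proof -
      have "b i \<le> B" unfolding B_def using S nonneg that by (intro member_le_sum) auto
      then show "b i / B \<le> 1" using B by simp
      show "0 \<le> b i / B" using nonneg that S B by (auto intro!: divide_nonneg_pos)
    qed
    have "a i / A - b i / B = (a i - b i) / A + b i / B * ((B - A) / A)"
      using A B by (simp add: field_simps)
    also have "\<bar>\<dots>\<bar> \<le> \<bar>a i - b i\<bar> / A + b i / B * (\<bar>B - A\<bar> / A)"
      using A B nonneg(2)[of i] S(2) that by (intro order_trans[OF abs_triangle_ineq]) (auto simp: abs_mult)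
    also have "\<dots> \<le> d / \<epsilon> + 1 * (N * d / \<epsilon>)"
      using ab[OF that] A bB AB pos N by (intro add_mono mult_mono frac_le) auto
    finally show ?thesis by (simp add: distrib_right add_divide_distrib)
  qed
  have "(\<Sum>i\<in>S. a i * v i) / A - (\<Sum>i\<in>S. b i * v i) / B = (\<Sum>i\<in>S. (v i - c) * (a i / A - b i / B))"
  proof -
    have "(\<Sum>i\<in>S. (v i - c) * (a i / A - b i / B)) =
        ((\<Sum>i\<in>S. a i * v i) / A - (\<Sum>i\<in>S. b i * v i) / B) - c * ((\<Sum>i\<in>S. a i) / A - (\<Sum>i\<in>S. b i) / B)"
      by (simp add: sum_divide_distrib sum_distrib_left sum_subtractf[symmetric] algebra_simps diff_divide_distrib)
    then show ?thesis using A B by (simp add: A_def[symmetric] B_def[symmetric])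
  qed
  also have "\<dots> = (\<Sum>i\<in>T. (v i - c) * (a i / A - b i / B))"
    using S zero by (intro sum.mono_neutral_right) auto
  also have "\<bar>\<dots>\<bar> \<le> (\<Sum>i\<in>T. \<bar>(v i - c) * (a i / A - b i / B)\<bar>)" by simp
  also have "\<dots> \<le> (\<Sum>i\<in>T. \<delta> * ((N + 1) * (d / \<epsilon>)))"
    unfolding abs_mult using v quot pos N by (intro sum_mono mult_mono) auto
  also have "\<dots> = card T * (\<delta> * ((N + 1) * (d / \<epsilon>)))" by simp
  also have "\<dots> \<le> N * (\<delta> * ((N + 1) * (d / \<epsilon>)))"
    using S(3) pos N by (intro mult_right_mono) auto
  finally show ?thesis by (simp add: A_def B_def mult_ac)
qed

section \<open>Averages over balls of a fixed small radius\<close>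

context poincare_space
begin

text \<open>Both small balls lie in \<open>ball b (5 * \<epsilon>)\<close>, whose mean is compared
  with theirs; this ball lies in the 16-fold enlargement of either, whence
  \<open>D ^ 4\<close>.\<close>

lemma ball_average_diff_le:
  assumes "0 < \<epsilon>" "dist a b < 4 * \<epsilon>" "u \<in> borel_measurable M" "\<And>y. \<bar>u y\<bar> \<le> 1" "upper_gradient u g" "0 \<le> s"
    "(\<integral>\<^sup>+z. epow (g z) p * indicator (ball b (lam * (5 * \<epsilon>))) z \<partial>M) \<le> ennreal (s powr p * vol b (lam * (5 * \<epsilon>)))"
  shows "\<bar>avg M (ball a \<epsilon>) u - avg M (ball b \<epsilon>) u\<bar> \<le> 10 * K * D ^ 4 * \<epsilon> * s"
proof -
  define c where "c = avg M (ball b (5 * \<epsilon>)) u"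
  have int: "set_integrable M (ball b (5 * \<epsilon>)) u"
    by (rule bounded_set_integrable[OF assms(3,4)])
  have *: "\<bar>avg M (ball z \<epsilon>) u - c\<bar> \<le> 5 * K * D ^ 4 * \<epsilon> * s" if z: "dist z b < 4 * \<epsilon>" for z
  proof -
    have pos: "0 < vol z \<epsilon>" using assms(1) by (rule vol_pos)
    have "\<bar>avg M (ball z \<epsilon>) u - c\<bar> * vol z \<epsilon> \<le> (\<integral>z\<in>ball b (5 * \<epsilon>). \<bar>u z - c\<bar> \<partial>M)"
      using z assms(1) by (intro average_diff_le[OF _ _ int] ball_subset_iff_dist) auto
    also have "\<dots> \<le> K * (5 * \<epsilon>) * s * vol b (5 * \<epsilon>)"
      unfolding c_def using assms int by (intro poincare) auto
    also have "\<dots> \<le> K * (5 * \<epsilon>) * s * (D ^ 4 * vol z \<epsilon>)"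
      using z assms K_ge_1 by (intro mult_left_mono vol_compare) (auto simp: dist_commute)
    finally have "\<bar>avg M (ball z \<epsilon>) u - c\<bar> * vol z \<epsilon> \<le> (5 * K * D ^ 4 * \<epsilon> * s) * vol z \<epsilon>"
      by (simp add: algebra_simps)
    then show ?thesis using pos by simp
  qed
  show ?thesis using *[OF assms(2)] *[of b] assms(1) by simp
qed

lemma ball_average_const:
  assumes "0 < \<epsilon>" "\<And>z. z \<in> ball a \<epsilon> \<Longrightarrow> u z = k"
  shows "avg M (ball a \<epsilon>) u = k"
proof -
  have "(\<integral>z\<in>ball a \<epsilon>. u z \<partial>M) = (\<integral>z\<in>ball a \<epsilon>. k \<partial>M)"
    using assms(2) by (intro set_lebesgue_integral_cong) auto
  also have "\<dots> = k * vol a \<epsilon>" by (simp add: set_lebesgue_integral_def mult.commute)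
  finally show ?thesis using vol_pos[OF assms(1), of a] by (simp add: avg_def)
qed

lemma ball_average_bounds:
  assumes "0 < \<epsilon>" "u \<in> borel_measurable M" "\<And>y. 0 \<le> u y" "\<And>y. u y \<le> (1::real)"
  shows "0 \<le> avg M (ball a \<epsilon>) u" "avg M (ball a \<epsilon>) u \<le> 1"
proof -
  have int: "set_integrable M (ball a \<epsilon>) u" "set_integrable M (ball a \<epsilon>) (\<lambda>_. 1::real)"
    using assms by (auto intro!: bounded_set_integrable[where c=1])
  have "(\<integral>z\<in>ball a \<epsilon>. u z \<partial>M) \<le> (\<integral>z\<in>ball a \<epsilon>. 1 \<partial>M)"
    using int assms by (intro set_integral_mono) auto
  also have "\<dots> = vol a \<epsilon>" by (simp add: set_lebesgue_integral_def)
  finally show "avg M (ball a \<epsilon>) u \<le> 1" using vol_pos[OF assms(1), of a] by (simp add: avg_def)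
  show "0 \<le> avg M (ball a \<epsilon>) u"
    unfolding avg_def set_lebesgue_integral_def using assms(3)
    by (intro divide_nonneg_nonneg Bochner_Integration.integral_nonneg) auto
qed

text \<open>Level sets of a Newtonian function are only measurable with respect to \<open>M\<close>, while upper gradients have
  to be Borel. Averaging over a net at a scale comparable to the inner radius makes the function continuous
  at the cost of a constant factor in the energy.\<close>
lemma ex_continuous_smoothing:
  "\<exists>C\<ge>0. \<forall>x \<epsilon> R u g. 0 < \<epsilon> \<and> u \<in> borel_measurable M \<and> (\<forall>y. 0 \<le> u y \<and> u y \<le> 1) \<and>
      (\<forall>y. y \<notin> ball x R \<longrightarrow> u y = 0) \<and> upper_gradient u g \<and> energy M p g < \<infinity> \<longrightarrow>
    (\<exists>w h. continuous_on UNIV w \<and> (\<forall>y. 0 \<le> w y \<and> w y \<le> 1) \<and> upper_gradient w h \<and>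
      energy M p h \<le> ennreal C * energy M p g \<and>
      (\<forall>y. R + 3 * \<epsilon> \<le> dist x y \<longrightarrow> w y = 0) \<and> (\<forall>y. (\<forall>z\<in>ball y (3 * \<epsilon>). u z = 1) \<longrightarrow> w y = 1))"
proof -
  \<comment> \<open>\<open>m\<close> doublings lead from \<open>\<epsilon>\<close> beyond the
    Poincare radius \<open>lam * (5 * \<epsilon>)\<close>, and \<open>N\<close> bounds the number of
    points of the net within \<open>4 * \<epsilon>\<close> of a given one.\<close>
  obtain m :: nat where m: "lam * 5 < 2 ^ m" using real_arch_pow[of 2 "lam * 5"] by auto
  define N where "N = D ^ 5"
  define c where "c = N * (N + 1) * (10 * K * D ^ 4)"
  have N: "1 \<le> N" using D_ge_1 by (simp add: N_def)
  have c: "0 < c" using N D_ge_1 K_ge_1 by (simp add: c_def)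
  show ?thesis
  proof (intro exI[of _ "c powr p * D ^ (m + 3)"] conjI allI impI; (elim conjE)?)
    show "0 \<le> c powr p * D ^ (m + 3)" using D_ge_1 by simp
  next
    fix x :: 'a and \<epsilon> R :: real and u :: "'a \<Rightarrow> real" and g :: "'a \<Rightarrow> ennreal"
    assume \<epsilon>: "0 < \<epsilon>" and u: "u \<in> borel_measurable M" and u01: "\<forall>y. 0 \<le> u y \<and> u y \<le> 1"
      and u0: "\<forall>y. y \<notin> ball x R \<longrightarrow> u y = 0" and ug: "upper_gradient u g"
      and fin: "energy M p g < \<infinity>"
    have g_borel: "g \<in> borel_measurable borel" using ug by (simp add: upper_gradient_def)
    note [measurable] = g_borel mms_borel_measurable[OF mms g_borel]
    have u_abs: "\<bar>u y\<bar> \<le> 1" for y using u01 by (simp add: abs_le_iff)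
    \<comment> \<open>From distance \<open>R + 3 * \<epsilon>\<close> on the smoothed function
      vanishes; the further \<open>\<epsilon>\<close> covers pairs of points at distance less than
      \<open>\<epsilon>\<close>.\<close>
    obtain S where S: "finite S" "S \<subseteq> ball x (R + 4 * \<epsilon>)"
      and sep: "\<And>a b. a \<in> S \<Longrightarrow> b \<in> S \<Longrightarrow> a \<noteq> b \<Longrightarrow> \<epsilon> \<le> dist a b"
      and net: "\<And>y. y \<in> ball x (R + 4 * \<epsilon>) \<Longrightarrow> \<exists>a\<in>S. dist y a < \<epsilon>"
      using ex_finite_net[OF \<epsilon>, of x "R + 4 * \<epsilon>"] by metis
    define \<rho> where "\<rho> = lam * (5 * \<epsilon>)"
    have \<rho>: "2 * \<epsilon> \<le> \<rho>" "0 < \<rho>" "\<rho> \<le> 2 ^ m * \<epsilon>"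
    proof -
      show "0 < \<rho>" using lam_ge_1 \<epsilon> by (simp add: \<rho>_def)
      show "2 * \<epsilon> \<le> \<rho>" unfolding \<rho>_def using lam_ge_1 \<epsilon> mult_right_mono[of 1 lam "5 * \<epsilon>"] by simp
      show "\<rho> \<le> 2 ^ m * \<epsilon>" unfolding \<rho>_def using m \<epsilon> mult_right_mono[of "lam * 5" "2 ^ m" \<epsilon>] by (simp add: mult.assoc)
    qed
    define E where "E i = (\<integral>\<^sup>+z. epow (g z) p * indicator (ball i \<rho>) z \<partial>M)" for i
    have E_le: "E i \<le> energy M p g" for i
      unfolding E_def by (intro nn_integral_mono) (auto simp: indicator_def)
    then have E_fin: "E i < top" for i using fin order_le_less_trans by (metis infinity_ennreal_def)
    \<comment> \<open>\<open>s i\<close> is the \<open>L^p\<close> average of \<open>g\<close> over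
      \<open>ball i \<rho>\<close>, the smallest value that the hypothesis of
      \<open>poincare\<close> allows.\<close>
    define s where "s i = (enn2real (E i) / vol i \<rho>) powr (1 / p)" for i
    have s_nonneg: "0 \<le> s i" for i by (simp add: s_def)
    have s_p: "s i powr p = enn2real (E i) / vol i \<rho>" for i
      using p_gt_1 by (simp add: s_def powr_powr)
    have Es: "E i = ennreal (s i powr p * vol i \<rho>)" for i
      using vol_pos[OF \<rho>(2), of i] E_fin[of i] by (simp add: s_p)
    define v where "v i = avg M (ball i \<epsilon>) u" for i
    have v01: "0 \<le> v i" "v i \<le> 1" for i
      unfolding v_def using ball_average_bounds[OF \<epsilon> u, of i] u01 by auto
    have v_diff: "\<bar>v i - v j\<bar> \<le> 10 * K * D ^ 4 * \<epsilon> * s j" if "dist i j < 4 * \<epsilon>" for i j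
      unfolding v_def using Es[of j]
      by (intro ball_average_diff_le[OF \<epsilon> that u u_abs ug s_nonneg]) (simp add: E_def \<rho>_def)
    \<comment> \<open>Tents of radius \<open>2 * \<epsilon>\<close> over an
      \<open>\<epsilon>\<close>-net: at every point of \<open>ball x (R + 4 * \<epsilon>)\<close>
      one of them exceeds \<open>\<epsilon>\<close>, which bounds the total weight from
      below.\<close>
    define \<phi> where "\<phi> i y = max 0 (2 * \<epsilon> - dist y i)" for i y :: 'a
    have \<phi>_nonneg: "0 \<le> \<phi> i y" for i y by (simp add: \<phi>_def)
    have \<phi>_zero: "\<phi> i y = 0" if "2 * \<epsilon> \<le> dist y i" for i y using that by (simp add: \<phi>_def)
    define \<Phi> where "\<Phi> y = (\<Sum>i\<in>S. \<phi> i y)" for y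
    have \<Phi>_ge: "\<phi> i y \<le> \<Phi> y" if "i \<in> S" for i y
      unfolding \<Phi>_def using S(1) that \<phi>_nonneg by (intro member_le_sum) auto
    \<comment> \<open>Where all tents vanish this is \<open>0 / 0\<close>, that is 0, which is the
      intended value.\<close>
    define w where "w y = (\<Sum>i\<in>S. \<phi> i y * v i) / \<Phi> y" for y
    have \<Phi>_nonneg: "0 \<le> \<Phi> y" for y unfolding \<Phi>_def by (intro sum_nonneg \<phi>_nonneg)
    have w01: "0 \<le> w y" "w y \<le> 1" for y
    proof -
      show "0 \<le> w y" unfolding w_def using v01 \<phi>_nonneg \<Phi>_nonneg
        by (intro divide_nonneg_nonneg sum_nonneg mult_nonneg_nonneg) auto
      have "(\<Sum>i\<in>S. \<phi> i y * v i) \<le> (\<Sum>i\<in>S. \<phi> i y * 1)"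
        using v01 \<phi>_nonneg by (intro sum_mono mult_left_mono) auto
      then show "w y \<le> 1" unfolding w_def using \<Phi>_nonneg[of y]
        by (cases "\<Phi> y = 0") (auto simp: \<Phi>_def[symmetric])
    qed
    have w_zero: "w y = 0" if "R + 3 * \<epsilon> \<le> dist x y" for y
    proof -
      have "\<phi> i y * v i = 0" for i
      proof (cases "2 * \<epsilon> \<le> dist y i")
        case False
        have "u z = 0" if "z \<in> ball i \<epsilon>" for z
        proof -
          have "dist x y \<le> dist x z + dist z i + dist i y"
            using dist_triangle[of x y z] dist_triangle[of z y i] by linarith
          then have "R \<le> dist x z"
            using that False \<open>R + 3 * \<epsilon> \<le> dist x y\<close> by (simp add: dist_commute)
          then show ?thesis using u0 by auto
        qed
        then have "v i = 0" unfolding v_def by (rule ball_average_const[OF \<epsilon>])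
        then show ?thesis by simp
      qed (simp add: \<phi>_zero)
      then have "(\<Sum>i\<in>S. \<phi> i y * v i) = 0" by (intro sum.neutral) blast
      then show ?thesis by (simp add: w_def)
    qed
    have w_one: "w y = 1" if one: "\<forall>z\<in>ball y (3 * \<epsilon>). u z = 1" for y
    proof -
      have "u y = 1" using one \<epsilon> by simp
      then have "y \<in> ball x (R + 4 * \<epsilon>)" using u0[rule_format, of y] \<epsilon> by fastforce
      then obtain a where a: "a \<in> S" "dist y a < \<epsilon>" using net by blast
      have "0 < \<Phi> y" using \<Phi>_ge[OF a(1), of y] a \<epsilon> by (auto simp: \<phi>_def)
      have "\<phi> i y * v i = \<phi> i y" for i
      proof (cases "2 * \<epsilon> \<le> dist y i")
        case False
        have "ball i \<epsilon> \<subseteq> ball y (3 * \<epsilon>)" using False by (intro ball_subset_iff_dist) (simp add: dist_commute)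
        then have "v i = 1" unfolding v_def using one by (intro ball_average_const[OF \<epsilon>]) auto
        then show ?thesis by simp
      qed (simp add: \<phi>_zero)
      then have "(\<Sum>i\<in>S. \<phi> i y * v i) = \<Phi> y" unfolding \<Phi>_def by (intro sum.cong) auto
      then show ?thesis using \<open>0 < \<Phi> y\<close> by (simp add: w_def)
    qed
    \<comment> \<open>Only points of the net near \<open>a\<close>, the one chosen for
      \<open>y\<close>, enter, and their averages differ from \<open>v a\<close> by at most a fixed
      multiple of \<open>\<epsilon> * s a\<close>; so a single \<open>s a\<close> governs the local
      oscillation.\<close>
    have local: "w y = w z \<or> (\<exists>i\<in>S. dist y i < \<epsilon> \<and> \<bar>w y - w z\<bar> \<le> c * s i * dist y z)"
      if yz: "dist y z < \<epsilon>" for y z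
    proof (cases "y \<in> ball x (R + 4 * \<epsilon>)")
      case False
      then have "R + 4 * \<epsilon> \<le> dist x y" by simp
      moreover have "dist x y \<le> dist x z + dist y z" by (metis dist_commute dist_triangle)
      ultimately have "w y = 0" "w z = 0" using yz \<epsilon> by (auto intro!: w_zero)
      then show ?thesis by simp
    next
      case True
      then obtain a where a: "a \<in> S" "dist y a < \<epsilon>" using net by blast
      have za: "dist z a < 2 * \<epsilon>" using dist_triangle[of z a y] a yz by (simp add: dist_commute)
      define T where "T = {i\<in>S. dist i a < 4 * \<epsilon>}"
      have "real (card T) \<le> D ^ (2 + 3)"
        using S(1) sep by (intro separated_card_le[OF _ \<epsilon>, of _ a]) (auto simp: T_def dist_commute)
      then have cardT: "real (card T) \<le> N" by (simp add: N_def)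
      have zeroT: "\<phi> i q = 0" if "i \<in> S - T" "dist q a < 2 * \<epsilon>" for i q
      proof (rule \<phi>_zero)
        show "2 * \<epsilon> \<le> dist q i"
          using that dist_triangle[of i a q] by (auto simp: T_def dist_commute)
      qed
      have "\<bar>w y - w z\<bar> \<le> N * (N + 1) * (10 * K * D ^ 4 * \<epsilon> * s a) * (dist y z / \<epsilon>)"
        unfolding w_def \<Phi>_def
      proof (rule weighted_average_lipschitz[OF S(1) _ cardT, where c="v a"])
        show "T \<subseteq> S" by (auto simp: T_def)
        show "\<bar>\<phi> i y - \<phi> i z\<bar> \<le> dist y z" for i
          using dist_triangle[of y i z] dist_triangle[of z i y] unfolding \<phi>_def
          by (simp add: dist_commute[of z y])
        show "\<bar>v i - v a\<bar> \<le> 10 * K * D ^ 4 * \<epsilon> * s a" if "i \<in> T" for i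
          using that by (intro v_diff) (simp add: T_def)
        show "\<epsilon> \<le> (\<Sum>i\<in>S. \<phi> i y)"
          using \<Phi>_ge[OF a(1), of y] a unfolding \<Phi>_def by (auto simp: \<phi>_def)
        show "0 < (\<Sum>i\<in>S. \<phi> i z)"
          using \<Phi>_ge[OF a(1), of z] za unfolding \<Phi>_def by (auto simp: \<phi>_def)
        show "0 \<le> 10 * K * D ^ 4 * \<epsilon> * s a" using K_ge_1 D_ge_1 \<epsilon> s_nonneg by simp
      qed (use zeroT a za \<epsilon> \<phi>_nonneg in auto)
      also have "\<dots> = c * s a * dist y z" using \<epsilon> by (simp add: c_def)
      finally show ?thesis using a by blast
    qed
    have cs: "0 \<le> c * s i" for i using c s_nonneg by simp
    \<comment> \<open>A crude bound for all local slopes, available because the net is finite; it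
      gives continuity, while the energy estimate keeps the individual \<open>s i\<close>.\<close>
    define L where "L = (\<Sum>i\<in>S. c * s i)"
    have "continuous_on UNIV w"
    proof (rule continuous_onI)
      fix y :: 'a and e :: real assume e: "0 < e"
      have L: "0 \<le> L" unfolding L_def by (intro sum_nonneg cs)
      show "\<exists>d>0. \<forall>z\<in>UNIV. dist z y < d \<longrightarrow> dist (w z) (w y) \<le> e"
      proof (intro exI[of _ "min \<epsilon> (e / (L + 1))"] conjI ballI impI)
        show "0 < min \<epsilon> (e / (L + 1))" using \<epsilon> e L by simp
        fix z assume z: "dist z y < min \<epsilon> (e / (L + 1))"
        have "\<bar>w y - w z\<bar> \<le> L * dist y z"
        proof (cases "w y = w z")
          case False
          then obtain i where i: "i \<in> S" "\<bar>w y - w z\<bar> \<le> c * s i * dist y z"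
            using local[of y z] z by (auto simp: dist_commute)
          have "c * s i \<le> L" unfolding L_def using S(1) i cs by (intro member_le_sum) auto
          then show ?thesis using i(2) mult_right_mono[of "c * s i" L "dist y z"] by simp
        qed (use L in simp)
        also have "\<dots> \<le> (L + 1) * (e / (L + 1))"
          using z L by (intro mult_mono) (auto simp: dist_commute)
        also have "\<dots> = e" using L by simp
        finally show "dist (w z) (w y) \<le> e" by (simp add: dist_real_def abs_minus_commute)
      qed
    qed
    \<comment> \<open>Adding p-th powers makes \<open>h\<close> dominate every slope
      \<open>c * s i\<close> on its ball, while its energy is the plain sum over the net.\<close>
    define H where "H y = (\<Sum>i\<in>S. (c * s i) powr p * indicator (ball i (2 * \<epsilon>)) y)" for y
    have H_nonneg: "0 \<le> H y" for y unfolding H_def by (intro sum_nonneg) simp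
    define h where "h y = ennreal (H y powr (1 / p))" for y
    have h_ge: "ennreal (c * s i) \<le> h y" if "i \<in> S" "y \<in> ball i (2 * \<epsilon>)" for i y
    proof -
      have "(c * s i) powr p * indicator (ball i (2 * \<epsilon>)) y \<le> H y"
        unfolding H_def using S(1) that by (intro member_le_sum[where f="\<lambda>i. (c * s i) powr p * indicator (ball i (2 * \<epsilon>)) y"]) auto
      then have "(c * s i) powr p \<le> H y" using that by simp
      then have "((c * s i) powr p) powr (1 / p) \<le> H y powr (1 / p)"
        using p_gt_1 by (intro powr_mono2) auto
      then show ?thesis unfolding h_def using p_gt_1 cs[of i] by (intro ennreal_leI) (simp add: powr_powr)
    qed
    have [measurable]: "H \<in> borel_measurable borel"
      unfolding H_def by (intro borel_measurable_sum borel_measurable_times borel_measurable_indicator) auto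
    have h_borel[measurable]: "h \<in> borel_measurable borel" unfolding h_def by measurable
    have "upper_gradient w h"
      unfolding upper_gradient_def
    proof (intro conjI allI impI h_borel)
      fix \<gamma> :: "real \<Rightarrow> 'a" and l assume \<gamma>: "arc_curve \<gamma> l"
      define G where "G t = h (\<gamma> t) * indicator {0..l} t" for t
      have "ennreal \<bar>w (\<gamma> 0) - w (\<gamma> l)\<bar> \<le> (\<integral>\<^sup>+t. G t * indicator {0..l} t \<partial>lborel)"
      proof (rule increment_bound_from_local[OF _ _ \<epsilon>])
        show "G \<in> borel_measurable borel" unfolding G_def by (rule borel_measurable_along_curve[OF h_borel \<gamma>]) auto
        show "0 \<le> l" using \<gamma> by (simp add: arc_curve_def)
        fix a b assume ab: "0 \<le> a" "a \<le> b" "b \<le> l" "b - a < \<epsilon>"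
        have d: "dist (\<gamma> a) (\<gamma> t) \<le> t - a" if "a \<le> t" "t \<le> b" for t
          using arc_curve_dist_le[OF \<gamma>, of a t] that ab by auto
        show "ennreal \<bar>w (\<gamma> a) - w (\<gamma> b)\<bar> \<le> (\<integral>\<^sup>+t. G t * indicator {a..b} t \<partial>lborel)"
        proof (cases "w (\<gamma> a) = w (\<gamma> b)")
          case False
          then obtain i where i: "i \<in> S" "dist (\<gamma> a) i < \<epsilon>"
            "\<bar>w (\<gamma> a) - w (\<gamma> b)\<bar> \<le> c * s i * dist (\<gamma> a) (\<gamma> b)"
            using local[of "\<gamma> a" "\<gamma> b"] d[of b] ab by auto
          have "ennreal \<bar>w (\<gamma> a) - w (\<gamma> b)\<bar> \<le> ennreal (c * s i * (b - a))"
            using i(3) d[of b] ab cs[of i] mult_left_mono[of "dist (\<gamma> a) (\<gamma> b)" "b - a" "c * s i"]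
            by (intro ennreal_leI) simp
          also have "\<dots> = (\<integral>\<^sup>+t. ennreal (c * s i) * indicator {a..b} t \<partial>lborel)"
            using ab cs[of i] by (simp add: nn_integral_cmult ennreal_mult)
          also have "\<dots> \<le> (\<integral>\<^sup>+t. G t * indicator {a..b} t \<partial>lborel)"
          proof (rule nn_integral_mono)
            fix t
            show "ennreal (c * s i) * indicator {a..b} t \<le> G t * indicator {a..b} t"
            proof (cases "t \<in> {a..b}")
              case True
              then have "dist i (\<gamma> t) < 2 * \<epsilon>"
                using i(2) d[of t] ab dist_triangle[of i "\<gamma> t" "\<gamma> a"] by (auto simp: dist_commute)
              then show ?thesis using h_ge[OF i(1), of "\<gamma> t"] True ab by (auto simp: G_def)
            qed simp
          qed
          finally show ?thesis .
        qed simp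
      qed
      also have "\<dots> = line_integral h \<gamma> l"
        unfolding line_integral_def by (intro nn_integral_cong) (auto simp: G_def indicator_def)
      finally show "ennreal \<bar>w (\<gamma> 0) - w (\<gamma> l)\<bar> \<le> line_integral h \<gamma> l" .
    qed
    have "energy M p h \<le> ennreal (c powr p * D ^ (m + 3)) * energy M p g"
    proof -
      have "energy M p h = (\<integral>\<^sup>+y. (\<Sum>i\<in>S. ennreal ((c * s i) powr p) * indicator (ball i (2 * \<epsilon>)) y) \<partial>M)"
      proof (intro nn_integral_cong)
        fix y
        have "epow (h y) p = ennreal (H y)"
          unfolding h_def using H_nonneg p_gt_1 by (simp add: powr_powr)
        also have "\<dots> = (\<Sum>i\<in>S. ennreal ((c * s i) powr p * indicator (ball i (2 * \<epsilon>)) y))"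
          unfolding H_def by (rule sum_ennreal[symmetric]) simp
        also have "\<dots> = (\<Sum>i\<in>S. ennreal ((c * s i) powr p) * indicator (ball i (2 * \<epsilon>)) y)"
          by (intro sum.cong) (auto simp: indicator_def)
        finally show "epow (h y) p = (\<Sum>i\<in>S. ennreal ((c * s i) powr p) * indicator (ball i (2 * \<epsilon>)) y)" .
      qed
      also have "\<dots> = (\<Sum>i\<in>S. ennreal ((c * s i) powr p) * emeasure M (ball i (2 * \<epsilon>)))"
        by (simp add: nn_integral_sum nn_integral_cmult)
      also have "\<dots> \<le> (\<Sum>i\<in>S. ennreal (c powr p) * E i)"
      proof (rule sum_mono)
        fix i
        have "ennreal ((c * s i) powr p) * emeasure M (ball i (2 * \<epsilon>)) = ennreal (c powr p * (s i powr p * vol i (2 * \<epsilon>)))"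
          using c s_nonneg by (simp add: emeasure_ball powr_mult ennreal_mult[symmetric] mult.assoc)
        also have "\<dots> \<le> ennreal (c powr p * (s i powr p * vol i \<rho>))"
          using \<rho>(1) by (intro ennreal_leI mult_left_mono vol_mono_radius) auto
        also have "\<dots> = ennreal (c powr p) * E i" unfolding Es by (simp add: ennreal_mult)
        finally show "ennreal ((c * s i) powr p) * emeasure M (ball i (2 * \<epsilon>)) \<le> ennreal (c powr p) * E i" .
      qed
      also have "\<dots> = ennreal (c powr p) * (\<Sum>i\<in>S. E i)" by (simp add: sum_distrib_left)
      also have "(\<Sum>i\<in>S. E i) = (\<integral>\<^sup>+z. (\<Sum>i\<in>S. epow (g z) p * indicator (ball i \<rho>) z) \<partial>M)"
        unfolding E_def by (rule nn_integral_sum[symmetric]) simp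
      \<comment> \<open>A point lies in at most \<open>D ^ (m + 3)\<close> of the balls of radius
        \<open>\<rho>\<close>, since their centres are separated.\<close>
      also have "\<dots> \<le> (\<integral>\<^sup>+z. ennreal (D ^ (m + 3)) * epow (g z) p \<partial>M)"
      proof (rule nn_integral_mono)
        fix z
        define T where "T = {i\<in>S. z \<in> ball i \<rho>}"
        have "real (card T) \<le> D ^ (m + 3)"
          using S(1) sep \<rho>(3) by (intro separated_card_le[OF _ \<epsilon>, of _ z]) (auto simp: T_def dist_commute)
        moreover have "(\<Sum>i\<in>S. epow (g z) p * indicator (ball i \<rho>) z) = (\<Sum>i\<in>T. epow (g z) p)"
          using S(1) by (intro sum.mono_neutral_cong_right) (auto simp: T_def indicator_def)
        ultimately show "(\<Sum>i\<in>S. epow (g z) p * indicator (ball i \<rho>) z) \<le> ennreal (D ^ (m + 3)) * epow (g z) p"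
          by (auto simp: ennreal_of_nat_eq_real_of_nat intro!: mult_right_mono ennreal_leI)
      qed
      also have "\<dots> = ennreal (D ^ (m + 3)) * energy M p g"
        by (rule nn_integral_cmult) measurable
      finally show ?thesis
        using D_ge_1 by (simp add: mult_left_mono ennreal_mult mult.assoc)
    qed
    then show "\<exists>w h. continuous_on UNIV w \<and> (\<forall>y. 0 \<le> w y \<and> w y \<le> 1) \<and> upper_gradient w h \<and>
      energy M p h \<le> ennreal (c powr p * D ^ (m + 3)) * energy M p g \<and>
      (\<forall>y. R + 3 * \<epsilon> \<le> dist x y \<longrightarrow> w y = 0) \<and> (\<forall>y. (\<forall>z\<in>ball y (3 * \<epsilon>). u z = 1) \<longrightarrow> w y = 1)"
      using \<open>continuous_on UNIV w\<close> \<open>upper_gradient w h\<close> w01 w_zero w_one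
      by (intro exI[of _ w] exI[of _ h]) blast
  qed
qed

end

section \<open>Lower bound for the capacity\<close>

text \<open>Power mean inequality up to a constant. Terms are compared with half the mean,
  \<open>1 / (2 * n)\<close>: subtracting it from every term costs only half of the total, and a
  term above it satisfies \<open>d k powr p \<ge> d k * (2 * n) powr (1 - p)\<close>.\<close>

lemma sum_powr_ge:
  fixes d :: "nat \<Rightarrow> real"
  assumes "1 < p" "0 < n" "\<And>k. k < n \<Longrightarrow> 0 \<le> d k" "(\<Sum>k<n. d k) = 1"
  shows "1 / 2 * (2 * real n) powr (1 - p) \<le> (\<Sum>k<n. d k powr p)"
proof -
  have "(d k - 1 / (2 * real n)) * (2 * real n) powr (1 - p) \<le> d k powr p" if "k < n" for k
  proof (cases "d k \<le> 1 / (2 * real n)")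
    case True
    then have "(d k - 1 / (2 * real n)) * (2 * real n) powr (1 - p) \<le> 0"
      by (intro mult_nonpos_nonneg) auto
    then show ?thesis by (meson order_trans powr_ge_zero)
  next
    case False
    then have d: "1 / (2 * real n) < d k" by simp
    have "0 < d k" using d by (rule order_le_less_trans[rotated]) simp
    have "(2 * real n) powr (1 - p) = (1 / (2 * real n)) powr (p - 1)"
      using assms(2) by (simp add: powr_divide powr_diff)
    also have "\<dots> \<le> d k powr (p - 1)" using d assms(1) by (intro powr_mono2) auto
    finally have "(d k - 1 / (2 * real n)) * (2 * real n) powr (1 - p) \<le> d k * d k powr (p - 1)"
      using d \<open>0 < d k\<close> by (intro mult_mono) auto
    also have "\<dots> = d k powr p" using \<open>0 < d k\<close> by (simp add: powr_mult_base)
    finally show ?thesis .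
  qed
  then have "(\<Sum>k<n. (d k - 1 / (2 * real n)) * (2 * real n) powr (1 - p)) \<le> (\<Sum>k<n. d k powr p)"
    by (intro sum_mono) auto
  moreover have "(\<Sum>k<n. (d k - 1 / (2 * real n)) * (2 * real n) powr (1 - p)) = 1 / 2 * (2 * real n) powr (1 - p)"
    using assms(2,4) by (simp add: sum_distrib_right[symmetric] sum_subtractf)
  ultimately show ?thesis by simp
qed

context poincare_space
begin

text \<open>A level \<open>t\<close> is passed at scale \<open>k\<close> once \<open>{w \<le> t}\<close> fills a fixed proportion of one of the first
  \<open>k\<close> balls. Truncating \<open>w\<close> at the levels passed between consecutive scales gives functions whose
  gradients live on disjoint sets, so that the energies add up; this is what yields the exponent
  \<open>1 - p\<close> rather than \<open>-p\<close>.\<close>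
lemma energy_ge_of_dyadic_growth:
  assumes w: "continuous_on UNIV w" "\<And>y. 0 \<le> w y" "\<And>y. w y \<le> 1" and ug: "upper_gradient w h"
    and one: "\<And>y. y \<in> ball x \<rho> \<Longrightarrow> w y = 1" and \<rho>: "0 < \<rho>" and \<theta>: "0 < \<theta>" "\<theta> \<le> 1 / 2" and n: "0 < n"
    and zero: "\<theta> * vol x (2 ^ n * \<rho>) \<le> measure M (ball x (2 ^ n * \<rho>) \<inter> {y. w y \<le> 0})"
    and A: "0 < A" "\<And>k. k \<le> n \<Longrightarrow> A * (2 ^ k * \<rho>) powr p \<le> vol x (2 ^ k * \<rho>)"
  shows "ennreal (A * real n powr (1 - p)) \<le> ennreal ((2 * (2 * K * D / \<theta>)) powr p) * energy M p h"
proof (cases "energy M p h = top")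
  case True
  then show ?thesis using \<theta> D_ge_1 K_ge_1 by (simp add: ennreal_mult_top)
next
  case False
  then obtain E where E: "energy M p h = ennreal E" "0 \<le> E"
    by (cases "energy M p h") auto
  have w_borel: "w \<in> borel_measurable borel" and h_borel: "h \<in> borel_measurable borel"
    using w ug by (auto simp: borel_measurable_continuous_onI upper_gradient_def)
  note [measurable] = w_borel h_borel mms_borel_measurable[OF mms w_borel] mms_borel_measurable[OF mms h_borel]
  have lev[measurable]: "{y. w y \<le> t} \<in> sets M" "{y. t < w y} \<in> sets M" for t
    by (auto intro!: sets_M_borel)
  define B where "B k = ball x (2 ^ k * \<rho>)" for k :: nat
  have B_sets[measurable, simp]: "B k \<in> sets M" for k by (simp add: B_def)
  have B_pos: "0 < measure M (B k)" for k unfolding B_def using \<rho> by (intro vol_pos) simp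
  have Bm: "B k \<inter> X \<in> fmeasurable M" if "X \<in> sets M" for k X
    using that by (auto simp: B_def intro!: fmeasurableI2[OF fmeasurable_ball[of x "2 ^ k * \<rho>"]])
  \<comment> \<open>Admitting all balls up to scale \<open>k\<close> makes \<open>L k\<close> grow
    with \<open>k\<close>, so that the levels \<open>\<tau> k\<close> decrease, from 1 at the first
    scale to 0 at the last.\<close>
  define L where "L k = {t. 0 \<le> t \<and> (\<exists>j\<le>k. \<theta> * measure M (B j) \<le> measure M (B j \<inter> {y. w y \<le> t}))}" for k
  define \<tau> where "\<tau> k = Inf (L k)" for k
  have L_one: "1 \<in> L k" for k
  proof -
    have "B 0 \<inter> {y. w y \<le> 1} = B 0" using w by auto
    moreover have "\<theta> * measure M (B 0) \<le> 1 * measure M (B 0)" using \<theta> B_pos[of 0] by (intro mult_right_mono) auto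
    ultimately show ?thesis by (auto simp: L_def intro!: exI[of _ 0])
  qed
  have L_bdd: "bdd_below (L k)" for k by (rule bdd_belowI[of _ 0]) (simp add: L_def)
  have L_up: "t' \<in> L k" if "t \<in> L k" "t \<le> t'" for t t' k
  proof -
    from that obtain j where j: "j \<le> k" "\<theta> * measure M (B j) \<le> measure M (B j \<inter> {y. w y \<le> t})" "0 \<le> t"
      by (auto simp: L_def)
    moreover have "measure M (B j \<inter> {y. w y \<le> t}) \<le> measure M (B j \<inter> {y. w y \<le> t'})"
      using that by (intro measure_mono_fmeasurable Bm) auto
    ultimately show ?thesis using that by (auto simp: L_def intro!: exI[of _ j])
  qed
  have L_above: "a \<in> L k" if "\<tau> k < a" for a k
    using cInf_lessD[of "L k" a] that L_one L_up unfolding \<tau>_def by (metis empty_iff less_imp_le)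
  have L_below: "b \<notin> L k" if "b < \<tau> k" for b k
    using cInf_lower[of b "L k"] L_bdd that unfolding \<tau>_def by fastforce
  have \<tau>_nonneg: "0 \<le> \<tau> k" for k
    unfolding \<tau>_def
  proof (rule cInf_greatest)
    show "L k \<noteq> {}" using L_one[of k] by blast
  qed (simp add: L_def)
  have \<tau>_Suc: "\<tau> (Suc k) \<le> \<tau> k" for k
  proof -
    have "L k \<subseteq> L (Suc k)" unfolding L_def using le_SucI by blast
    then show ?thesis unfolding \<tau>_def using L_one[of k] L_bdd[of "Suc k"] by (intro cInf_superset_mono) auto
  qed
  have \<tau>_dec: "\<tau> j \<le> \<tau> k" if "k \<le> j" for k j
    using \<tau>_Suc that by (rule lift_Suc_antimono_le)
  have \<tau>_0: "\<tau> 0 = 1"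
  proof (rule antisym)
    show "\<tau> 0 \<le> 1" unfolding \<tau>_def by (rule cInf_lower[OF L_one L_bdd])
    show "1 \<le> \<tau> 0"
      unfolding \<tau>_def
    proof (rule cInf_greatest)
      fix t assume t: "t \<in> L 0"
      show "1 \<le> t"
      proof (rule ccontr)
        assume "\<not> 1 \<le> t"
        then have "B 0 \<inter> {y. w y \<le> t} = {}" using one by (auto simp: B_def)
        then show False using t B_pos[of 0] \<theta> by (auto simp: L_def mult_le_0_iff)
      qed
    qed (use L_one in auto)
  qed
  have \<tau>_n: "\<tau> n = 0"
  proof -
    have "0 \<in> L n" using zero by (auto simp: L_def B_def)
    then have "\<tau> n \<le> 0" unfolding \<tau>_def by (rule cInf_lower[OF _ L_bdd])
    then show ?thesis using \<tau>_nonneg[of n] by simp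
  qed
  define C where "C = 2 * K * D / \<theta>"
  have C: "0 < C" using K_ge_1 D_ge_1 \<theta> by (simp add: C_def)
  define V where "V k = {y. \<tau> (Suc k) < w y \<and> w y < \<tau> k}" for k
  have [measurable]: "V k \<in> sets M" for k unfolding V_def by (rule sets_M_borel) measurable
  define e where "e k = (\<integral>\<^sup>+y. epow (h y) p * indicator (V k) y \<partial>M)" for k
  have e_le: "e k \<le> ennreal E" for k
    unfolding e_def E(1)[symmetric] by (intro nn_integral_mono) (auto simp: indicator_def)
  have e_fin: "e k < top" for k using e_le[of k] by (simp add: order_le_less_trans)
  define d where "d k = \<tau> k - \<tau> (Suc k)" for k
  have step: "A * d k powr p \<le> C powr p * enn2real (e k)" if k: "k < n" for k
  proof -
    define r where "r = 2 ^ Suc k * \<rho>"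
    have r: "0 < r" "r \<le> lam * r" using \<rho> lam_ge_1 by (auto simp: r_def)
    define s where "s = (enn2real (e k) / vol x (lam * r)) powr (1 / p)"
    have vl: "0 < vol x (lam * r)" using r by (intro vol_pos) auto
    have s_p: "s powr p = enn2real (e k) / vol x (lam * r)"
      using p_gt_1 by (simp add: s_def powr_powr)
    have es: "e k = ennreal (s powr p * vol x (lam * r))"
      using vl e_fin[of k] by (simp add: s_p)
    have s_nonneg: "0 \<le> s" by (simp add: s_def)
    have ab: "b - a \<le> C * r * s" if a: "\<tau> (Suc k) < a" "a < b" "b < \<tau> k" for a b
    proof -
      \<comment> \<open>\<open>a\<close> is passed at scale \<open>Suc k\<close> but not before, so
        \<open>{w \<le> a}\<close> is large in \<open>B (Suc k)\<close> itself; \<open>b\<close> is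
        not yet passed at scale \<open>k\<close>, so \<open>{b < w}\<close> fills at least the
        fraction \<open>1 - \<theta> \<ge> \<theta>\<close> of \<open>B k\<close>.\<close>
      have "a \<in> L (Suc k)" "a \<notin> L k" "b \<notin> L k" 
        using L_above[OF a(1)] L_below[of a k] L_below[OF a(3)] a by auto
      then have F2: "\<theta> * measure M (B (Suc k)) \<le> measure M (B (Suc k) \<inter> {y. w y \<le> a})"
        by (auto simp: L_def le_Suc_eq)
      have "0 \<le> b" using a \<tau>_nonneg[of "Suc k"] by simp
      then have "measure M (B k \<inter> {y. w y \<le> b}) \<le> \<theta> * measure M (B k)"
        using \<open>b \<notin> L k\<close> by (force simp: L_def)
      moreover have "measure M (B k) = measure M (B k \<inter> {y. w y \<le> b}) + measure M (B k \<inter> {y. b < w y})"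
      proof -
        have "measure M ((B k \<inter> {y. w y \<le> b}) \<union> (B k \<inter> {y. b < w y})) =
            measure M (B k \<inter> {y. w y \<le> b}) + measure M (B k \<inter> {y. b < w y})"
          using fmeasurableD2[OF Bm[OF lev(1)]] fmeasurableD2[OF Bm[OF lev(2)]]
          by (intro measure_Union) auto
        moreover have "(B k \<inter> {y. w y \<le> b}) \<union> (B k \<inter> {y. b < w y}) = B k" by auto
        ultimately show ?thesis by simp
      qed
      moreover have "\<theta> * measure M (B k) \<le> (1 - \<theta>) * measure M (B k)"
        using \<theta> B_pos[of k] by (intro mult_right_mono) auto
      ultimately have F1: "\<theta> * measure M (B k) \<le> measure M (B k \<inter> {y. b < w y})"
        by (simp add: algebra_simps)
      have dbl: "measure M (B (Suc k)) \<le> D * measure M (B k)"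
        using doubling[of "2 ^ k * \<rho>" x] \<rho> by (simp add: B_def mult.assoc)
      \<comment> \<open>A common lower bound for the measures of both level sets, in terms of the
        larger ball, to which the Poincare inequality is applied.\<close>
      define \<theta>' where "\<theta>' = \<theta> * measure M (B (Suc k)) / D"
      have th1: "\<theta>' \<le> \<theta> * measure M (B k)"
        using dbl \<theta> D_ge_1 by (simp add: \<theta>'_def divide_le_eq) (metis mult.assoc mult.commute mult_left_mono less_imp_le)
      have th2: "\<theta>' \<le> \<theta> * measure M (B (Suc k))"
        using frac_le[of "\<theta> * measure M (B (Suc k))" "\<theta> * measure M (B (Suc k))" 1 D] D_ge_1 \<theta> by (simp add: \<theta>'_def)
      have "(b - a) / 2 * \<theta>' \<le> K * r * s * vol x r"
      proof (rule poincare_level_sets[OF r(1), where f="\<lambda>y. max a (min b (w y))" and U="B k \<inter> {y. b < w y}"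
            and V="B (Suc k) \<inter> {y. w y \<le> a}"])
        show "set_integrable M (ball x r) (\<lambda>y. max a (min b (w y)))"
          by (rule bounded_set_integrable[where c="\<bar>a\<bar> + \<bar>b\<bar>"]) auto
        show "upper_gradient (\<lambda>y. max a (min b (w y))) (\<lambda>y. h y * indicator {y. a < w y \<and> w y < b} y)"
          by (rule upper_gradient_truncate[OF ug w(1)])
        have "(\<integral>\<^sup>+z. epow (h z * indicator {y. a < w y \<and> w y < b} z) p * indicator (ball x (lam * r)) z \<partial>M) \<le> e k"
          unfolding e_def V_def epow_indicator using a by (intro nn_integral_mono) (auto simp: indicator_def)
        then show "(\<integral>\<^sup>+z. epow (h z * indicator {y. a < w y \<and> w y < b} z) p * indicator (ball x (lam * r)) z \<partial>M)
          \<le> ennreal (s powr p * vol x (lam * r))" by (simp add: es)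
        have "2 ^ k * \<rho> \<le> r" using \<rho> by (simp add: r_def)
        then show "B k \<inter> {y. b < w y} \<subseteq> ball x r" by (auto simp: B_def)
        show "B (Suc k) \<inter> {y. w y \<le> a} \<subseteq> ball x r" by (auto simp: B_def r_def)
      qed (use a s_nonneg F1 F2 th1 th2 in auto)
      then have "(b - a) * (\<theta> / (2 * D)) * vol x r \<le> K * r * s * vol x r"
        by (simp add: \<theta>'_def B_def r_def field_simps)
      moreover have "0 < vol x r" using r by (intro vol_pos)
      ultimately have "(b - a) * (\<theta> / (2 * D)) \<le> K * r * s"
        by (simp only: mult_le_cancel_right_pos)
      then show ?thesis
        using \<theta> D_ge_1 by (simp add: C_def field_simps)
    qed
    have "d k \<le> C * r * s"
    proof (rule ccontr)
      assume "\<not> d k \<le> C * r * s"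
      then have *: "C * r * s < d k" by simp
      have nn: "0 \<le> C * r * s" using C r s_nonneg by simp
      \<comment> \<open>The infima need not be attained, and \<open>ab\<close> asks for strict
        inequalities. Moving both levels inward by a quarter of the excess leaves a gap halfway
        between \<open>C * r * s\<close> and \<open>d k\<close>, still too large.\<close>
      define \<eta> where "\<eta> = (d k - C * r * s) / 4"
      have "(\<tau> k - \<eta>) - (\<tau> (Suc k) + \<eta>) \<le> C * r * s"
        using * nn by (intro ab) (auto simp: \<eta>_def d_def field_simps)
      then show False using * by (simp add: \<eta>_def d_def field_simps)
    qed
    then have "d k powr p \<le> (C * r * s) powr p"
      using \<tau>_Suc[of k] p_gt_1 by (intro powr_mono2) (auto simp: d_def)
    also have "\<dots> = C powr p * (r powr p * s powr p)"
      using C r s_nonneg by (simp add: powr_mult mult.assoc)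
    finally have "A * d k powr p \<le> C powr p * (A * r powr p) * s powr p"
      using A(1) by (simp add: algebra_simps)
    \<comment> \<open>The growth hypothesis at scale \<open>Suc k \<le> n\<close> trades
      \<open>A * r powr p\<close> for the volume in the denominator of
      \<open>s powr p\<close>.\<close>
    also have "\<dots> \<le> C powr p * vol x (lam * r) * s powr p"
    proof (intro mult_right_mono mult_left_mono)
      have "A * r powr p \<le> vol x r" unfolding r_def using k by (intro A(2)) simp
      also have "\<dots> \<le> vol x (lam * r)" using r by (intro vol_mono_radius)
      finally show "A * r powr p \<le> vol x (lam * r)" .
    qed auto
    also have "\<dots> = C powr p * enn2real (e k)" using vl by (simp add: s_p)
    finally show ?thesis .
  qed
  have sum_e: "(\<Sum>k<n. enn2real (e k)) \<le> E"
  proof -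
    have "ennreal (\<Sum>k<n. enn2real (e k)) = (\<Sum>k<n. e k)"
      using e_fin by (simp add: sum_ennreal[symmetric])
    also have "\<dots> = (\<integral>\<^sup>+y. (\<Sum>k<n. epow (h y) p * indicator (V k) y) \<partial>M)"
      unfolding e_def by (rule nn_integral_sum[symmetric]) measurable
    also have "\<dots> \<le> energy M p h"
    proof (rule nn_integral_mono)
      fix y
      show "(\<Sum>k<n. epow (h y) p * indicator (V k) y) \<le> epow (h y) p"
      proof (cases "\<exists>k<n. y \<in> V k")
        case True
        then obtain k where k: "k < n" "y \<in> V k" by blast
        have "y \<notin> V j" if "j \<noteq> k" for j
          using that k(2) \<tau>_dec[of "Suc j" k] \<tau>_dec[of "Suc k" j] unfolding V_def
          by (cases "j < k") auto
        then have "(\<Sum>k<n. epow (h y) p * indicator (V k) y) = (\<Sum>k\<in>{k}. epow (h y) p * indicator (V k) y)"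
          using k by (intro sum.mono_neutral_right) (auto simp: indicator_def)
        then show ?thesis using k by simp
      qed (auto simp: indicator_def)
    qed
    finally show ?thesis using E by simp
  qed
  have "1 / 2 * (2 * real n) powr (1 - p) \<le> (\<Sum>k<n. d k powr p)"
  proof (rule sum_powr_ge[OF p_gt_1 n])
    show "0 \<le> d k" for k using \<tau>_Suc[of k] by (simp add: d_def)
    have "(\<Sum>k<n. d k) = - (\<Sum>k<n. \<tau> (Suc k) - \<tau> k)"
      by (simp add: d_def sum_negf[symmetric])
    also have "\<dots> = 1" unfolding sum_lessThan_telescope using \<tau>_0 \<tau>_n by simp
    finally show "(\<Sum>k<n. d k) = 1" .
  qed
  then have "A * (1 / 2 * (2 * real n) powr (1 - p)) \<le> (\<Sum>k<n. A * d k powr p)"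
    using A(1) by (simp add: sum_distrib_left[symmetric])
  also have "\<dots> \<le> (\<Sum>k<n. C powr p * enn2real (e k))" using step by (intro sum_mono) auto
  also have "\<dots> \<le> C powr p * E" using sum_e by (simp add: sum_distrib_left[symmetric] mult_left_mono)
  finally have "A * (1 / 2 * (2 * real n) powr (1 - p)) \<le> C powr p * E" .
  moreover have "1 / 2 * (2 * real n) powr (1 - p) = 2 powr (-p) * real n powr (1 - p)"
    by (simp add: powr_mult powr_diff powr_minus field_simps)
  ultimately have "2 powr (-p) * (A * real n powr (1 - p)) \<le> C powr p * E"
    by (simp add: algebra_simps)
  then have "A * real n powr (1 - p) \<le> 2 powr p * (C powr p * E)"
    by (simp add: powr_minus field_simps)
  also have "\<dots> = (2 * C) powr p * E" using C by (simp add: powr_mult)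
  finally have "ennreal (A * real n powr (1 - p)) \<le> ennreal ((2 * C) powr p * E)" by (rule ennreal_leI)
  then show ?thesis using E by (simp add: C_def ennreal_mult)
qed

text \<open>No curve could cross an empty annulus, so the indicator of \<open>ball x (2 * R)\<close>
  would have upper gradient 0. The Poincare inequality with \<open>s = 0\<close>, on a ball
  containing both \<open>ball x (2 * R)\<close> and \<open>ball z R\<close>, would then contradict
  the positive measure of these two balls.\<close>

lemma annulus_nonempty:
  fixes x z :: 'a
  assumes "0 < R" "2 * R \<le> dist x z"
  shows "\<exists>y. 2 * R \<le> dist x y \<and> dist x y < 3 * R"
proof (rule ccontr)
  assume *: "\<not> ?thesis"
  then have gap: "3 * R \<le> dist x y" if "2 * R \<le> dist x y" for y using that by (meson not_le)
  define f where "f y = (indicator (ball x (2 * R)) y :: real)" for y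
  have ug: "upper_gradient f (\<lambda>_. 0)"
    unfolding upper_gradient_def
  proof (intro conjI allI impI)
    fix \<gamma> :: "real \<Rightarrow> 'a" and l assume \<gamma>: "arc_curve \<gamma> l"
    have l: "0 \<le> l" using \<gamma> by (simp add: arc_curve_def)
    have cont: "continuous_on {0..l} (\<lambda>t. dist x (\<gamma> t))"
      by (intro continuous_intros arc_curve_continuous[OF \<gamma>])
    have "f (\<gamma> 0) = f (\<gamma> l)"
    proof (rule ccontr)
      assume "f (\<gamma> 0) \<noteq> f (\<gamma> l)"
      then consider "dist x (\<gamma> 0) < 2 * R" "3 * R \<le> dist x (\<gamma> l)" | "dist x (\<gamma> l) < 2 * R" "3 * R \<le> dist x (\<gamma> 0)"
        using gap[of "\<gamma> 0"] gap[of "\<gamma> l"]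
        by (cases "dist x (\<gamma> 0) < 2 * R"; cases "dist x (\<gamma> l) < 2 * R") (auto simp: f_def)
      then obtain t where "dist x (\<gamma> t) = 5 / 2 * R"
      proof cases
        case 1
        then show ?thesis using IVT'[OF _ _ l cont, of "5 / 2 * R"] that assms by auto
      next
        case 2
        then show ?thesis using IVT2'[OF _ _ l cont, of "5 / 2 * R"] that assms by auto
      qed
      then show False using gap[of "\<gamma> t"] assms by auto
    qed
    then show "ennreal \<bar>f (\<gamma> 0) - f (\<gamma> l)\<bar> \<le> line_integral (\<lambda>_. 0) \<gamma> l" by simp
  qed simp
  define \<theta> where "\<theta> = min (vol x (2 * R)) (vol z R)"
  have fm: "f \<in> borel_measurable M" unfolding f_def by measurable
  have "(1 - 0) / 2 * \<theta> \<le> K * (dist x z + R) * 0 * vol x (dist x z + R)"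
  proof (rule poincare_level_sets[OF _ fm _ ug, where U="ball x (2 * R)" and V="ball z R"])
    show "set_integrable M (ball x (dist x z + R)) f"
      using fm by (rule bounded_set_integrable[where c=1]) (auto simp: f_def indicator_def)
    show "ball x (2 * R) \<subseteq> ball x (dist x z + R)" "ball z R \<subseteq> ball x (dist x z + R)"
      using assms by (auto intro!: ball_subset_iff_dist simp: dist_commute)
    show "f y \<le> 0" if "y \<in> ball z R" for y
      using that gap[OF assms(2)] dist_triangle[of x z y] by (auto simp: f_def dist_commute)
  qed (use assms in \<open>auto simp: f_def \<theta>_def intro: add_nonneg_pos\<close>)
  moreover have "0 < \<theta>" unfolding \<theta>_def using assms by (auto intro!: vol_pos)
  ultimately show False by simp
qed

text \<open>Smoothing at scale \<open>r / 6\<close> leaves \<open>w = 1\<close> on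
  \<open>ball x (r / 2)\<close> and \<open>w = 0\<close> from distance \<open>R + r / 2\<close> on,
  so the dyadic scales start at \<open>r / 2\<close>. The bounds on \<open>2 ^ n * r\<close> put the
  last radius between \<open>4 * R\<close> and \<open>8 * R\<close>: large enough to contain
  \<open>ball y0 (R / 2)\<close>, centred in the annulus, on which \<open>w\<close> vanishes, and
  small enough to be comparable to it.\<close>

lemma ex_cap_lower_bound:
  "\<exists>C>0. \<forall>x r R A n. 0 < r \<and> 2 * r \<le> R \<and> (\<exists>z. 2 * R \<le> dist x z) \<and> 0 < n \<and>
      8 * R \<le> 2 ^ n * r \<and> 2 ^ n * r \<le> 16 * R \<and> 0 < A \<and>
      (\<forall>k\<le>n. A * (2 ^ k * (r / 2)) powr p \<le> vol x (2 ^ k * (r / 2))) \<longrightarrow>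
    ennreal (A * real n powr (1 - p)) \<le> ennreal C * cap_p M p (ball x r) (ball x R)"
proof -
  obtain C1 where C1: "0 \<le> C1" and smooth: "\<And>x \<epsilon> R u g. 0 < \<epsilon> \<and> u \<in> borel_measurable M \<and> (\<forall>y. 0 \<le> u y \<and> u y \<le> 1) \<and>
      (\<forall>y. y \<notin> ball x R \<longrightarrow> u y = 0) \<and> upper_gradient u g \<and> energy M p g < \<infinity> \<Longrightarrow>
    (\<exists>w h. continuous_on UNIV w \<and> (\<forall>y. 0 \<le> w y \<and> w y \<le> 1) \<and> upper_gradient w h \<and>
      energy M p h \<le> ennreal C1 * energy M p g \<and>
      (\<forall>y. R + 3 * \<epsilon> \<le> dist x y \<longrightarrow> w y = 0) \<and> (\<forall>y. (\<forall>z\<in>ball y (3 * \<epsilon>). u z = 1) \<longrightarrow> w y = 1))"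
    using ex_continuous_smoothing by blast
  \<comment> \<open>The last ball has at most \<open>D ^ 5\<close> times the volume of
    \<open>ball y0 (R / 2)\<close>, as \<open>3 * R + 8 * R \<le> 2 ^ 5 * (R / 2)\<close>; the
    factor 2 ensures \<open>\<theta> \<le> 1 / 2\<close>.\<close>
  define \<theta> where "\<theta> = 1 / (2 * D ^ 5)"
  have D5: "1 \<le> D ^ 5" using D_ge_1 by simp
  have \<theta>: "0 < \<theta>" "\<theta> \<le> 1 / 2" using D5 D_ge_1 by (auto simp: \<theta>_def divide_simps)
  define C2 where "C2 = (2 * (2 * K * D / \<theta>)) powr p"
  have C2: "0 < C2" using K_ge_1 D_ge_1 \<theta> by (simp add: C2_def)
  \<comment> \<open>\<open>C1\<close> may be 0, and \<open>C3\<close> has to be positive to be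
    divided by.\<close>
  define C3 where "C3 = C2 * (C1 + 1)"
  have C3: "0 < C3" using C1 C2 by (simp add: C3_def)
  show ?thesis
  proof (intro exI[of _ "C3 * 2 powr p"] conjI allI impI; (elim conjE exE)?)
    show "0 < C3 * 2 powr p" using C3 by simp
  next
    fix x :: 'a and r R A :: real and n :: nat and z
    assume r: "0 < r" "2 * r \<le> R" and z: "2 * R \<le> dist x z" and n: "0 < n" "8 * R \<le> 2 ^ n * r" "2 ^ n * r \<le> 16 * R"
      and A: "0 < A" "\<forall>k\<le>n. A * (2 ^ k * (r / 2)) powr p \<le> vol x (2 ^ k * (r / 2))"
    define X where "X = A * real n powr (1 - p)"
    have X: "0 \<le> X" using A by (simp add: X_def)
    have "0 < R" using r by simp
    then obtain y0 where y0: "2 * R \<le> dist x y0" "dist x y0 < 3 * R" using annulus_nonempty[OF _ z] by blast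
    have "ennreal (X / C3) \<le> ennreal (2 powr p) * cap_p M p (ball x r) (ball x R)"
    proof (rule cap_p_ge_upper_gradient[OF mms])
      show "0 < p" using p_gt_1 by simp
      show "open (ball x R)" by simp
      fix u :: "'a \<Rightarrow> real" and g
      assume u: "u \<in> borel_measurable M" "\<And>y. 0 \<le> u y" "\<And>y. u y \<le> 1" "\<And>y. y \<notin> ball x R \<Longrightarrow> u y = 0"
        "\<And>y. y \<in> ball x r \<Longrightarrow> u y = 1" and ug: "upper_gradient u g"
      show "ennreal (X / C3) \<le> energy M p g"
      proof (cases "energy M p g = top")
        case False
        then obtain I where I: "energy M p g = ennreal I" "0 \<le> I"
          by (cases "energy M p g") auto
        obtain w h where w: "continuous_on UNIV w" "\<forall>y. 0 \<le> w y \<and> w y \<le> 1" "upper_gradient w h"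
          "energy M p h \<le> ennreal C1 * energy M p g"
          "\<forall>y. R + 3 * (r / 6) \<le> dist x y \<longrightarrow> w y = 0" "\<forall>y. (\<forall>z\<in>ball y (3 * (r / 6)). u z = 1) \<longrightarrow> w y = 1"
          using smooth[of "r / 6" u x R g] u ug r I by auto
        have "ennreal X \<le> ennreal C2 * energy M p h"
          unfolding X_def C2_def
        proof (rule energy_ge_of_dyadic_growth[OF w(1) _ _ w(3) _ _ \<theta> n(1) _ A(1)])
          show "w y = 1" if "y \<in> ball x (r / 2)" for y
          proof -
            have "ball y (3 * (r / 6)) \<subseteq> ball x r"
              using that by (intro ball_subset_iff_dist) (auto simp: dist_commute)
            then show ?thesis using w(6) u(5) by blast
          qed
          have half: "2 ^ n * (r / 2) = 2 ^ n * r / 2" by simp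
          have sub: "ball y0 (R / 2) \<subseteq> ball x (2 ^ n * (r / 2)) \<inter> {y. w y \<le> 0}"
          proof
            fix y assume y: "y \<in> ball y0 (R / 2)"
            have "dist x y0 \<le> dist x y + dist y0 y" "dist x y \<le> dist x y0 + dist y0 y"
              using dist_triangle[of x y0 y] dist_triangle[of x y y0] by (auto simp: dist_commute)
            then have "R + 3 * (r / 6) \<le> dist x y" "dist x y < 2 ^ n * (r / 2)"
              using y y0 r n(2) unfolding half by (auto simp: dist_commute)
            then show "y \<in> ball x (2 ^ n * (r / 2)) \<inter> {y. w y \<le> 0}" using w(5) by auto
          qed
          have "vol x (2 ^ n * (r / 2)) \<le> D ^ 5 * vol y0 (R / 2)"
            using y0 r n(3) unfolding half by (intro vol_compare) auto
          then have "\<theta> * vol x (2 ^ n * (r / 2)) \<le> \<theta> * (D ^ 5 * vol y0 (R / 2))"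
            using \<theta> by (intro mult_left_mono) auto
          also have "\<dots> = vol y0 (R / 2) / 2" using D_ge_1 by (simp add: \<theta>_def)
          also have "\<dots> \<le> vol y0 (R / 2)" by simp
          also have "\<dots> \<le> measure M (ball x (2 ^ n * (r / 2)) \<inter> {y. w y \<le> 0})"
          proof (rule measure_mono_fmeasurable[OF sub])
            have "w \<in> borel_measurable borel" using w(1) by (rule borel_measurable_continuous_onI)
            then have "{y. w y \<le> 0} \<in> sets M" by (intro sets_M_borel) measurable
            then show "ball x (2 ^ n * (r / 2)) \<inter> {y. w y \<le> 0} \<in> fmeasurable M"
              by (intro fmeasurableI2[OF fmeasurable_ball[of x "2 ^ n * (r / 2)"]]) auto
          qed simp
          finally show "\<theta> * vol x (2 ^ n * (r / 2)) \<le> measure M (ball x (2 ^ n * (r / 2)) \<inter> {y. w y \<le> 0})" .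
        qed (use w r A in auto)
        also have "\<dots> \<le> ennreal C2 * (ennreal C1 * ennreal I)"
          using w(4) I by (intro mult_left_mono) auto
        also have "\<dots> = ennreal (C2 * (C1 * I))" using C1 C2 I by (simp add: ennreal_mult)
        finally have "X \<le> C2 * (C1 * I)" using C1 C2 I by (simp add: ennreal_le_iff)
        also have "\<dots> \<le> C3 * I" using C2 I by (simp add: C3_def algebra_simps)
        finally have "X / C3 \<le> I" using C3 by (simp add: divide_le_eq mult.commute)
        then show ?thesis unfolding I by (rule ennreal_leI)
      qed simp
    qed
    then have "ennreal C3 * ennreal (X / C3) \<le> ennreal C3 * (ennreal (2 powr p) * cap_p M p (ball x r) (ball x R))"
      by (rule mult_left_mono) simp
    moreover have "ennreal C3 * ennreal (X / C3) = ennreal X" using C3 X by (simp flip: ennreal_mult)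
    moreover have "ennreal C3 * (ennreal (2 powr p) * cap_p M p (ball x r) (ball x R)) =
        ennreal (C3 * 2 powr p) * cap_p M p (ball x r) (ball x R)"
      using C3 by (simp add: ennreal_mult mult.assoc)
    ultimately show "ennreal (A * real n powr (1 - p)) \<le> ennreal (C3 * 2 powr p) * cap_p M p (ball x r) (ball x R)"
      by (simp add: X_def)
  qed
qed

end

section \<open>Upper bound for the capacity\<close>

lemma upper_gradient_lipschitz:
  fixes f :: "'a::metric_space \<Rightarrow> real"
  assumes "0 \<le> L" "\<And>y z. \<bar>f y - f z\<bar> \<le> L * dist y z"
  shows "upper_gradient f (\<lambda>_. ennreal L)"
  unfolding upper_gradient_def
proof (intro conjI allI impI)
  fix \<gamma> :: "real \<Rightarrow> 'a" and l assume \<gamma>: "arc_curve \<gamma> l"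
  have l: "0 \<le> l" using \<gamma> by (simp add: arc_curve_def)
  have "\<bar>f (\<gamma> 0) - f (\<gamma> l)\<bar> \<le> L * l"
    using assms(2)[of "\<gamma> 0" "\<gamma> l"] arc_curve_dist_le[OF \<gamma>, of 0 l] l assms(1)
    by (simp add: mult_left_mono order_trans)
  then show "ennreal \<bar>f (\<gamma> 0) - f (\<gamma> l)\<bar> \<le> line_integral (\<lambda>_. ennreal L) \<gamma> l"
    unfolding line_integral_def using l assms(1) by (simp add: nn_integral_cmult ennreal_leI flip: ennreal_mult)
qed simp

lemma upper_gradient_add:
  fixes f f' :: "'a::metric_space \<Rightarrow> real"
  assumes "upper_gradient f g" "upper_gradient f' g'"
  shows "upper_gradient (\<lambda>y. f y + f' y) (\<lambda>y. g y + g' y)"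
  unfolding upper_gradient_def
proof (intro conjI allI impI)
  have g: "g \<in> borel_measurable borel" "g' \<in> borel_measurable borel" using assms by (auto simp: upper_gradient_def)
  then show "(\<lambda>y. g y + g' y) \<in> borel_measurable borel" by measurable
  fix \<gamma> :: "real \<Rightarrow> 'a" and l assume \<gamma>: "arc_curve \<gamma> l"
  have "ennreal \<bar>(f (\<gamma> 0) + f' (\<gamma> 0)) - (f (\<gamma> l) + f' (\<gamma> l))\<bar> \<le> ennreal \<bar>f (\<gamma> 0) - f (\<gamma> l)\<bar> + ennreal \<bar>f' (\<gamma> 0) - f' (\<gamma> l)\<bar>"
    by (simp add: ennreal_leI flip: ennreal_plus)
  also have "\<dots> \<le> line_integral g \<gamma> l + line_integral g' \<gamma> l"
    using assms \<gamma> by (intro add_mono) (auto simp: upper_gradient_def)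
  also have "\<dots> = line_integral (\<lambda>y. g y + g' y) \<gamma> l"
    unfolding line_integral_def
    using borel_measurable_along_curve[OF g(1) \<gamma>, of 0 l] borel_measurable_along_curve[OF g(2) \<gamma>, of 0 l]
    by (simp add: nn_integral_add[symmetric] distrib_right)
  finally show "ennreal \<bar>(f (\<gamma> 0) + f' (\<gamma> 0)) - (f (\<gamma> l) + f' (\<gamma> l))\<bar> \<le> line_integral (\<lambda>y. g y + g' y) \<gamma> l" .
qed

lemma upper_gradient_sum:
  fixes f :: "'i \<Rightarrow> 'a::metric_space \<Rightarrow> real"
  assumes "finite S" "\<And>i. i \<in> S \<Longrightarrow> upper_gradient (f i) (g i)"
  shows "upper_gradient (\<lambda>y. \<Sum>i\<in>S. f i y) (\<lambda>y. \<Sum>i\<in>S. g i y)"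
  using assms
proof (induction S rule: finite_induct)
  case empty
  show ?case by (simp add: upper_gradient_def)
next
  case (insert i S)
  then show ?case by (auto intro!: upper_gradient_add)
qed

text \<open>The slope \<open>c k\<close> makes the piece at scale \<open>k\<close> fall by
  \<open>1 / n\<close> across its annulus, and \<open>c k * (2 ^ Suc k * a) = 2 / n\<close>, so each
  scale costs at most \<open>A * (2 / n) powr p\<close>. The starting radius \<open>a\<close> is
  separate from \<open>r\<close>, so that with \<open>n = 1\<close> the cutoff can also be placed at
  the outer scale, as in \<open>cap_le_outer\<close>.\<close>

lemma (in doubling_space) cap_upper_bound:
  assumes "0 < p" "0 < a" "r \<le> a" "0 < n" "2 ^ n * a \<le> R" "0 \<le> A"
    and growth: "\<And>k. k < n \<Longrightarrow> vol x (2 ^ Suc k * a) \<le> A * (2 ^ Suc k * a) powr p"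
  shows "cap_p M p (ball x r) (ball x R) \<le> ennreal (2 powr p * A * real n powr (1 - p))"
proof -
  define c where "c k = 1 / (real n * (2 ^ k * a))" for k :: nat
  have c: "0 < c k" for k using assms by (simp add: c_def)
  define f where "f k y = c k * (2 ^ Suc k * a - dist x y)" for k y
  have cont: "continuous_on UNIV (f k)" for k unfolding f_def by (intro continuous_intros)
  have lip: "upper_gradient (f k) (\<lambda>_. ennreal (c k))" for k
  proof (rule upper_gradient_lipschitz)
    show "0 \<le> c k" using c[of k] by simp
    fix y z
    have "\<bar>f k y - f k z\<bar> = c k * \<bar>dist x z - dist x y\<bar>"
      using c[of k] unfolding f_def by (simp add: abs_mult flip: right_diff_distrib)
    also have "\<dots> \<le> c k * dist y z"
      using c[of k] dist_triangle[of x z y] dist_triangle[of x y z]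
      by (intro mult_left_mono) (auto simp: dist_commute abs_le_iff)
    finally show "\<bar>f k y - f k z\<bar> \<le> c k * dist y z" .
  qed
  define V where "V k = {y. 0 < f k y \<and> f k y < 1 / real n}" for k
  define u where "u y = (\<Sum>k<n. max 0 (min (1 / real n) (f k y)))" for y
  define g where "g y = (\<Sum>k<n. ennreal (c k) * indicator (V k) y)" for y
  have ug: "upper_gradient u g"
    unfolding u_def g_def V_def
    by (intro upper_gradient_sum upper_gradient_truncate[OF lip cont]) auto
  have V: "2 ^ k * a < dist x y \<and> dist x y < 2 ^ Suc k * a" if "y \<in> V k" for k y
  proof -
    have "0 < 2 ^ Suc k * a - dist x y" using that c[of k] by (simp add: V_def f_def zero_less_mult_iff)
    moreover have "c k * (2 ^ Suc k * a - dist x y) < c k * (2 ^ k * a)"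
      using that assms(2,4) by (simp add: V_def f_def c_def)
    then have "2 ^ Suc k * a - dist x y < 2 ^ k * a" using c[of k] by simp
    ultimately show ?thesis by (simp add: algebra_simps)
  qed
  \<comment> \<open>The open annuli of distinct scales are disjoint, so at each point at most one
    summand of \<open>g\<close> is nonzero and the power passes through the sum.\<close>
  have g_le: "epow (g y) p \<le> (\<Sum>k<n. ennreal (c k powr p) * indicator (ball x (2 ^ Suc k * a)) y)" for y
  proof (cases "\<exists>k<n. y \<in> V k")
    case True
    then obtain k where k: "k < n" "y \<in> V k" by blast
    have "y \<notin> V j" if "j \<noteq> k" for j
    proof
      assume "y \<in> V j"
      from V[OF this] V[OF k(2)] have *: "2 ^ k * a < 2 ^ Suc j * a" "2 ^ j * a < 2 ^ Suc k * a" by linarith+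
      then have "(2::real) ^ k < 2 ^ Suc j" "(2::real) ^ j < 2 ^ Suc k"
        using assms(2) by (simp_all only: mult_less_cancel_right_pos)
      then have "k < Suc j" "j < Suc k" by (simp_all only: power_strict_increasing_iff one_less_numeral_iff semiring_norm)
      then show False using that by simp
    qed
    then have "g y = (\<Sum>k\<in>{k}. ennreal (c k) * indicator (V k) y)"
      unfolding g_def using k by (intro sum.mono_neutral_right) (auto simp: indicator_def)
    then have "epow (g y) p = ennreal (c k powr p)" using k c[of k] by simp
    also have "\<dots> = ennreal (c k powr p) * indicator (ball x (2 ^ Suc k * a)) y"
      using V[OF k(2)] by simp
    also have "\<dots> \<le> (\<Sum>k<n. ennreal (c k powr p) * indicator (ball x (2 ^ Suc k * a)) y)"
      using k by (intro member_le_sum) auto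
    finally show ?thesis .
  next
    case False
    then have "g y = 0" by (auto simp: g_def)
    then show ?thesis by simp
  qed
  have energy: "energy M p g \<le> ennreal (2 powr p * A * real n powr (1 - p))"
  proof -
    have "energy M p g \<le> (\<integral>\<^sup>+y. (\<Sum>k<n. ennreal (c k powr p) * indicator (ball x (2 ^ Suc k * a)) y) \<partial>M)"
      by (intro nn_integral_mono g_le)
    also have "\<dots> = (\<Sum>k<n. \<integral>\<^sup>+y. ennreal (c k powr p) * indicator (ball x (2 ^ Suc k * a)) y \<partial>M)"
      by (rule nn_integral_sum) simp
    also have "\<dots> = (\<Sum>k<n. ennreal (c k powr p * vol x (2 ^ Suc k * a)))"
      by (intro sum.cong refl) (subst nn_integral_cmult_indicator, auto simp: emeasure_ball ennreal_mult)
    also have "\<dots> = ennreal (\<Sum>k<n. c k powr p * vol x (2 ^ Suc k * a))"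
      by (rule sum_ennreal) simp
    also have "\<dots> \<le> ennreal (\<Sum>k<n. 2 powr p * A * real n powr (- p))"
    proof (intro ennreal_leI sum_mono)
      fix k assume "k \<in> {..<n}"
      then have "c k powr p * vol x (2 ^ Suc k * a) \<le> c k powr p * (A * (2 ^ Suc k * a) powr p)"
        by (intro mult_left_mono growth) auto
      also have "\<dots> = A * (c k * (2 ^ Suc k * a)) powr p"
        using c[of k] assms(2) by (simp add: powr_mult)
      also have "c k * (2 ^ Suc k * a) = 2 / real n" using assms(2,4) by (simp add: c_def)
      also have "(2 / real n) powr p = 2 powr p * real n powr (- p)"
        using assms(4) by (simp add: powr_divide powr_minus_divide)
      finally show "c k powr p * vol x (2 ^ Suc k * a) \<le> 2 powr p * A * real n powr (- p)" by (simp add: mult_ac)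
    qed
    also have "(\<Sum>k<n. 2 powr p * A * real n powr (- p)) = 2 powr p * A * real n powr (1 - p)"
      using assms(4) powr_mult_base[of "real n" "- p"] by (simp add: mult_ac)
    finally show ?thesis .
  qed
  have u_bounds: "0 \<le> u y" "u y \<le> 1" for y
  proof -
    show "0 \<le> u y" unfolding u_def by (intro sum_nonneg) simp
    have "u y \<le> (\<Sum>k<n. 1 / real n)" unfolding u_def by (intro sum_mono) auto
    then show "u y \<le> 1" using assms(4) by simp
  qed
  have u_zero: "u y = 0" if "y \<notin> ball x R" for y
  proof -
    have "f k y \<le> 0" if "k < n" for k
    proof -
      have "(2::real) ^ Suc k \<le> 2 ^ n" using that by (intro power_increasing) auto
      then have "2 ^ Suc k * a \<le> 2 ^ n * a" using assms(2) by (intro mult_right_mono) auto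
      also have "\<dots> \<le> dist x y" using \<open>y \<notin> ball x R\<close> assms(5) by simp
      finally show ?thesis using c[of k] by (simp add: f_def mult_nonneg_nonpos)
    qed
    then show ?thesis unfolding u_def by (intro sum.neutral) (auto intro!: max_absorb1 min.coboundedI2)
  qed
  have u_one: "1 \<le> u y" if "y \<in> ball x r" for y
  proof -
    have "1 / real n \<le> f k y" for k
    proof -
      have "1 * a \<le> 2 ^ k * a" using assms(2) by (intro mult_right_mono) auto
      then have "2 ^ k * a \<le> 2 ^ Suc k * a - dist x y" using that assms(3) by (simp add: algebra_simps)
      then have "c k * (2 ^ k * a) \<le> f k y"
        unfolding f_def using c[of k] by (intro mult_left_mono) auto
      then show ?thesis using assms(2,4) by (simp add: c_def)
    qed
    then have "u y = (\<Sum>k<n. 1 / real n)" unfolding u_def by (intro sum.cong) (auto simp: max_def min_def)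
    then show ?thesis using assms(4) by simp
  qed
  have "u \<in> borel_measurable borel"
    unfolding u_def using cont by (intro borel_measurable_continuous_onI continuous_intros)
  then have um: "u \<in> borel_measurable M" by (rule mms_borel_measurable[OF mms])
  have "(\<integral>\<^sup>+y. ennreal (\<bar>u y\<bar> powr p) \<partial>M) \<le> (\<integral>\<^sup>+y. indicator (ball x R) y \<partial>M)"
  proof (rule nn_integral_mono)
    fix y show "ennreal (\<bar>u y\<bar> powr p) \<le> indicator (ball x R) y"
      using u_zero[of y] u_bounds[of y] assms(1) by (cases "y \<in> ball x R") (auto simp: powr_le1)
  qed
  also have "\<dots> < \<infinity>" by simp
  finally have "cap_p M p (ball x r) (ball x R) \<le> energy M p g"
    using energy by (intro cap_p_le_upper_gradient[OF mms assms(1) um _ u_zero u_one ug])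
      (auto intro: order_le_less_trans)
  then show ?thesis using energy by (rule order_trans)
qed

section \<open>Dyadic scales and logarithms\<close>

text \<open>As \<open>1 - p\<close> is negative, the upper bound for the capacity needs many scales
  and the lower bound few. From \<open>2 \<le> q\<close> there is at least one scale, so rounding
  \<open>log 2 q\<close> down costs a factor of at most 2.\<close>

lemma ex_dyadic_below:
  fixes q :: real
  assumes "2 \<le> q"
  shows "\<exists>n>0. 2 ^ n \<le> q \<and> ln q / (2 * ln 2) \<le> real n"
proof -
  have l: "1 \<le> log 2 q" using assms by (simp add: le_log_iff)
  define n where "n = nat \<lfloor>log 2 q\<rfloor>"
  have n: "real n \<le> log 2 q" "log 2 q < real n + 1" "0 < n" using l by (auto simp: n_def)
  have "2 powr real n \<le> q" using n(1) assms by (simp add: le_log_iff)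
  then have "2 ^ n \<le> q" by (simp add: powr_realpow)
  moreover have "1 \<le> real n" using n(3) by simp
  then have "log 2 q / 2 \<le> real n" using n(2) by simp
  then have "ln q / (2 * ln 2) \<le> real n" by (simp add: log_def)
  ultimately show ?thesis using n(3) by blast
qed

text \<open>Rounding \<open>3 + log 2 q\<close> up adds at most 1, and
  \<open>log 2 q \<ge> 1\<close> absorbs the total of 4 into \<open>5 * log 2 q\<close>. The factors
  8 and 16 are those of \<open>ex_cap_lower_bound\<close>.\<close>

lemma ex_dyadic_above:
  fixes q :: real
  assumes "2 \<le> q"
  shows "\<exists>n>0. 8 * q \<le> 2 ^ n \<and> 2 ^ n \<le> 16 * q \<and> real n \<le> 5 * ln q / ln 2"
proof -
  have l: "1 \<le> log 2 q" using assms by (simp add: le_log_iff)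
  have l8: "log 2 (8 * q) = 3 + log 2 q"
    using assms log_mult[of 2 8 q] log_pow_cancel[of 2 3] by simp
  define n where "n = nat \<lceil>log 2 (8 * q)\<rceil>"
  have n: "log 2 (8 * q) \<le> real n" "real n < log 2 (8 * q) + 1" "0 < n"
    using l l8 by (auto simp: n_def) linarith+
  have "8 * q \<le> 2 powr real n" using n(1) assms by (simp add: log_le_iff)
  then have 1: "8 * q \<le> 2 ^ n" by (simp add: powr_realpow)
  have "2 powr real n \<le> 2 powr (log 2 (8 * q) + 1)" using n(2) by (intro powr_mono) auto
  also have "\<dots> = 16 * q" using assms by (simp add: powr_add)
  finally have 2: "2 ^ n \<le> 16 * q" by (simp add: powr_realpow)
  have "real n \<le> 5 * log 2 q" using n(2) l l8 by simp
  then show ?thesis using 1 2 n(3) by (auto simp: log_def)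
qed

section \<open>Capacity bounds with logarithms\<close>

context poincare_space
begin

lemma ex_cap_upper_bound_log:
  "\<exists>C>0. \<forall>x r R A. 0 < r \<and> 2 * r \<le> R \<and> 0 \<le> A \<and> (\<forall>\<rho>. r \<le> \<rho> \<and> \<rho> \<le> R \<longrightarrow> vol x \<rho> / \<rho> powr p \<le> A) \<longrightarrow>
    cap_p M p (ball x r) (ball x R) \<le> ennreal (C * (A * ln (R / r) powr (1 - p)))"
proof (intro exI[of _ "2 powr p * (1 / (2 * ln 2)) powr (1 - p)"] conjI allI impI; (elim conjE)?)
  fix x :: 'a and r R A :: real
  assume r: "0 < r" "2 * r \<le> R" and A: "0 \<le> A" "\<forall>\<rho>. r \<le> \<rho> \<and> \<rho> \<le> R \<longrightarrow> vol x \<rho> / \<rho> powr p \<le> A"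
  have q: "2 \<le> R / r" using r by (simp add: le_divide_eq)
  then have lnq: "0 < ln (R / r)" by simp
  obtain n where n: "0 < n" "2 ^ n \<le> R / r" "ln (R / r) / (2 * ln 2) \<le> real n"
    using ex_dyadic_below[OF q] by blast
  have nR: "2 ^ n * r \<le> R" using n(2) r by (simp add: le_divide_eq)
  have "cap_p M p (ball x r) (ball x R) \<le> ennreal (2 powr p * A * real n powr (1 - p))"
  proof (rule cap_upper_bound[OF _ r(1) order_refl n(1) nR A(1)])
    show "0 < p" using p_gt_1 by simp
    fix k assume "k < n"
    then have "(2::real) ^ Suc k \<le> 2 ^ n" by (intro power_increasing) auto
    then have "2 ^ Suc k * r \<le> 2 ^ n * r" using r by (intro mult_right_mono) auto
    moreover have "1 * r \<le> 2 ^ Suc k * r" using r one_le_power[of "2::real" "Suc k"] by (intro mult_right_mono) auto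
    ultimately have "vol x (2 ^ Suc k * r) / (2 ^ Suc k * r) powr p \<le> A"
      using nR by (intro A(2)[rule_format]) linarith
    then show "vol x (2 ^ Suc k * r) \<le> A * (2 ^ Suc k * r) powr p" using r by (simp add: divide_le_eq)
  qed
  also have "\<dots> \<le> ennreal (2 powr p * (1 / (2 * ln 2)) powr (1 - p) * (A * ln (R / r) powr (1 - p)))"
  proof (rule ennreal_leI)
    have "real n powr (1 - p) \<le> (1 / (2 * ln 2) * ln (R / r)) powr (1 - p)"
      using n(3) lnq p_gt_1 by (intro powr_mono2') auto
    also have "\<dots> = (1 / (2 * ln 2)) powr (1 - p) * ln (R / r) powr (1 - p)"
      by (rule powr_mult)
    finally have "2 powr p * A * real n powr (1 - p) \<le>
        2 powr p * A * ((1 / (2 * ln 2)) powr (1 - p) * ln (R / r) powr (1 - p))"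
      using A by (intro mult_left_mono) auto
    then show "2 powr p * A * real n powr (1 - p) \<le>
        2 powr p * (1 / (2 * ln 2)) powr (1 - p) * (A * ln (R / r) powr (1 - p))"
      by (simp only: mult_ac)
  qed
  finally show "cap_p M p (ball x r) (ball x R) \<le>
      ennreal (2 powr p * (1 / (2 * ln 2)) powr (1 - p) * (A * ln (R / r) powr (1 - p)))" .
qed simp

lemma ex_cap_lower_bound_log:
  "\<exists>C>0. \<forall>x r R A. 0 < r \<and> 2 * r \<le> R \<and> (\<exists>z. 2 * R \<le> dist x z) \<and> 0 < A \<and>
      (\<forall>\<rho>. r / 2 \<le> \<rho> \<and> \<rho> \<le> 8 * R \<longrightarrow> A \<le> vol x \<rho> / \<rho> powr p) \<longrightarrow>
    ennreal (A * ln (R / r) powr (1 - p)) \<le> ennreal C * cap_p M p (ball x r) (ball x R)"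
proof -
  obtain C where C: "0 < C" and lower: "\<And>x r R A n. 0 < r \<and> 2 * r \<le> R \<and> (\<exists>z. 2 * R \<le> dist x z) \<and> 0 < n \<and>
      8 * R \<le> 2 ^ n * r \<and> 2 ^ n * r \<le> 16 * R \<and> 0 < A \<and>
      (\<forall>k\<le>n. A * (2 ^ k * (r / 2)) powr p \<le> vol x (2 ^ k * (r / 2))) \<Longrightarrow>
    ennreal (A * real n powr (1 - p)) \<le> ennreal C * cap_p M p (ball x r) (ball x R)"
    using ex_cap_lower_bound by blast
  define c where "c = (5 / ln 2) powr (1 - p)"
  have c: "0 < c" by (simp add: c_def)
  show ?thesis
  proof (intro exI[of _ "C / c"] conjI allI impI; (elim conjE)?)
    show "0 < C / c" using C c by simp
  next
    fix x :: 'a and r R A :: real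
    assume r: "0 < r" "2 * r \<le> R" and z: "\<exists>z. 2 * R \<le> dist x z"
      and A: "0 < A" "\<forall>\<rho>. r / 2 \<le> \<rho> \<and> \<rho> \<le> 8 * R \<longrightarrow> A \<le> vol x \<rho> / \<rho> powr p"
    have q: "2 \<le> R / r" using r by (simp add: le_divide_eq)
    then have lnq: "0 < ln (R / r)" by simp
    obtain n where n: "0 < n" "8 * (R / r) \<le> 2 ^ n" "2 ^ n \<le> 16 * (R / r)" "real n \<le> 5 * ln (R / r) / ln 2"
      using ex_dyadic_above[OF q] by blast
    have nR: "8 * R \<le> 2 ^ n * r" "2 ^ n * r \<le> 16 * R" using n(2,3) r by (simp_all add: field_simps)
    have "A * (2 ^ k * (r / 2)) powr p \<le> vol x (2 ^ k * (r / 2))" if "k \<le> n" for k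
    proof -
      have "(2::real) ^ k \<le> 2 ^ n" using that by (intro power_increasing) auto
      then have "2 ^ k * (r / 2) \<le> 2 ^ n * (r / 2)" using r by (intro mult_right_mono) auto
      moreover have "1 * (r / 2) \<le> 2 ^ k * (r / 2)" using r by (intro mult_right_mono) auto
      moreover have "2 ^ n * (r / 2) \<le> 8 * R" using nR(2) by simp
      ultimately have "A \<le> vol x (2 ^ k * (r / 2)) / (2 ^ k * (r / 2)) powr p"
        by (intro A(2)[rule_format]) linarith
      then show ?thesis using r by (simp add: le_divide_eq)
    qed
    then have *: "ennreal (A * real n powr (1 - p)) \<le> ennreal C * cap_p M p (ball x r) (ball x R)"
      using r z n nR A by (intro lower) auto
    have "c * ln (R / r) powr (1 - p) = (5 / ln 2 * ln (R / r)) powr (1 - p)"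
      unfolding c_def by (rule powr_mult[symmetric])
    also have "\<dots> \<le> real n powr (1 - p)" using n p_gt_1 by (intro powr_mono2') auto
    finally have "A * (c * ln (R / r) powr (1 - p)) \<le> A * real n powr (1 - p)"
      using A(1) by (intro mult_left_mono) auto
    then have "ennreal (c * (A * ln (R / r) powr (1 - p))) \<le> ennreal (A * real n powr (1 - p))"
      by (intro ennreal_leI) (simp add: mult_ac)
    also note *
    finally have "ennreal (1 / c) * ennreal (c * (A * ln (R / r) powr (1 - p))) \<le>
        ennreal (1 / c) * (ennreal C * cap_p M p (ball x r) (ball x R))"
      by (rule mult_left_mono) simp
    moreover have "ennreal (1 / c) * ennreal (c * (A * ln (R / r) powr (1 - p))) = ennreal (A * ln (R / r) powr (1 - p))"
      using c A by (simp flip: ennreal_mult)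
    moreover have "ennreal (1 / c) * (ennreal C * cap_p M p (ball x r) (ball x R)) = ennreal (C / c) * cap_p M p (ball x r) (ball x R)"
      using c C by (simp add: mult.assoc[symmetric] flip: ennreal_mult)
    ultimately show "ennreal (A * ln (R / r) powr (1 - p)) \<le> ennreal (C / c) * cap_p M p (ball x r) (ball x R)"
      by simp
  qed
qed

end

section \<open>Exponent sets\<close>

context doubling_space
begin

text \<open>\<open>lowerQ0\<close> speaks of radii up to 1. For larger ones up to \<open>T\<close>,
  monotonicity of the volume and the bound \<open>max 1 T powr p\<close> for \<open>t powr p\<close>
  suffice; a pair straddling 1 is compared through the radius 1.\<close>

lemma lowerQ0_growth:
  assumes "p \<in> lowerQ0 M x" "0 < T"
  shows "\<exists>C>0. \<forall>s t. 0 < s \<and> s \<le> t \<and> t \<le> T \<longrightarrow> vol x s / s powr p \<le> C * (vol x t / t powr p)"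
proof -
  from assms(1) obtain C where p: "0 < p" and C: "0 < C"
    "\<And>r R. 0 < r \<Longrightarrow> r < R \<Longrightarrow> R \<le> 1 \<Longrightarrow> vol x r / vol x R \<le> C * (r / R) powr p"
    by (auto simp: lowerQ0_def)
  define C' where "C' = max 1 C"
  have C': "1 \<le> C'" "C \<le> C'" by (auto simp: C'_def)
  define N where "N = max 1 T powr p"
  have N: "1 \<le> N" using p by (simp add: N_def ge_one_powr_ge_zero)
  have unit: "vol x s / s powr p \<le> C' * (vol x t / t powr p)" if "0 < s" "s \<le> t" "t \<le> 1" for s t
  proof (cases "s = t")
    case True
    then show ?thesis using C' mult_right_mono[of 1 C' "vol x t / t powr p"] by simp
  next
    case False
    then have "vol x s / vol x t \<le> C * (s / t) powr p" using that by (intro C) auto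
    moreover have "0 < vol x t" using that by (intro vol_pos) auto
    ultimately have "vol x s \<le> C * (s / t) powr p * vol x t" by (simp add: divide_le_eq)
    also have "\<dots> \<le> C' * (s / t) powr p * vol x t" using C' by (intro mult_right_mono) auto
    finally show ?thesis using that by (simp add: powr_divide field_simps)
  qed
  have big: "vol x t \<le> N * (vol x t / t powr p)" if "1 \<le> t" "t \<le> T" for t
  proof -
    have "t powr p \<le> N" unfolding N_def using that p by (intro powr_mono2) auto
    then have "vol x t * t powr p \<le> vol x t * N" by (intro mult_left_mono) auto
    then show ?thesis using that by (simp add: le_divide_eq mult.commute)
  qed
  have "vol x s / s powr p \<le> C' * N * (vol x t / t powr p)" if "0 < s" "s \<le> t" "t \<le> T" for s t
  proof -
    have nn: "0 \<le> vol x t / t powr p" by simp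
    consider "t \<le> 1" | "s \<le> 1" "1 < t" | "1 < s" using that by linarith
    then show ?thesis
    proof cases
      case 1
      have "vol x s / s powr p \<le> C' * (vol x t / t powr p)" using that 1 by (intro unit)
      also have "\<dots> \<le> C' * N * (vol x t / t powr p)"
        using N C' nn by (intro mult_right_mono) (auto simp: mult_le_cancel_left1)
      finally show ?thesis .
    next
      case 2
      have "vol x s / s powr p \<le> C' * (vol x 1 / 1 powr p)" using that 2 by (intro unit) auto
      also have "\<dots> \<le> C' * vol x t" using 2 C' by (auto intro!: mult_left_mono vol_mono_radius)
      also have "\<dots> \<le> C' * (N * (vol x t / t powr p))" using 2 that C' by (intro mult_left_mono big) auto
      finally show ?thesis by (simp add: mult.assoc)
    next
      case 3
      have "vol x s / s powr p \<le> vol x s / 1"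
        using 3 p by (intro divide_left_mono) (auto simp: ge_one_powr_ge_zero)
      also have "\<dots> \<le> vol x t" using that by (simp add: vol_mono_radius)
      also have "\<dots> \<le> N * (vol x t / t powr p)" using 3 that by (intro big) auto
      also have "\<dots> \<le> C' * N * (vol x t / t powr p)"
        using N C' nn by (intro mult_right_mono) (auto simp: mult_le_cancel_right1)
      finally show ?thesis .
    qed
  qed
  then show ?thesis using N C' by (intro exI[of _ "C' * N"]) auto
qed

text \<open>Here a volume at a large radius has to be bounded by one at a smaller radius, so
  monotonicity points the wrong way beyond radius 1; the ratio \<open>vol x T / vol x 1\<close>
  inside \<open>N\<close> makes up for it.\<close>

lemma upperQ0_growth:
  assumes "p \<in> upperQ0 M x" "0 < T"
  shows "\<exists>C>0. \<forall>s t. 0 < s \<and> s \<le> t \<and> t \<le> T \<longrightarrow> vol x t / t powr p \<le> C * (vol x s / s powr p)"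
proof -
  from assms(1) obtain C where p: "0 < p" and C: "0 < C"
    "\<And>r R. 0 < r \<Longrightarrow> r < R \<Longrightarrow> R \<le> 1 \<Longrightarrow> C * (r / R) powr p \<le> vol x r / vol x R"
    by (auto simp: upperQ0_def)
  define C' where "C' = max 1 (1 / C)"
  have C': "1 \<le> C'" "1 / C \<le> C'" by (auto simp: C'_def)
  define N where "N = max 1 T powr p * (max 1 (vol x T / vol x 1))"
  have T1: "1 \<le> max 1 T powr p" using p by (simp add: ge_one_powr_ge_zero)
  then have N: "1 \<le> N" "vol x T / vol x 1 \<le> N" "max 1 T powr p * (vol x T / vol x 1) \<le> N"
  proof -
    show "1 \<le> N" unfolding N_def using mult_mono[of 1 "max 1 T powr p" 1 "max 1 (vol x T / vol x 1)"] T1 by simp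
    show "vol x T / vol x 1 \<le> N"
      unfolding N_def using mult_mono[of 1 "max 1 T powr p" "vol x T / vol x 1" "max 1 (vol x T / vol x 1)"] T1 by simp
    show "max 1 T powr p * (vol x T / vol x 1) \<le> N"
      unfolding N_def by (intro mult_left_mono) auto
  qed
  have v1: "0 < vol x 1" by (intro vol_pos) simp
  have unit: "vol x t / t powr p \<le> C' * (vol x s / s powr p)" if "0 < s" "s \<le> t" "t \<le> 1" for s t
  proof (cases "s = t")
    case True
    then show ?thesis using C' mult_right_mono[of 1 C' "vol x t / t powr p"] by simp
  next
    case False
    then have "C * (s / t) powr p \<le> vol x s / vol x t" using that by (intro C) auto
    moreover have "0 < vol x t" using that by (intro vol_pos) auto
    ultimately have "C * (s / t) powr p * vol x t \<le> vol x s" by (simp add: le_divide_eq)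
    then have "(s / t) powr p * vol x t \<le> 1 / C * vol x s" using C(1) by (simp add: field_simps)
    also have "\<dots> \<le> C' * vol x s" using C' by (intro mult_right_mono) auto
    finally show ?thesis using that by (simp add: powr_divide field_simps)
  qed
  have "vol x t / t powr p \<le> C' * N * (vol x s / s powr p)" if "0 < s" "s \<le> t" "t \<le> T" for s t
  proof -
    have nn: "0 \<le> vol x s / s powr p" by simp
    have volT: "vol x t \<le> vol x T / vol x 1 * vol x 1" using that v1 by (simp add: vol_mono_radius)
    consider "t \<le> 1" | "s \<le> 1" "1 < t" | "1 < s" using that by linarith
    then show ?thesis
    proof cases
      case 1
      have "vol x t / t powr p \<le> C' * (vol x s / s powr p)" using that 1 by (intro unit)
      also have "\<dots> \<le> C' * N * (vol x s / s powr p)"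
        using N C' nn by (intro mult_right_mono) (auto simp: mult_le_cancel_left1)
      finally show ?thesis .
    next
      case 2
      have "vol x t / t powr p \<le> vol x t / 1"
        using 2 p by (intro divide_left_mono) (auto simp: ge_one_powr_ge_zero)
      also have "\<dots> \<le> N * vol x 1" using volT mult_right_mono[OF N(2), of "vol x 1"] v1 by simp
      also have "\<dots> \<le> N * (C' * (vol x s / s powr p))"
        using unit[of s 1] that 2 N by (intro mult_left_mono) auto
      finally show ?thesis by (simp add: mult_ac)
    next
      case 3
      have "vol x t / t powr p \<le> vol x t / 1"
        using 3 that p by (intro divide_left_mono) (auto simp: ge_one_powr_ge_zero)
      also have "\<dots> \<le> vol x T / vol x 1 * vol x s"
      proof -
        have "vol x 1 \<le> vol x s" using 3 by (intro vol_mono_radius) simp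
        then show ?thesis using volT mult_left_mono[of "vol x 1" "vol x s" "vol x T / vol x 1"] by simp
      qed
      also have "\<dots> \<le> vol x T / vol x 1 * (max 1 T powr p * (vol x s / s powr p))"
      proof (intro mult_left_mono)
        have "s powr p \<le> max 1 T powr p" using that 3 p by (intro powr_mono2) auto
        then have "vol x s * s powr p \<le> vol x s * max 1 T powr p" by (intro mult_left_mono) auto
        then show "vol x s \<le> max 1 T powr p * (vol x s / s powr p)"
          using that by (simp add: le_divide_eq mult.commute)
      qed simp
      also have "\<dots> \<le> N * (vol x s / s powr p)"
        using mult_right_mono[OF N(3) nn] by (simp only: mult_ac)
      also have "\<dots> \<le> C' * N * (vol x s / s powr p)"
        using N C' nn by (intro mult_right_mono) (auto simp: mult_le_cancel_right1)
      finally show ?thesis .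
    qed
  qed
  then show ?thesis using N C' by (intro exI[of _ "C' * N"]) auto
qed

text \<open>The logarithm is removed by lowering the exponent: \<open>\<delta>\<close> is chosen
  such that \<open>(y powr \<delta>) powr (p - 1) = y powr (p - q)\<close>, which dominates
  \<open>ln y powr (p - 1)\<close> up to a constant. As \<open>bound\<close> stops at
  \<open>R0\<close>, \<open>R\<close> is replaced by \<open>S = min R R0\<close>, smaller by a
  factor of at most \<open>N\<close>; if \<open>S < 2 * r\<close>, monotonicity of the volume is
  enough.\<close>

lemma lowerQ0_memI:
  assumes q: "0 < q" "q < p" and p: "1 < p" and R0: "0 < R0" and C: "0 < C"
    and bound: "\<And>r R. 0 < r \<Longrightarrow> 2 * r \<le> R \<Longrightarrow> R \<le> R0 \<Longrightarrow>
      vol x r / r powr p * ln (R / r) powr (1 - p) \<le> C * (vol x R / R powr p)"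
  shows "q \<in> lowerQ0 M x"
proof -
  define N where "N = max 1 (1 / R0)"
  have N: "1 \<le> N" "1 \<le> N * R0" using R0 by (auto simp: N_def max_def field_simps)
  define \<delta> where "\<delta> = (p - q) / (p - 1)"
  have \<delta>: "0 < \<delta>" "\<delta> * (p - 1) = p - q" using q p by (auto simp: \<delta>_def)
  define C1 where "C1 = C * (1 / \<delta>) powr (p - 1)"
  have C1: "0 < C1" using C \<delta> by (simp add: C1_def)
  have "vol x r / vol x R \<le> (C1 * N powr q + (2 * N) powr q) * (r / R) powr q" if r: "0 < r" "r < R" "R \<le> 1" for r R
  proof -
    define S where "S = min R R0"
    have S: "0 < S" "S \<le> R" "S \<le> R0" using r R0 by (auto simp: S_def)
    have RS: "R \<le> N * S"
    proof (cases "R \<le> R0")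
      case True
      then have "S = R" by (simp add: S_def)
      then show ?thesis using N(1) r mult_right_mono[of 1 N R] by simp
    next
      case False
      then have "S = R0" by (simp add: S_def)
      then show ?thesis using N(2) r by simp
    qed
    have volR: "0 < vol x R" "0 < vol x S" "0 < vol x r" using r S by (auto intro!: vol_pos)
    have rS: "r / S \<le> N * (r / R)" using RS r S by (simp add: field_simps)
    have nn: "0 \<le> C1 * N powr q * (r / R) powr q" "0 \<le> (2 * N) powr q * (r / R) powr q" using C1 by simp_all
    show ?thesis
    proof (cases "2 * r \<le> S")
      case True
      define y where "y = S / r"
      have y: "2 \<le> y" using True r by (simp add: y_def le_divide_eq)
      then have lny: "0 < ln y" by simp
      have "ln y powr (p - 1) \<le> (y powr \<delta> / \<delta>) powr (p - 1)"
        using y \<delta> p lny ln_powr_bound[of y \<delta>] by (intro powr_mono2) auto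
      also have "\<dots> = y powr (p - q) * (1 / \<delta>) powr (p - 1)"
        using y \<delta> by (simp add: powr_divide powr_powr)
      finally have ln_le: "ln y powr (p - 1) \<le> y powr (p - q) * (1 / \<delta>) powr (p - 1)" .
      have "vol x r / r powr p * ln y powr (1 - p) \<le> C * (vol x S / S powr p)"
        unfolding y_def using True r S by (intro bound)
      then have "vol x r / r powr p * ln y powr (1 - p) * ln y powr (p - 1) \<le> C * (vol x S / S powr p) * ln y powr (p - 1)"
        by (intro mult_right_mono) auto
      moreover have "ln y powr (1 - p) * ln y powr (p - 1) = 1" using lny by (simp flip: powr_add)
      ultimately have "vol x r / r powr p \<le> C * (vol x S / S powr p) * ln y powr (p - 1)"
        by (simp add: mult.assoc)
      also have "\<dots> \<le> C * (vol x S / S powr p) * (y powr (p - q) * (1 / \<delta>) powr (p - 1))"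
        using ln_le C by (intro mult_left_mono) auto
      finally have "vol x r \<le> C * (vol x S / S powr p) * (y powr (p - q) * (1 / \<delta>) powr (p - 1)) * r powr p"
        using r by (simp add: divide_le_eq)
      also have "\<dots> = C1 * vol x S * (y powr (p - q) * (r / S) powr p)"
        using r S by (simp add: C1_def powr_divide field_simps)
      also have "y powr (p - q) * (r / S) powr p = (r / S) powr q"
        using r S by (simp add: y_def powr_divide powr_diff field_simps)
      finally have "vol x r \<le> C1 * (r / S) powr q * vol x S" by (simp add: mult_ac)
      also have "\<dots> \<le> C1 * (N * (r / R)) powr q * vol x R"
        using rS r S q C1 by (intro mult_mono mult_left_mono powr_mono2 vol_mono_radius) auto
      also have "(N * (r / R)) powr q = N powr q * (r / R) powr q"
        by (rule powr_mult)
      finally have "vol x r / vol x R \<le> C1 * N powr q * (r / R) powr q"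
        using volR by (simp add: divide_le_eq mult_ac)
      then show ?thesis using nn unfolding distrib_right by linarith
    next
      case False
      have "vol x r / vol x R \<le> 1" using volR r by (simp add: vol_mono_radius)
      also have "1 \<le> (2 * (r / S)) powr q"
        using False q S by (intro ge_one_powr_ge_zero) (auto simp: field_simps)
      also have "\<dots> \<le> (2 * (N * (r / R))) powr q"
        using rS q r S by (intro powr_mono2) auto
      also have "\<dots> = (2 * N) powr q * (r / R) powr q"
        using N r powr_mult[of "2 * N" "r / R" q] by (simp add: mult.assoc)
      finally show ?thesis using nn unfolding distrib_right by linarith
    qed
  qed
  moreover have "0 < C1 * N powr q + (2 * N) powr q" using C1 N by (intro add_pos_pos) auto
  ultimately show ?thesis using q unfolding lowerQ0_def by blast
qed

text \<open>Now the exponent is raised, and replacing \<open>R\<close> by \<open>S\<close> decreases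
  the volume in the unfavourable direction; \<open>m\<close> doublings repair this, and one more
  settles the case \<open>S < 2 * r\<close>.\<close>

lemma upperQ0_memI:
  assumes q: "p < q" and p: "1 < p" and R0: "0 < R0" and C: "0 < C"
    and bound: "\<And>r R. 0 < r \<Longrightarrow> 2 * r \<le> R \<Longrightarrow> R \<le> R0 \<Longrightarrow>
      vol x R / R powr p * ln (R / r) powr (1 - p) \<le> C * (vol x r / r powr p)"
  shows "q \<in> upperQ0 M x"
proof -
  obtain m :: nat where m: "max 1 (1 / R0) < 2 ^ m" using real_arch_pow[of 2 "max 1 (1 / R0)"] by auto
  have m1: "1 \<le> 2 ^ m * R0" using m R0 by (simp add: field_simps)
  define \<delta> where "\<delta> = (q - p) / (p - 1)"
  have \<delta>: "0 < \<delta>" "\<delta> * (p - 1) = q - p" using q p by (auto simp: \<delta>_def)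
  define C1 where "C1 = 1 / C * \<delta> powr (p - 1)"
  have C1: "0 < C1" using C \<delta> by (simp add: C1_def)
  define c where "c = min C1 (1 / D) / D ^ m"
  have c: "0 < c" using C1 D_ge_1 by (simp add: c_def)
  have "c * (r / R) powr q \<le> vol x r / vol x R" if r: "0 < r" "r < R" "R \<le> 1" for r R
  proof -
    define S where "S = min R R0"
    have S: "0 < S" "S \<le> R" "S \<le> R0" using r R0 by (auto simp: S_def)
    have RS: "R \<le> 2 ^ m * S"
    proof (cases "R \<le> R0")
      case True
      then have "S = R" by (simp add: S_def)
      then show ?thesis using r mult_right_mono[of 1 "2 ^ m" R] by simp
    next
      case False
      then have "S = R0" by (simp add: S_def)
      then show ?thesis using m1 r by simp
    qed
    have volR: "0 < vol x R" using r by (auto intro!: vol_pos)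
    have volS: "vol x R / D ^ m \<le> vol x S"
      using vol_compare[of S x x R m] RS S D_ge_1 by (simp add: divide_le_eq mult.commute)
    have main: "min C1 (1 / D) * (r / R) powr q * vol x S \<le> vol x r"
    proof (cases "2 * r \<le> S")
      case True
      define y where "y = S / r"
      have y: "2 \<le> y" using True r by (simp add: y_def le_divide_eq)
      then have lny: "0 < ln y" by simp
      have "(y powr \<delta> / \<delta>) powr (1 - p) \<le> ln y powr (1 - p)"
        using y \<delta> p lny ln_powr_bound[of y \<delta>] by (intro powr_mono2') auto
      moreover have "(y powr \<delta> / \<delta>) powr (1 - p) = y powr (p - q) * \<delta> powr (p - 1)"
      proof -
        have "\<delta> * (1 - p) = p - q" using \<delta>(2) by (simp add: algebra_simps)
        moreover have "1 / \<delta> powr (1 - p) = \<delta> powr (p - 1)" using powr_minus_divide[of \<delta> "1 - p"] by simp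
        ultimately show ?thesis using y \<delta>(1) by (simp add: powr_divide powr_powr) (metis times_divide_eq_right mult.right_neutral)
      qed
      ultimately have ln_ge: "y powr (p - q) * \<delta> powr (p - 1) \<le> ln y powr (1 - p)" by simp
      have "vol x S / S powr p * (y powr (p - q) * \<delta> powr (p - 1)) \<le> vol x S / S powr p * ln y powr (1 - p)"
        using ln_ge by (intro mult_left_mono) auto
      also have "\<dots> \<le> C * (vol x r / r powr p)"
        unfolding y_def using True r S by (intro bound)
      finally have "C1 * (y powr (p - q) * (r powr p / S powr p)) * vol x S \<le> vol x r"
        using C r S by (simp add: C1_def field_simps)
      also have "y powr (p - q) * (r powr p / S powr p) = (r / S) powr q"
        using r S by (simp add: y_def powr_divide powr_diff field_simps)
      finally have *: "C1 * (r / S) powr q * vol x S \<le> vol x r" .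
      have "(r / R) powr q \<le> (r / S) powr q"
        using r S p q by (intro powr_mono2 divide_left_mono) auto
      then have "min C1 (1 / D) * (r / R) powr q * vol x S \<le> C1 * (r / S) powr q * vol x S"
        using C1 D_ge_1 by (intro mult_right_mono mult_mono) auto
      with * show ?thesis by linarith
    next
      case False
      have "min C1 (1 / D) * (r / R) powr q \<le> 1 / D * 1"
        using C1 D_ge_1 r p q by (intro mult_mono powr_le1) auto
      then have "min C1 (1 / D) * (r / R) powr q * vol x S \<le> 1 / D * vol x S"
        by (intro mult_right_mono) auto
      also have "\<dots> \<le> vol x (S / 2)" using doubling[of "S / 2" x] S D_ge_1 by (simp add: divide_le_eq mult.commute)
      also have "\<dots> \<le> vol x r" using False by (intro vol_mono_radius) simp
      finally show ?thesis .
    qed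
    have "c * (r / R) powr q * vol x R = min C1 (1 / D) * (r / R) powr q * (vol x R / D ^ m)"
      by (simp add: c_def)
    also have "\<dots> \<le> min C1 (1 / D) * (r / R) powr q * vol x S"
      using volS C1 D_ge_1 by (intro mult_left_mono) auto
    also note main
    finally show ?thesis using volR by (simp add: le_divide_eq)
  qed
  then show ?thesis using c q p unfolding upperQ0_def by auto
qed

end

section \<open>Capacity of annuli\<close>

text \<open>Splitting at \<open>a = t\<close>. Integrated with \<open>t\<close> at the
  \<open>L^p\<close> average, this is Hoelder's inequality up to a factor 2.\<close>

lemma epow_le_interpolate:
  assumes "0 < t" "0 < q" "q \<le> p"
  shows "epow a q \<le> ennreal (t powr q) + ennreal (t powr (q - p)) * epow a p"
proof (cases a)
  case (real b)
  have "b powr q \<le> t powr q + t powr (q - p) * b powr p"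
  proof (cases "b \<le> t")
    case True
    then have "b powr q \<le> t powr q" using real assms by (intro powr_mono2) auto
    then show ?thesis by (simp add: add_increasing2)
  next
    case False
    have "b powr q = b powr (q - p) * b powr p" by (simp flip: powr_add)
    also have "\<dots> \<le> t powr (q - p) * b powr p"
      using False assms by (intro mult_right_mono powr_mono2') auto
    finally show ?thesis by (simp add: add_increasing)
  qed
  then show ?thesis using real by (simp add: ennreal_leI flip: ennreal_mult ennreal_plus)
next
  case top
  then show ?thesis using assms by (simp add: ennreal_mult_top)
qed

text \<open>The average with exponent \<open>p0\<close> is estimated by
  \<open>epow_le_interpolate\<close>; its two terms are of equal size, and
  \<open>2 powr (1 / p0) \<le> 2\<close> gives the constant \<open>2 * C\<close>.\<close>

lemma ex_poincare_space:
  fixes M :: "'a::metric_space measure"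
  assumes M: "mms M" and "globally_doubling M" and p: "1 \<le> p0" "p0 < p" and "global_poincare M p0"
  shows "\<exists>D K lam. poincare_space M D p K lam"
proof -
  obtain D0 where D0: "\<And>y r. 0 < r \<Longrightarrow> emeasure M (ball y (2 * r)) \<le> ennreal D0 * emeasure M (ball y r)"
    using assms(2) by (auto simp: globally_doubling_def)
  define D where "D = max 1 D0"
  have em: "emeasure M (ball y r) = ennreal (measure M (ball y r))" if "0 < r" for y r
    using M that by (intro emeasure_eq_ennreal_measure) (auto simp: mms_def less_top[symmetric])
  have "measure M (ball y (2 * r)) \<le> D * measure M (ball y r)" if "0 < r" for y r
  proof -
    have "ennreal (measure M (ball y (2 * r))) \<le> ennreal D0 * ennreal (measure M (ball y r))"
      using D0[OF that, of y] that by (simp add: em)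
    also have "\<dots> \<le> ennreal D * ennreal (measure M (ball y r))"
      by (intro mult_right_mono ennreal_leI) (auto simp: D_def)
    also have "\<dots> = ennreal (D * measure M (ball y r))" by (simp add: D_def ennreal_mult)
    finally show ?thesis by (simp add: D_def ennreal_le_iff)
  qed
  then interpret doubling_space M D
    using M by unfold_locales (auto simp: D_def)
  obtain C lam where C: "1 \<le> C" "1 \<le> lam" and PI: "\<And>y r f g. 0 < r \<Longrightarrow> f \<in> borel_measurable M \<Longrightarrow>
      set_integrable M (ball y r) f \<Longrightarrow> upper_gradient f g \<Longrightarrow>
        ennreal ((\<integral>z\<in>ball y r. \<bar>f z - avg M (ball y r) f\<bar> \<partial>M) / measure M (ball y r))
        \<le> ennreal (C * r) * epow ((\<integral>\<^sup>+ z. epow (g z) p0 * indicator (ball y (lam*r)) z \<partial>M)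
                / ennreal (measure M (ball y (lam*r)))) (1/p0)"
    using assms(5) unfolding global_poincare_def by blast
  have "poincare_space M D p (2 * C) lam"
  proof unfold_locales
    show "1 < p" "1 \<le> 2 * C" "1 \<le> lam" using p C by auto
    fix r s :: real and f y g
    assume r: "0 < r" and f: "f \<in> borel_measurable M" "set_integrable M (ball y r) f" and ug: "upper_gradient f g"
      and s: "0 \<le> s"
      "(\<integral>\<^sup>+z. epow (g z) p * indicator (ball y (lam * r)) z \<partial>M) \<le> ennreal (s powr p * vol y (lam * r))"
    have g_borel: "g \<in> borel_measurable borel" using ug by (simp add: upper_gradient_def)
    note [measurable] = mms_borel_measurable[OF M g_borel]
    define V where "V = vol y (lam * r)"
    have V: "0 < V" unfolding V_def using r C by (intro vol_pos) simp
    define X where "X = (\<integral>z\<in>ball y r. \<bar>f z - avg M (ball y r) f\<bar> \<partial>M)"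
    \<comment> \<open>The interpolation needs \<open>t > 0\<close> while \<open>s\<close> may be 0;
      hence the estimate for every \<open>t > s\<close>, followed by the limit.\<close>
    have X_le: "X \<le> 2 * C * r * t * vol y r" if t: "s < t" for t
    proof -
      have t0: "0 < t" using s t by simp
      have "(\<integral>\<^sup>+z. epow (g z) p0 * indicator (ball y (lam * r)) z \<partial>M) \<le>
        (\<integral>\<^sup>+z. ennreal (t powr p0) * indicator (ball y (lam * r)) z +
          ennreal (t powr (p0 - p)) * (epow (g z) p * indicator (ball y (lam * r)) z) \<partial>M)"
        using epow_le_interpolate[OF t0, of p0 p] p by (intro nn_integral_mono) (auto simp: indicator_def)
      also have "\<dots> = ennreal (t powr p0) * ennreal V +
          ennreal (t powr (p0 - p)) * (\<integral>\<^sup>+z. epow (g z) p * indicator (ball y (lam * r)) z \<partial>M)"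
        by (simp add: nn_integral_add nn_integral_cmult nn_integral_cmult_indicator emeasure_ball V_def)
      also have "\<dots> \<le> ennreal (t powr p0) * ennreal V + ennreal (t powr (p0 - p)) * ennreal (s powr p * V)"
        using s(2) by (intro add_left_mono mult_left_mono) (auto simp: V_def)
      also have "\<dots> \<le> ennreal (t powr p0) * ennreal V + ennreal (t powr (p0 - p)) * ennreal (t powr p * V)"
        using s t V p by (intro add_left_mono mult_left_mono ennreal_leI mult_right_mono powr_mono2) auto
      also have "\<dots> = ennreal (2 * t powr p0 * V)"
        using V by (simp add: mult.assoc[symmetric] flip: ennreal_mult ennreal_plus powr_add)
      finally have "(\<integral>\<^sup>+z. epow (g z) p0 * indicator (ball y (lam * r)) z \<partial>M) / ennreal V \<le> ennreal (2 * t powr p0 * V) / ennreal V"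
        by (rule divide_right_mono_ennreal)
      also have "\<dots> = ennreal (2 * t powr p0)" using V by (simp add: divide_ennreal)
      finally have "epow ((\<integral>\<^sup>+z. epow (g z) p0 * indicator (ball y (lam * r)) z \<partial>M) / ennreal V) (1 / p0)
          \<le> epow (ennreal (2 * t powr p0)) (1 / p0)"
        using p by (intro epow_mono) auto
      also have "\<dots> = ennreal (2 powr (1 / p0) * t)"
        using p t0 by (simp add: powr_mult powr_powr)
      also have "\<dots> \<le> ennreal (2 * t)"
        using p t0 powr_mono[of "1 / p0" 1 2] by (intro ennreal_leI mult_right_mono) auto
      finally have "ennreal (C * r) * epow ((\<integral>\<^sup>+z. epow (g z) p0 * indicator (ball y (lam * r)) z \<partial>M) / ennreal V) (1 / p0)
          \<le> ennreal (C * r) * ennreal (2 * t)" by (rule mult_left_mono) simp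
      also have "\<dots> = ennreal (2 * C * r * t)" using C r t0 by (simp add: mult_ac flip: ennreal_mult)
      finally have "ennreal (X / vol y r) \<le> ennreal (2 * C * r * t)"
        using PI[OF r f ug] unfolding X_def V_def by (rule order_trans[rotated])
      then have "X / vol y r \<le> 2 * C * r * t" using C r t0 by (simp add: ennreal_le_iff)
      then show ?thesis using vol_pos[OF r, of y] by (simp add: divide_le_eq)
    qed
    have pos: "0 < 2 * C * r * vol y r" using vol_pos[OF r, of y] C r by simp
    have "X / (2 * C * r * vol y r) \<le> t" if "s < t" for t
      unfolding pos_divide_le_eq[OF pos] using X_le[OF that] by (simp only: mult_ac)
    then have "X / (2 * C * r * vol y r) \<le> s" by (rule dense_ge)
    then show "(\<integral>z\<in>ball y r. \<bar>f z - avg M (ball y r) f\<bar> \<partial>M) \<le> 2 * C * r * s * vol y r"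
      unfolding pos_divide_le_eq[OF pos] by (simp only: X_def mult_ac)
  qed
  then show ?thesis by blast
qed

lemma ex_far_point:
  fixes x :: "'a::metric_space"
  assumes "ereal (4 * R) < diam_X TYPE('a)"
  shows "\<exists>z. 2 * R \<le> dist x z"
proof -
  from assms obtain a b :: 'a where "4 * R < dist a b"
    unfolding diam_X_def less_SUP_iff by auto
  moreover have "dist a b \<le> dist x a + dist x b" by (metis dist_commute dist_triangle)
  ultimately have "2 * R \<le> dist x a \<or> 2 * R \<le> dist x b" by linarith
  then show ?thesis by blast
qed

section \<open>Two-sided capacity bounds\<close>

context poincare_space
begin

text \<open>Serves both exponent hypotheses: \<open>lo\<close> and \<open>up\<close> stand for the
  normalised volumes at the two ends of the range, in one order for \<open>lowerQ0\<close> and in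
  the other for \<open>upperQ0\<close>.\<close>

lemma capacity_bounds_of_growth:
  fixes lo up :: "real \<Rightarrow> real \<Rightarrow> real"
  assumes far: "\<exists>z. 2 * R0 \<le> dist x z" and E: "0 < E" and C: "0 < C"
    and lo_pos: "\<And>r R. 0 < r \<Longrightarrow> 2 * r \<le> R \<Longrightarrow> R \<le> R0 \<Longrightarrow> 0 < lo r R"
    and lo: "\<And>r R \<rho>. 0 < r \<Longrightarrow> 2 * r \<le> R \<Longrightarrow> R \<le> R0 \<Longrightarrow> r / 2 \<le> \<rho> \<Longrightarrow> \<rho> \<le> 8 * R \<Longrightarrow>
      lo r R \<le> E * (vol x \<rho> / \<rho> powr p)"
    and up: "\<And>r R \<rho>. 0 < r \<Longrightarrow> 2 * r \<le> R \<Longrightarrow> R \<le> R0 \<Longrightarrow> r \<le> \<rho> \<Longrightarrow> \<rho> \<le> R \<Longrightarrow>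
      vol x \<rho> / \<rho> powr p \<le> C * up r R"
  shows "\<exists>C>0. \<forall>r R. 0 < r \<and> 2*r \<le> R \<and> R \<le> R0 \<longrightarrow>
          ennreal (lo r R * ln (R/r) powr (1-p)) \<le> ennreal C * cap_p M p (ball x r) (ball x R) \<and>
          cap_p M p (ball x r) (ball x R) \<le> ennreal (C * (up r R * ln (R/r) powr (1-p)))"
proof -
  obtain CU where CU: "0 < CU" and upper: "\<And>x r R A. 0 < r \<and> 2 * r \<le> R \<and> 0 \<le> A \<and>
      (\<forall>\<rho>. r \<le> \<rho> \<and> \<rho> \<le> R \<longrightarrow> vol x \<rho> / \<rho> powr p \<le> A) \<Longrightarrow>
    cap_p M p (ball x r) (ball x R) \<le> ennreal (CU * (A * ln (R / r) powr (1 - p)))"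
    using ex_cap_upper_bound_log by blast
  obtain CL where CL: "0 < CL" and lower: "\<And>x r R A. 0 < r \<and> 2 * r \<le> R \<and> (\<exists>z. 2 * R \<le> dist x z) \<and> 0 < A \<and>
      (\<forall>\<rho>. r / 2 \<le> \<rho> \<and> \<rho> \<le> 8 * R \<longrightarrow> A \<le> vol x \<rho> / \<rho> powr p) \<Longrightarrow>
    ennreal (A * ln (R / r) powr (1 - p)) \<le> ennreal CL * cap_p M p (ball x r) (ball x R)"
    using ex_cap_lower_bound_log by blast
  define C' where "C' = max (CL * E) (CU * C)"
  have C': "CL * E \<le> C'" "CU * C \<le> C'" "0 < C'" using CU C by (auto simp: C'_def less_max_iff_disj)
  show ?thesis
  proof (intro exI[of _ C'] conjI allI impI; (elim conjE)?)
    show "0 < C'" by fact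
  next
    fix r R assume r: "0 < r" "2 * r \<le> R" "R \<le> R0"
    define A where "A = lo r R / E"
    have A: "0 < A" using E lo_pos[OF r] by (simp add: A_def)
    have "A \<le> vol x \<rho> / \<rho> powr p" if "r / 2 \<le> \<rho>" "\<rho> \<le> 8 * R" for \<rho>
      using lo[OF r that] E unfolding A_def by (simp only: pos_divide_le_eq mult.commute)
    moreover obtain z where "2 * R0 \<le> dist x z" using far by blast
    then have "\<exists>z. 2 * R \<le> dist x z" using r(3) by (intro exI[of _ z]) linarith
    ultimately have "ennreal (A * ln (R / r) powr (1 - p)) \<le> ennreal CL * cap_p M p (ball x r) (ball x R)"
      using A r by (intro lower) auto
    then have "ennreal E * ennreal (A * ln (R / r) powr (1 - p)) \<le>
        ennreal E * (ennreal CL * cap_p M p (ball x r) (ball x R))" by (rule mult_left_mono) simp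
    moreover have "ennreal E * ennreal (A * ln (R / r) powr (1 - p)) = ennreal (lo r R * ln (R/r) powr (1-p))"
      using lo_pos[OF r] E by (simp add: A_def flip: ennreal_mult)
    moreover have "ennreal E * (ennreal CL * cap_p M p (ball x r) (ball x R)) =
        ennreal (CL * E) * cap_p M p (ball x r) (ball x R)"
      using E CL by (simp add: ennreal_mult mult_ac)
    moreover have "\<dots> \<le> ennreal C' * cap_p M p (ball x r) (ball x R)"
      using C' by (intro mult_right_mono ennreal_leI) auto
    ultimately show "ennreal (lo r R * ln (R/r) powr (1-p)) \<le> ennreal C' * cap_p M p (ball x r) (ball x R)"
      by simp
    have "0 \<le> vol x r / r powr p" by simp
    also have "\<dots> \<le> C * up r R" using r by (intro up) auto
    finally have nn: "0 \<le> C * up r R" .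
    then have "0 \<le> up r R" using C by (simp add: zero_le_mult_iff)
    have "cap_p M p (ball x r) (ball x R) \<le> ennreal (CU * (C * up r R * ln (R / r) powr (1 - p)))"
      using up[OF r] r nn by (intro upper) blast
    also have "\<dots> \<le> ennreal (C' * (up r R * ln (R/r) powr (1-p)))"
      using mult_right_mono[OF C'(2), of "up r R * ln (R/r) powr (1-p)"] \<open>0 \<le> up r R\<close>
      by (intro ennreal_leI) (simp add: mult.assoc)
    finally show "cap_p M p (ball x r) (ball x R) \<le> ennreal (C' * (up r R * ln (R/r) powr (1-p)))" .
  qed
qed

lemma capacity_bounds_lowerQ0:
  assumes x: "p \<in> lowerQ0 M x" and R0: "0 < R0" and far: "\<exists>z. 2 * R0 \<le> dist x z"
  shows "\<exists>C>0. \<forall>r R. 0 < r \<and> 2*r \<le> R \<and> R \<le> R0 \<longrightarrow>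
          ennreal (vol x r / r powr p * ln (R/r) powr (1-p)) \<le> ennreal C * cap_p M p (ball x r) (ball x R) \<and>
          cap_p M p (ball x r) (ball x R) \<le> ennreal (C * (vol x R / R powr p * ln (R/r) powr (1-p)))"
proof -
  obtain C where C: "0 < C" and growth: "\<And>s t. 0 < s \<Longrightarrow> s \<le> t \<Longrightarrow> t \<le> 8 * R0 \<Longrightarrow>
      vol x s / s powr p \<le> C * (vol x t / t powr p)"
    using lowerQ0_growth[OF x, of "8 * R0"] R0 by auto
  show ?thesis
  proof (rule capacity_bounds_of_growth[OF far _ C])
    \<comment> \<open>\<open>D\<close> pays for passing from \<open>r\<close> to the smallest radius
      \<open>r / 2\<close>.\<close>
    show "0 < D * C" using C D_ge_1 by simp
    fix r R assume r: "0 < r" "2 * r \<le> R" "R \<le> R0"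
    show "0 < vol x r / r powr p" using r vol_pos[of r x] by simp
    fix \<rho>
    show "vol x \<rho> / \<rho> powr p \<le> C * (vol x R / R powr p)" if "r \<le> \<rho>" "\<rho> \<le> R"
      using that r R0 by (intro growth) auto
    assume \<rho>: "r / 2 \<le> \<rho>" "\<rho> \<le> 8 * R"
    have "vol x r / r powr p \<le> D * vol x (r / 2) / (r / 2) powr p"
      using doubling[of "r / 2" x] r p_gt_1 D_ge_1 by (intro frac_le powr_mono2) auto
    also have "\<dots> = D * (vol x (r / 2) / (r / 2) powr p)" by simp
    also have "\<dots> \<le> D * (C * (vol x \<rho> / \<rho> powr p))"
      using \<rho> r D_ge_1 by (intro mult_left_mono growth) auto
    finally show "vol x r / r powr p \<le> D * C * (vol x \<rho> / \<rho> powr p)" by (simp only: mult.assoc)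
  qed
qed

lemma capacity_bounds_upperQ0:
  assumes x: "p \<in> upperQ0 M x" and R0: "0 < R0" and far: "\<exists>z. 2 * R0 \<le> dist x z"
  shows "\<exists>C>0. \<forall>r R. 0 < r \<and> 2*r \<le> R \<and> R \<le> R0 \<longrightarrow>
          ennreal (vol x R / R powr p * ln (R/r) powr (1-p)) \<le> ennreal C * cap_p M p (ball x r) (ball x R) \<and>
          cap_p M p (ball x r) (ball x R) \<le> ennreal (C * (vol x r / r powr p * ln (R/r) powr (1-p)))"
proof -
  obtain C where C: "0 < C" and growth: "\<And>s t. 0 < s \<Longrightarrow> s \<le> t \<Longrightarrow> t \<le> 8 * R0 \<Longrightarrow>
      vol x t / t powr p \<le> C * (vol x s / s powr p)"
    using upperQ0_growth[OF x, of "8 * R0"] R0 by auto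
  show ?thesis
  proof (rule capacity_bounds_of_growth[OF far _ C])
    \<comment> \<open>\<open>8 powr p\<close> pays for passing from \<open>R\<close> to the largest
      radius \<open>8 * R\<close>.\<close>
    show "0 < 8 powr p * C" using C by simp
    fix r R assume r: "0 < r" "2 * r \<le> R" "R \<le> R0"
    then have R: "0 < R" by simp
    then show "0 < vol x R / R powr p" using vol_pos[of R x] by simp
    fix \<rho>
    show "vol x \<rho> / \<rho> powr p \<le> C * (vol x r / r powr p)" if "r \<le> \<rho>" "\<rho> \<le> R"
      using that r R0 by (intro growth) auto
    assume \<rho>: "r / 2 \<le> \<rho>" "\<rho> \<le> 8 * R"
    have "vol x R / R powr p \<le> 8 powr p * (vol x (8 * R) / (8 * R) powr p)"
      using R by (simp add: powr_mult divide_right_mono vol_mono_radius)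
    also have "\<dots> \<le> 8 powr p * (C * (vol x \<rho> / \<rho> powr p))"
      using \<rho> r by (intro mult_left_mono growth) auto
    finally show "vol x R / R powr p \<le> 8 powr p * C * (vol x \<rho> / \<rho> powr p)" by (simp only: mult.assoc)
  qed
qed

section \<open>Cutoffs at one scale and the converse statements\<close>

lemma cap_le_outer:
  assumes "0 < r" "2 * r \<le> R"
  shows "cap_p M p (ball x r) (ball x R) \<le> ennreal (2 powr p * (vol x R / R powr p))"
  using cap_upper_bound[of p "R / 2" r 1 R "vol x R / R powr p" x] assms p_gt_1 by simp

text \<open>The cutoff falls between \<open>r\<close> and \<open>2 * r\<close>; the factor
  \<open>2 powr p\<close> of the general bound cancels against
  \<open>(2 * r) powr p\<close>.\<close>

lemma cap_le_inner:
  assumes "0 < r" "2 * r \<le> R"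
  shows "cap_p M p (ball x r) (ball x R) \<le> ennreal (D * (vol x r / r powr p))"
proof -
  have "cap_p M p (ball x r) (ball x R) \<le> ennreal (2 powr p * (D * vol x r / (2 * r) powr p) * real 1 powr (1 - p))"
    using assms p_gt_1 D_ge_1 doubling[of r x] by (intro cap_upper_bound) auto
  then show ?thesis using assms by (simp add: powr_mult)
qed

lemma le_Sup_lowerQ0:
  assumes R0: "0 < R0" and C: "0 < C"
    and lower: "\<And>r R. 0 < r \<Longrightarrow> 2*r \<le> R \<Longrightarrow> R \<le> R0 \<Longrightarrow>
      ennreal (vol x r / r powr p * ln (R/r) powr (1-p)) \<le> ennreal C * cap_p M p (ball x r) (ball x R)"
  shows "ereal p \<le> Sup (ereal ` lowerQ0 M x)"
proof (rule ccontr)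
  assume "\<not> ?thesis"
  \<comment> \<open>The maximum with 0 yields a positive \<open>q\<close> even if
    \<open>lowerQ0 M x\<close> is empty, where the supremum is \<open>- \<infinity>\<close>.\<close>
  then have "max 0 (Sup (ereal ` lowerQ0 M x)) < ereal p" using p_gt_1 by (simp add: zero_ereal_def)
  then obtain q where q: "max 0 (Sup (ereal ` lowerQ0 M x)) < ereal q" "q < p"
    using ereal_dense2 by (metis less_ereal.simps(1))
  have q0: "0 < q" using q(1) by (simp add: zero_ereal_def)
  have "q \<in> lowerQ0 M x"
  proof (rule lowerQ0_memI[OF q0 q(2) p_gt_1 R0])
    show "0 < C * 2 powr p" using C by simp
    fix r R assume r: "0 < r" "2 * r \<le> R" "R \<le> R0"
    have "ennreal (vol x r / r powr p * ln (R/r) powr (1-p)) \<le> ennreal C * cap_p M p (ball x r) (ball x R)"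
      by (rule lower[OF r])
    also have "\<dots> \<le> ennreal C * ennreal (2 powr p * (vol x R / R powr p))"
      using r by (intro mult_left_mono cap_le_outer) auto
    also have "\<dots> = ennreal (C * 2 powr p * (vol x R / R powr p))"
      using C by (simp add: mult.assoc flip: ennreal_mult)
    finally show "vol x r / r powr p * ln (R / r) powr (1 - p) \<le> C * 2 powr p * (vol x R / R powr p)"
      using C by (simp add: ennreal_le_iff)
  qed
  then have "ereal q \<le> Sup (ereal ` lowerQ0 M x)" by (intro Sup_upper) simp
  from leD[OF this] q(1) show False by simp
qed

lemma Inf_upperQ0_le:
  assumes R0: "0 < R0" and C: "0 < C"
    and lower: "\<And>r R. 0 < r \<Longrightarrow> 2*r \<le> R \<Longrightarrow> R \<le> R0 \<Longrightarrow>
      ennreal (vol x R / R powr p * ln (R/r) powr (1-p)) \<le> ennreal C * cap_p M p (ball x r) (ball x R)"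
  shows "Inf (ereal ` upperQ0 M x) \<le> ereal p"
proof (rule ccontr)
  assume "\<not> ?thesis"
  then obtain q where q: "ereal q < Inf (ereal ` upperQ0 M x)" "p < q"
    using ereal_dense2 by (metis less_ereal.simps(1) not_le)
  have "q \<in> upperQ0 M x"
  proof (rule upperQ0_memI[OF q(2) p_gt_1 R0])
    show "0 < C * D" using C D_ge_1 by simp
    fix r R assume r: "0 < r" "2 * r \<le> R" "R \<le> R0"
    have "ennreal (vol x R / R powr p * ln (R/r) powr (1-p)) \<le> ennreal C * cap_p M p (ball x r) (ball x R)"
      by (rule lower[OF r])
    also have "\<dots> \<le> ennreal C * ennreal (D * (vol x r / r powr p))"
      using r by (intro mult_left_mono cap_le_inner) auto
    also have "\<dots> = ennreal (C * D * (vol x r / r powr p))"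
      using C D_ge_1 by (simp add: mult.assoc flip: ennreal_mult)
    finally show "vol x R / R powr p * ln (R / r) powr (1 - p) \<le> C * D * (vol x r / r powr p)"
      using C D_ge_1 by (simp add: ennreal_le_iff)
  qed
  then have "Inf (ereal ` upperQ0 M x) \<le> ereal q" by (intro Inf_lower) simp
  with q(1) show False by simp
qed

end

theorem theorem1p2:
  fixes M :: "'a::metric_space measure" and x :: 'a and R0 p p0 :: real
  assumes "mms M" and "globally_doubling M"
    and "0 < R0" and "ereal (4 * R0) < diam_X TYPE('a)"
    and "1 < p" and "1 \<le> p0" and "p0 < p" and "global_poincare M p0"
  shows
   "(p \<in> lowerQ0 M x \<and> (\<forall>q\<in>lowerQ0 M x. q \<le> p) \<longrightarrow>
       (\<exists>C>0. \<forall>r R. 0 < r \<and> 2*r \<le> R \<and> R \<le> R0 \<longrightarrow>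
          ennreal (measure M (ball x r) / r powr p * ln (R/r) powr (1-p))
            \<le> ennreal C * cap_p M p (ball x r) (ball x R) \<and>
          cap_p M p (ball x r) (ball x R)
            \<le> ennreal (C * (measure M (ball x R) / R powr p * ln (R/r) powr (1-p)))))
  \<and> (p \<in> upperQ0 M x \<and> (\<forall>q\<in>upperQ0 M x. p \<le> q) \<longrightarrow>
       (\<exists>C>0. \<forall>r R. 0 < r \<and> 2*r \<le> R \<and> R \<le> R0 \<longrightarrow>
          ennreal (measure M (ball x R) / R powr p * ln (R/r) powr (1-p))
            \<le> ennreal C * cap_p M p (ball x r) (ball x R) \<and>
          cap_p M p (ball x r) (ball x R)
            \<le> ennreal (C * (measure M (ball x r) / r powr p * ln (R/r) powr (1-p)))))
  \<and> ((\<exists>C>0. \<forall>r R. 0 < r \<and> 2*r \<le> R \<and> R \<le> R0 \<longrightarrow>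
          ennreal (measure M (ball x r) / r powr p * ln (R/r) powr (1-p))
            \<le> ennreal C * cap_p M p (ball x r) (ball x R))
       \<longrightarrow> ereal p \<le> Sup (ereal ` lowerQ0 M x))
  \<and> ((\<exists>C>0. \<forall>r R. 0 < r \<and> 2*r \<le> R \<and> R \<le> R0 \<longrightarrow>
          ennreal (measure M (ball x R) / R powr p * ln (R/r) powr (1-p))
            \<le> ennreal C * cap_p M p (ball x r) (ball x R))
       \<longrightarrow> Inf (ereal ` upperQ0 M x) \<le> ereal p)"
proof -
  obtain D K lam where "poincare_space M D p K lam"
    using ex_poincare_space[OF assms(1,2,6,7,8)] by blast
  then interpret poincare_space M D p K lam .
  have far: "\<exists>z. 2 * R0 \<le> dist x z" by (rule ex_far_point[OF assms(4)])
  show ?thesis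
  proof (intro conjI impI)
    assume "p \<in> lowerQ0 M x \<and> (\<forall>q\<in>lowerQ0 M x. q \<le> p)"
    then show "\<exists>C>0. \<forall>r R. 0 < r \<and> 2*r \<le> R \<and> R \<le> R0 \<longrightarrow>
          ennreal (measure M (ball x r) / r powr p * ln (R/r) powr (1-p))
            \<le> ennreal C * cap_p M p (ball x r) (ball x R) \<and>
          cap_p M p (ball x r) (ball x R)
            \<le> ennreal (C * (measure M (ball x R) / R powr p * ln (R/r) powr (1-p)))"
      by (intro capacity_bounds_lowerQ0[OF _ assms(3) far]) blast
  next
    assume "p \<in> upperQ0 M x \<and> (\<forall>q\<in>upperQ0 M x. p \<le> q)"
    then show "\<exists>C>0. \<forall>r R. 0 < r \<and> 2*r \<le> R \<and> R \<le> R0 \<longrightarrow>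
          ennreal (measure M (ball x R) / R powr p * ln (R/r) powr (1-p))
            \<le> ennreal C * cap_p M p (ball x r) (ball x R) \<and>
          cap_p M p (ball x r) (ball x R)
            \<le> ennreal (C * (measure M (ball x r) / r powr p * ln (R/r) powr (1-p)))"
      by (intro capacity_bounds_upperQ0[OF _ assms(3) far]) blast
  next
    assume "\<exists>C>0. \<forall>r R. 0 < r \<and> 2*r \<le> R \<and> R \<le> R0 \<longrightarrow>
          ennreal (measure M (ball x r) / r powr p * ln (R/r) powr (1-p))
            \<le> ennreal C * cap_p M p (ball x r) (ball x R)"
    then show "ereal p \<le> Sup (ereal ` lowerQ0 M x)"
      using le_Sup_lowerQ0[OF assms(3)] by blast
  next
    assume "\<exists>C>0. \<forall>r R. 0 < r \<and> 2*r \<le> R \<and> R \<le> R0 \<longrightarrow>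
          ennreal (measure M (ball x R) / R powr p * ln (R/r) powr (1-p))
            \<le> ennreal C * cap_p M p (ball x r) (ball x R)"
    then show "Inf (ereal ` upperQ0 M x) \<le> ereal p"
      using Inf_upperQ0_le[OF assms(3)] by blast
  qed
qed

end
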